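(* Let $X,Y$ be real nonzero Banach spaces, $S:X\rightrightarrows X^*$ and $T:Y\rightrightarrows Y^*$ maximal monotone operators of Gossez type (D) with strong representative functions $h_S$ and $h_T$, and $A:X\to Y$ linear continuous with $\big(\operatorname{dom}h_T\times\operatorname{pr}_{X^*}(\operatorname{dom}h_S)\big)\cap\big(\operatorname{im}A\times\Delta_{Y^*}^{A^*}\big)\neq\emptyset$. Assume one of: (a) $(0,0,0)\in{}^{ic}\big(\operatorname{dom}h_T\times\operatorname{pr}_{X^*}(\operatorname{dom}h_S)-\operatorname{im}A\times\Delta_{Y^*}^{A^*}\big)$; (b) the set $\{(u^*,A^*v^*,A^{**}u^{**}+v^{**},r): r\in\mathbb R,\ h_S^*(u^*,u^{**})+h_T^*(v^*,v^{**})\le r\}$ is closed regarding $\Delta_{X^*}\times\operatorname{im}A^{**}\times\mathbb R$ in $(X^*,w^* )\times(X^*,w^* )\times(Y^{**},w^* )\times\mathbb R$. Then $h:=\operatorname{cl}_{\|\cdot\|\times\|\cdot\|_*}(h_S\bigcirc_1^A h_T)$ is a strong representative function of $\overline S\|_A\overline T$, and $\overline S\|_A\overline T$ is a maximal monotone operator of Gossez type (D).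
   Context: $X$ is identified with its canonical image in $X^{**}$ (same for $Y$). For an operator $M$, $G(M)$ is its graph and $M^{-1}$ the operator with inverse graph. Coupling $c(x,x^* )=\langle x^*,x\rangle$. Conjugate of $h:X\times X^*\to\overline{\mathbb R}$: $h^*(x^*,x^{**})=\sup_{(x,y^* )}\{\langle x^*,x\rangle+\langle x^{**},y^*\rangle-h(x,y^* )\}$ on $X^*\times X^{**}$. A representative function of a monotone $S$ is a convex, norm-lower semicontinuous $h_S:X\times X^*\to\overline{\mathbb R}$ with $h_S\ge c$ and $G(S)\subseteq\{(x,x^* ):h_S(x,x^* )=\langle x^*,x\rangle\}$; it is strong if moreover $h_S^*(x^*,x^{**})\ge\langle x^{**},x^*\rangle$ for all $(x^*,x^{**})$. Gossez's monotone closure $\overline S:X^{**}\rightrightarrows X^*$ has graph $\{(x^{**},x^* ):\langle x^{**}-y,x^*-y^*\rangle\ge0\ \forall(y,y^* )\in G(S)\}$; a maximal monotone $S$ is of Gossez type (D) if each $(x^{**},x^* )\in G(\overline S)$ is the $w^*\times\|\cdot\|_*$-limit of a bounded net in $G(S)$. $A^*,A^{**}$ are adjoint and biadjoint; $\operatorname{im}A=A(X)$; $\Delta_{X^*}=\{(x^*,x^* )\}$; $\Delta_{Y^*}^{A^*}=\{(y^*,A^*y^* ):y^*\in Y^*\}$; $\operatorname{pr}_{X^*}$ projection. $(h_S\bigcirc_1^A h_T)(x,x^* )=\inf\{h_S(u,x^* )+h_T(Aw,v^* ):u,w\in X,\ v^*\in Y^*,\ u+w=x,\ A^*v^*=x^*\}$.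 The extended generalized parallel sum is $\overline S\|_A\overline T:X\rightrightarrows X^*$, $\overline S\|_A\overline T(x)=(\overline S^{-1}+(A^*\overline TA^{**})^{-1})^{-1}(x)$ for $x\in X$. A set $D$ is closed regarding $W$ if $\operatorname{cl}D\cap W=D\cap W$. ${}^{ic}D=\operatorname{icr}D$ if $\operatorname{aff}D$ is closed, else $\emptyset$, where $\operatorname{icr}D=\{u:\forall x\in\operatorname{aff}(D-D)\ \exists\delta>0\ \forall\lambda\in[0,\delta]:\ u+\lambda x\in D\}$. *)

theory Defs
  imports "HOL-Analysis.Analysis"
begin

type_synonym 'a dual = "'a \<Rightarrow>\<^sub>L real"

definition canon :: "'a::real_normed_vector \<Rightarrow> 'a dual dual" where
  "canon x = Blinfun (\<lambda>f. blinfun_apply f x)"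

definition adjoint_op :: "('a::real_normed_vector \<Rightarrow>\<^sub>L 'b::real_normed_vector) \<Rightarrow> ('b dual \<Rightarrow>\<^sub>L 'a dual)" where
  "adjoint_op A = Blinfun (\<lambda>y. y o\<^sub>L A)"

definition wstar :: "('a::real_normed_vector dual) topology" where
  "wstar = topology_generated_by {{f. blinfun_apply f x \<in> U} | x U. open U}"

text \<open>Operators X \<rightrightarrows> X* are identified with their graphs.\<close>
definition monotone_op :: "('a::real_normed_vector \<times> 'a dual) set \<Rightarrow> bool" where
  "monotone_op S \<longleftrightarrow> (\<forall>(x, xs)\<in>S. \<forall>(y, ys)\<in>S. 0 \<le> blinfun_apply (xs - ys) (x - y))"

definition maximal_monotone :: "('a::real_normed_vector \<times> 'a dual) set \<Rightarrow> bool" where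
  "maximal_monotone S \<longleftrightarrow> monotone_op S \<and> (\<forall>S'. monotone_op S' \<and> S \<subseteq> S' \<longrightarrow> S' = S)"

definition gossez_closure :: "('a::real_normed_vector \<times> 'a dual) set \<Rightarrow> ('a dual dual \<times> 'a dual) set" where
  "gossez_closure S = {(xss, xs). \<forall>(y, ys)\<in>S. 0 \<le> blinfun_apply (xss - canon y) (xs - ys)}"

text \<open>Type (D): every point of the Gossez closure is the w* x norm limit of a bounded net in G(S).
  Nets are represented by (proper) filters on G(S).\<close>
definition gossez_D :: "('a::real_normed_vector \<times> 'a dual) set \<Rightarrow> bool" where
  "gossez_D S \<longleftrightarrow> maximal_monotone S \<and>
     (\<forall>(xss, xs)\<in>gossez_closure S. \<exists>(F :: ('a \<times> 'a dual) filter) B.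
        F \<noteq> bot \<and> bounded B \<and> B \<subseteq> S \<and> eventually (\<lambda>p. p \<in> B) F \<and>
        limitin (prod_topology wstar euclidean) (\<lambda>(x, xs). (canon x, xs)) (xss, xs) F)"

definition edom :: "('a \<Rightarrow> ereal) \<Rightarrow> 'a set" where
  "edom h = {p. h p < \<infinity>}"

definition fconj :: "('a::real_normed_vector \<times> 'a dual \<Rightarrow> ereal) \<Rightarrow> ('a dual \<times> 'a dual dual \<Rightarrow> ereal)" where
  "fconj h = (\<lambda>(xs, xss). SUP p \<in> UNIV. ereal (blinfun_apply xs (fst p) + blinfun_apply xss (snd p)) - h p)"

text \<open>Convexity and (norm) lower semicontinuity of extended-real functions via the epigraph.\<close>
definition epi :: "('a \<Rightarrow> ereal) \<Rightarrow> ('a \<times> real) set" where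
  "epi h = {(p, r). h p \<le> ereal r}"

definition representative :: "('a::real_normed_vector \<times> 'a dual) set \<Rightarrow> ('a \<times> 'a dual \<Rightarrow> ereal) \<Rightarrow> bool" where
  "representative S h \<longleftrightarrow> convex (epi h) \<and> closed (epi h) \<and>
     (\<forall>x xs. ereal (blinfun_apply xs x) \<le> h (x, xs)) \<and>
     (\<forall>(x, xs)\<in>S. h (x, xs) = ereal (blinfun_apply xs x))"

definition strong_representative :: "('a::real_normed_vector \<times> 'a dual) set \<Rightarrow> ('a \<times> 'a dual \<Rightarrow> ereal) \<Rightarrow> bool" where
  "strong_representative S h \<longleftrightarrow> representative S h \<and>
     (\<forall>xs xss. ereal (blinfun_apply xss xs) \<le> fconj h (xs, xss))"

definition inf_conv1 :: "('a::real_normed_vector \<Rightarrow>\<^sub>L 'b::real_normed_vector) \<Rightarrow>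
    ('a \<times> 'a dual \<Rightarrow> ereal) \<Rightarrow> ('b \<times> 'b dual \<Rightarrow> ereal) \<Rightarrow> ('a \<times> 'a dual \<Rightarrow> ereal)" where
  "inf_conv1 A hS hT = (\<lambda>(x, xs). INF q \<in> {(u, w, vs). u + w = x \<and> adjoint_op A vs = xs}.
      hS (fst q, xs) + hT (blinfun_apply A (fst (snd q)), snd (snd q)))"

definition lsc_hull :: "('a::topological_space \<Rightarrow> ereal) \<Rightarrow> 'a \<Rightarrow> ereal" where
  "lsc_hull h p = Liminf (nhds p) h"

text \<open>Graph of the extended generalized parallel sum (S-bar^{-1} + (A* T-bar A**)^{-1})^{-1}, restricted to X.\<close>
definition par_sum :: "('a::real_normed_vector \<Rightarrow>\<^sub>L 'b::real_normed_vector) \<Rightarrow>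
    ('a \<times> 'a dual) set \<Rightarrow> ('b \<times> 'b dual) set \<Rightarrow> ('a \<times> 'a dual) set" where
  "par_sum A S T = {(x, xs). \<exists>uss vss ys. canon x = uss + vss \<and> (uss, xs) \<in> gossez_closure S \<and>
      (blinfun_apply (adjoint_op (adjoint_op A)) vss, ys) \<in> gossez_closure T \<and>
      blinfun_apply (adjoint_op A) ys = xs}"

definition set_minus :: "'a::ab_group_add set \<Rightarrow> 'a set \<Rightarrow> 'a set" where
  "set_minus D E = {d - e | d e. d \<in> D \<and> e \<in> E}"

definition icr :: "'a::real_vector set \<Rightarrow> 'a set" where
  "icr D = {u. \<forall>x\<in>affine hull (set_minus D D). \<exists>\<delta>>0. \<forall>l\<in>{0..\<delta>}. u + l *\<^sub>R x \<in> D}"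

definition ic :: "'a::real_normed_vector set \<Rightarrow> 'a set" where
  "ic D = (if closed (affine hull D) then icr D else {})"

definition closed_regarding :: "'a topology \<Rightarrow> 'a set \<Rightarrow> 'a set \<Rightarrow> bool" where
  "closed_regarding tp D W \<longleftrightarrow> (tp closure_of D) \<inter> W = D \<inter> W"

end

theory Submission
  imports Defs
begin

text \<open>Everything is read off epigraphs. For a closed convex \<open>E \<subseteq> (X \<times> X*) \<times> \<real>\<close> whose function and conjugate both
  dominate the coupling, Fenchel duality shows that the regularized infimum of \<open>E\<close> at any base point
  is \<open>\<le> 0\<close>. Iterating almost optimal points gives a Brondsted--Rockafellar property: a point of \<open>E\<close>
  with small defect is close to the contact set, where \<open>E\<close> touches the coupling. Testing a point \<open>(x**, x*)\<close>
  of the Gossez closure against almost optimal points, with a norm on \<open>X\<close> that weighs finitely many functionals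
  heavily and a base point supplied by Goldstine's theorem, yields a bounded net in the contact set converging
  to \<open>(x**, x*)\<close>. So the contact set is maximal monotone of type (D), and its Gossez closure is
  the set where the conjugate touches the coupling.

  It remains to split the conjugate of the infimal convolution as \<open>h_S* + h_T*\<close> with attainment. Under
  (a), a Robinson--Ursescu argument makes the value function of the perturbed problem bounded near \<open>0\<close>, hence
  subdifferentiable. Under (b), the splitting always holds up to weak* closure, by separation and the
  Fenchel--Moreau theorem. The splitting gives both the strong representative property and the identification of the
  contact set with the parallel sum.\<close>

section \<open>Hahn--Banach and separation\<close>

text \<open>\<open>X\<close> need not be reflexive, so the regularized problem need not have a
  minimizer, and every argument runs on almost optimal points with explicit errors; these errors
  decide the constants. The conjugate is handled through the relation \<open>conj_le\<close>,
  because real upper bounds avoid infinite sums, survive closure of the epigraph and can be split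
  between two summands. Two kinds of quadratic regularizer occur. Half the squared norm suffices for
  norm estimates, that is, for the Brondsted-Rockafellar property and for maximality. It gives no
  weak-star control near a point of the bidual; hence the general \<open>q\<close>. The delicate
  point of the approximation theorem is that the base point in \<open>X\<close> is chosen before the
  functional \<open>xs - xs0\<close> is known, although its value at this very functional matters.
  Attained splitting identifies the contact set with the parallel sum because two conjugate bounds,
  each at least its own coupling, can add up to the coupling of the sum only if both are equalities,
  and equality means membership in a Gossez closure.\<close>

definition sublinear :: "('v::real_vector \<Rightarrow> real) \<Rightarrow> bool" where
  "sublinear p \<longleftrightarrow> (\<forall>x y. p (x + y) \<le> p x + p y) \<and> (\<forall>c x. 0 \<le> c \<longrightarrow> p (c *\<^sub>R x) = c * p x)"

lemma sublinear_add: "sublinear p \<Longrightarrow> p (x + y) \<le> p x + p y"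
  and sublinear_scale: "sublinear p \<Longrightarrow> 0 \<le> c \<Longrightarrow> p (c *\<^sub>R x) = c * p x"
  by (auto simp: sublinear_def)

lemma sublinear_zero: "sublinear p \<Longrightarrow> p 0 = 0"
  using sublinear_scale[of p 0 0] by simp

lemma sublinear_minus: "sublinear p \<Longrightarrow> - p (- x) \<le> p x"
  using sublinear_add[of p x "- x"] sublinear_zero[of p] by simp

lemma sublinear_ge_of_pos_scale:
  assumes "\<And>x y. p (x + y) \<le> p x + p y" "\<And>c x. 0 < c \<Longrightarrow> p (c *\<^sub>R x) \<le> c * p x" "p 0 = 0"
  shows "sublinear p"
proof -
  have "p (c *\<^sub>R x) = c * p x" if "0 \<le> c" for c x
  proof (cases "c = 0")
    case False
    then have c: "0 < c" using that by simp
    have "p (inverse c *\<^sub>R (c *\<^sub>R x)) \<le> inverse c * p (c *\<^sub>R x)"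
      using assms(2) c by (metis positive_imp_inverse_positive)
    then have "c * p x \<le> p (c *\<^sub>R x)" using c by (simp add: field_simps)
    then show ?thesis using assms(2)[OF c, of x] by simp
  qed (simp add: assms(3))
  then show ?thesis using assms(1) by (auto simp: sublinear_def)
qed

text \<open>Tilting along \<open>y\<close> produces a smaller sublinear functional, so a minimal one is odd.\<close>

lemma sublinear_tilt:
  fixes x y :: "'v::real_vector"
  assumes p: "sublinear p"
  defines "q \<equiv> \<lambda>x. INF t\<in>{0..}. p (x + t *\<^sub>R y) - t * p y"
  shows "sublinear q" "q x \<le> p x" "q (- y) \<le> - p y"
proof -
  have lb: "- p (- x) \<le> p (x + t *\<^sub>R y) - t * p y" if "0 \<le> t" for x t
    using sublinear_add[OF p, of "x + t *\<^sub>R y" "- x"] sublinear_scale[OF p that, of y] by simp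
  then have bdd: "bdd_below ((\<lambda>t. p (x + t *\<^sub>R y) - t * p y) ` {0..})" for x
    by (intro bdd_belowI2[where m="- p (- x)"]) auto
  have le: "q x \<le> p (x + t *\<^sub>R y) - t * p y" if "0 \<le> t" for x t
    unfolding q_def by (rule cINF_lower[OF bdd]) (use that in auto)
  have ge: "m \<le> q x" if "\<And>t. 0 \<le> t \<Longrightarrow> m \<le> p (x + t *\<^sub>R y) - t * p y" for m x
    unfolding q_def by (rule cINF_greatest) (use that in auto)
  show "q x \<le> p x" using le[of 0 x] by simp
  show "q (- y) \<le> - p y" using le[of 1 "- y"] sublinear_zero[OF p] by simp
  show "sublinear q"
  proof (rule sublinear_ge_of_pos_scale)
    fix a b
    have "q (a + b) - (p (a + t *\<^sub>R y) - t * p y) \<le> q b" if t: "0 \<le> t" for t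
    proof (rule ge)
      fix s :: real assume s: "0 \<le> s"
      show "q (a + b) - (p (a + t *\<^sub>R y) - t * p y) \<le> p (b + s *\<^sub>R y) - s * p y"
        using le[of "t + s" "a + b"] s t sublinear_add[OF p, of "a + t *\<^sub>R y" "b + s *\<^sub>R y"]
        by (simp add: algebra_simps)
    qed
    then have "q (a + b) - q b \<le> q a" by (intro ge) (auto simp: algebra_simps)
    then show "q (a + b) \<le> q a + q b" by simp
  next
    fix c :: real and x assume c: "0 < c"
    have "q (c *\<^sub>R x) / c \<le> q x"
    proof (rule ge)
      fix t :: real assume t: "0 \<le> t"
      have "q (c *\<^sub>R x) \<le> p (c *\<^sub>R x + (c * t) *\<^sub>R y) - (c * t) * p y"
        using le[of "c * t"] c t by simp
      also have "p (c *\<^sub>R x + (c * t) *\<^sub>R y) = c * p (x + t *\<^sub>R y)"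
        using sublinear_scale[OF p, of c "x + t *\<^sub>R y"] c by (simp add: algebra_simps)
      finally show "q (c *\<^sub>R x) / c \<le> p (x + t *\<^sub>R y) - t * p y"
        using c by (simp add: field_simps)
    qed
    then show "q (c *\<^sub>R x) \<le> c * q x" using c by (simp add: field_simps)
  next
    have "0 \<le> q 0" by (rule ge) (simp add: sublinear_scale[OF p])
    moreover have "q 0 \<le> 0" using le[of 0 0] sublinear_zero[OF p] by simp
    ultimately show "q 0 = 0" by simp
  qed
qed

text \<open>Zorn's lemma is applied to the sublinear functionals below \<open>p\<close>, ordered
  downwards. A minimal one survives every tilt unchanged, hence is odd, and an odd sublinear
  functional is linear.\<close>

theorem hahn_banach_sublinear:
  fixes p :: "'v::real_vector \<Rightarrow> real"
  assumes p: "sublinear p"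
  shows "\<exists>\<phi>. linear \<phi> \<and> (\<forall>x. \<phi> x \<le> p x)"
proof -
  define A where "A = {q. sublinear q \<and> (\<forall>x. q x \<le> p x)}"
  define P where "P = (\<lambda>a b :: 'v \<Rightarrow> real. b \<le> a)"
  have "partial_order_on A (relation_of P A)"
    by (rule partial_order_on_relation_ofI) (auto simp: P_def)
  moreover have "\<exists>u\<in>A. \<forall>a\<in>C. P a u" if C: "C \<in> Chains (relation_of P A)" for C
  proof (cases "C = {}")
    case True
    then show ?thesis using p by (auto simp: A_def)
  next
    case False
    have CA: "C \<subseteq> A" using C unfolding Chains_def relation_of_def by blast
    have tot: "a \<le> b \<or> b \<le> a" if "a \<in> C" "b \<in> C" for a b
      using C that unfolding Chains_def relation_of_def P_def by blast
    define u where "u = (\<lambda>x. INF a\<in>C. a x)"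
    have sl: "sublinear a" "\<And>x. a x \<le> p x" if "a \<in> C" for a
      using CA that by (auto simp: A_def)
    have "- p (- x) \<le> a x" if "a \<in> C" for a x
      using sublinear_minus[OF sl(1)[OF that], of x] sl(2)[OF that, of "- x"] by simp
    then have bdd: "bdd_below ((\<lambda>a. a x) ` C)" for x
      by (intro bdd_belowI2[where m="- p (- x)"]) auto
    have le: "u x \<le> a x" if "a \<in> C" for a x
      unfolding u_def by (rule cINF_lower[OF bdd that])
    have ge: "m \<le> u x" if "\<And>a. a \<in> C \<Longrightarrow> m \<le> a x" for m x
      unfolding u_def by (rule cINF_greatest[OF False that])
    have "sublinear u"
    proof (rule sublinear_ge_of_pos_scale)
      fix x y
      have "u (x + y) - a x \<le> u y" if a: "a \<in> C" for a
      proof (rule ge)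
        fix b assume b: "b \<in> C"
        \<comment> \<open>Of two members of a chain the smaller one serves for both summands; an
          infimum of incomparable functionals need not be subadditive.\<close>
        show "u (x + y) - a x \<le> b y"
          using tot[OF a b] le[OF a, of "x + y"] le[OF b, of "x + y"]
            sublinear_add[OF sl(1)[OF a], of x y] sublinear_add[OF sl(1)[OF b], of x y]
          by (auto simp: le_fun_def) (smt (verit))+
      qed
      then have "u (x + y) - u y \<le> u x" by (intro ge) (auto simp: algebra_simps)
      then show "u (x + y) \<le> u x + u y" by simp
    next
      fix c :: real and x :: 'v assume c: "0 < c"
      have "u (c *\<^sub>R x) / c \<le> u x"
      proof (rule ge)
        fix a assume a: "a \<in> C"
        show "u (c *\<^sub>R x) / c \<le> a x"
          using le[OF a, of "c *\<^sub>R x"] sublinear_scale[OF sl(1)[OF a], of c x] c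
          by (simp add: field_simps)
      qed
      then show "u (c *\<^sub>R x) \<le> c * u x" using c by (simp add: field_simps)
    next
      obtain a where a: "a \<in> C" using False by blast
      have "0 \<le> u 0" by (rule ge) (simp add: sublinear_zero[OF sl(1)])
      moreover have "u 0 \<le> 0" using le[OF a, of 0] sublinear_zero[OF sl(1)[OF a]] by simp
      ultimately show "u 0 = 0" by simp
    qed
    moreover have "u x \<le> p x" for x
      using False le sl(2) by (meson ex_in_conv order_trans)
    ultimately have "u \<in> A" by (simp add: A_def)
    then show ?thesis using le by (auto simp: P_def le_fun_def)
  qed
  ultimately obtain q where q: "q \<in> A" and min: "\<And>a. a \<in> A \<Longrightarrow> P q a \<Longrightarrow> a = q"
    using predicate_Zorn[of A P] by blast
  have sq: "sublinear q" and qp: "\<And>x. q x \<le> p x" using q by (auto simp: A_def)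
  have odd: "q (- y) = - q y" for y
  proof -
    define q' where "q' = (\<lambda>x. INF t\<in>{0..}. q (x + t *\<^sub>R y) - t * q y)"
    have q': "sublinear q'" "\<And>x. q' x \<le> q x" "q' (- y) \<le> - q y"
      unfolding q'_def using sublinear_tilt[OF sq] by blast+
    have "q' x \<le> p x" for x using q'(2)[of x] qp[of x] by linarith
    then have "q' = q" using q' by (intro min) (auto simp: A_def P_def le_fun_def)
    then have "q (- y) \<le> - q y" using q'(3) by simp
    then show ?thesis using sublinear_minus[OF sq, of y] by simp
  qed
  have "linear q"
  proof (rule linearI)
    fix x y
    have "q (- x + - y) \<le> q (- x) + q (- y)" by (rule sublinear_add[OF sq])
    then show "q (x + y) = q x + q y"
      using odd[of "x + y"] odd[of x] odd[of y] sublinear_add[OF sq, of x y] by simp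
  next
    fix c :: real and x
    show "q (c *\<^sub>R x) = c *\<^sub>R q x"
    proof (cases "0 \<le> c")
      case False
      then have "q ((- c) *\<^sub>R (- x)) = (- c) * q (- x)" by (intro sublinear_scale[OF sq]) auto
      then show ?thesis using odd[of x] by simp
    qed (simp add: sublinear_scale[OF sq])
  qed
  then show ?thesis using qp by blast
qed

text \<open>The directional derivative \<open>p\<close> at \<open>0\<close> of the convex function whose epigraph is generated by
  \<open>E\<close> is sublinear.\<close>

theorem convex_subgradient_at_0:
  fixes E :: "('v::real_vector \<times> real) set"
  assumes E: "convex E"
    and absorb: "\<And>z. \<exists>t>0. \<exists>r. (t *\<^sub>R z, r) \<in> E"
    and zero: "\<And>r. (0, r) \<in> E \<Longrightarrow> m \<le> r"
  shows "\<exists>\<phi>. linear \<phi> \<and> (\<forall>(z, r)\<in>E. \<phi> z + m \<le> r)"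
proof -
  \<comment> \<open>\<open>Q z\<close> collects the difference quotients at \<open>0\<close> along
    \<open>z\<close>, measured from the lower bound \<open>m\<close>, which need not be
    attained.\<close>
  define Q where "Q z = {(r - m) / t | r t. 0 < t \<and> (t *\<^sub>R z, r) \<in> E}" for z
  define p where "p z = Inf (Q z)" for z
  \<comment> \<open>The weights are proportional to \<open>t2\<close> and \<open>t1\<close>, so that
    both directions are scaled by the same factor and their sum appears.\<close>
  have comb: "((t1 * t2 / (t1 + t2)) *\<^sub>R (z1 + z2), (t2 * r1 + t1 * r2) / (t1 + t2)) \<in> E"
    if "(t1 *\<^sub>R z1, r1) \<in> E" "(t2 *\<^sub>R z2, r2) \<in> E" "0 < t1" "0 < t2" for t1 t2 z1 z2 r1 r2
  proof -
    have "(t2 / (t1 + t2)) *\<^sub>R (t1 *\<^sub>R z1, r1) + (t1 / (t1 + t2)) *\<^sub>R (t2 *\<^sub>R z2, r2) \<in> E"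
      using that by (intro convexD[OF E]) (auto simp flip: add_divide_distrib)
    then show ?thesis using that(3,4) by (simp add: scaleR_add_right add_divide_distrib mult.commute)
  qed
  have ne: "Q z \<noteq> {}" for z using absorb[of z] by (auto simp: Q_def)
  \<comment> \<open>A point over a multiple of \<open>- z\<close> mixes with one over a multiple of
    \<open>z\<close> to a point over \<open>0\<close>, where \<open>m\<close> is a lower bound. This
    keeps the quotients bounded below.\<close>
  have lb: "- ((r' - m) / t') \<le> v" if "v \<in> Q z" "0 < t'" "(t' *\<^sub>R (- z), r') \<in> E" for v z r' t'
  proof -
    obtain r t where v: "v = (r - m) / t" "0 < t" "(t *\<^sub>R z, r) \<in> E" using \<open>v \<in> Q z\<close> by (auto simp: Q_def)
    have "(0, (t' * r + t * r') / (t + t')) \<in> E" using comb[OF v(3) that(3) v(2) that(2)] by simp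
    from zero[OF this] have "m * (t + t') \<le> t' * r + t * r'" using v(2) that(2) by (simp add: field_simps)
    then have "0 \<le> (t' * (r - m) + t * (r' - m)) / (t * t')"
      using v(2) that(2) by (simp add: algebra_simps)
    also have "\<dots> = (r - m) / t + (r' - m) / t'" using v(2) that(2) by (simp add: add_divide_distrib)
    finally show ?thesis using v(1) by simp
  qed
  have bdd: "bdd_below (Q z)" for z using absorb[of "- z"] lb by (meson bdd_below.I)
  have le: "p z \<le> (r - m) / t" if "0 < t" "(t *\<^sub>R z, r) \<in> E" for z r t
    unfolding p_def by (rule cInf_lower[OF _ bdd]) (use that in \<open>auto simp: Q_def\<close>)
  have ge: "k \<le> p z" if "\<And>r t. 0 < t \<Longrightarrow> (t *\<^sub>R z, r) \<in> E \<Longrightarrow> k \<le> (r - m) / t" for k z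
    unfolding p_def by (rule cInf_greatest[OF ne]) (use that in \<open>auto simp: Q_def\<close>)
  have "sublinear p"
  proof (rule sublinear_ge_of_pos_scale)
    fix a b
    have "p (a + b) - (r1 - m) / t1 \<le> p b" if 1: "0 < t1" "(t1 *\<^sub>R a, r1) \<in> E" for r1 t1
    proof (rule ge)
      fix r2 t2 :: real assume 2: "0 < t2" "(t2 *\<^sub>R b, r2) \<in> E"
      have "p (a + b) \<le> ((t2 * r1 + t1 * r2) / (t1 + t2) - m) / (t1 * t2 / (t1 + t2))"
        using 1 2 by (intro le comb) auto
      also have "(t2 * r1 + t1 * r2) / (t1 + t2) - m = (t2 * (r1 - m) + t1 * (r2 - m)) / (t1 + t2)"
        using 1 2 by (simp add: field_simps)
      also have "\<dots> / (t1 * t2 / (t1 + t2)) = (t2 * (r1 - m) + t1 * (r2 - m)) / (t1 * t2)"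
        using 1 2 by simp
      also have "\<dots> = (r1 - m) / t1 + (r2 - m) / t2"
        using 1 2 by (simp add: add_divide_distrib)
      finally show "p (a + b) - (r1 - m) / t1 \<le> (r2 - m) / t2" by simp
    qed
    then have "p (a + b) - p b \<le> p a" by (intro ge) (auto simp: algebra_simps)
    then show "p (a + b) \<le> p a + p b" by simp
  next
    fix c :: real and x assume c: "0 < c"
    have "p (c *\<^sub>R x) / c \<le> p x"
    proof (rule ge)
      fix r t :: real assume t: "0 < t" "(t *\<^sub>R x, r) \<in> E"
      have "p (c *\<^sub>R x) \<le> (r - m) / (t / c)" using c t by (intro le) auto
      then show "p (c *\<^sub>R x) / c \<le> (r - m) / t" using c by (simp add: field_simps)
    qed
    then show "p (c *\<^sub>R x) \<le> c * p x" using c by (simp add: field_simps)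
  next
    obtain t r where t: "0 < t" "(t *\<^sub>R 0, r) \<in> E" using absorb by blast
    have "0 \<le> p 0" by (rule ge) (use zero in auto)
    moreover have "p 0 \<le> 0"
    proof (rule field_le_epsilon)
      fix e :: real assume e: "0 < e"
      have "m \<le> r" using t zero by simp
      \<comment> \<open>Every multiple of \<open>0\<close> is \<open>0\<close>, so the step length
        may be taken large enough to push the quotient below \<open>e\<close>.\<close>
      define T where "T = (r - m) / e + 1"
      have T: "0 < T" using \<open>m \<le> r\<close> e by (simp add: T_def add_nonneg_pos)
      have "p 0 \<le> (r - m) / T" using t T by (intro le) auto
      also have "\<dots> \<le> e" using T e by (simp add: T_def field_simps)
      finally show "p 0 \<le> 0 + e" by simp
    qed
    ultimately show "p 0 = 0" by simp
  qed
  then obtain \<phi> where "linear \<phi>" and \<phi>: "\<And>x. \<phi> x \<le> p x" using hahn_banach_sublinear by blast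
  moreover have "\<phi> z + m \<le> r" if "(z, r) \<in> E" for z r
    using \<phi>[of z] le[of 1 z r] that by simp
  ultimately show ?thesis by blast
qed

section \<open>Continuous affine minorants and biconjugation\<close>

lemma linear_bounded_above_imp_bounded_linear:
  fixes \<phi> :: "'v::real_normed_vector \<Rightarrow> real"
  assumes \<phi>: "linear \<phi>" and d: "0 < d" and le: "\<And>z. norm z \<le> d \<Longrightarrow> \<phi> z \<le> C"
  shows "bounded_linear \<phi>"
proof (rule bounded_linear_intro[where K="C / d"])
  fix x :: 'v
  have *: "\<phi> y * d \<le> C * norm y" for y
  proof (cases "y = 0")
    case False
    have "\<phi> ((d / norm y) *\<^sub>R y) \<le> C" using d by (intro le) auto
    then show ?thesis using False by (simp add: linear_cmul[OF \<phi>] field_simps)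
  qed (simp add: linear_0[OF \<phi>])
  show "norm (\<phi> x) \<le> norm x * (C / d)"
    using *[of x] *[of "- x"] d by (simp add: linear_neg[OF \<phi>] field_simps abs_le_iff)
qed (simp_all add: linear_add[OF \<phi>] linear_cmul[OF \<phi>])

text \<open>Applied to \<open>c *\<^sub>R x\<close> and divided by \<open>c\<close>, the inequality
  carries the constant \<open>C / c\<close>, which vanishes as \<open>c\<close> grows.\<close>

lemma linear_le_sublinear_of_affine_le:
  fixes \<phi> :: "'v::real_vector \<Rightarrow> real"
  assumes \<phi>: "linear \<phi>" and p: "\<And>c x. 0 < c \<Longrightarrow> p (c *\<^sub>R x) = c * p x" and le: "\<And>x. \<phi> x \<le> p x + C"
  shows "\<phi> x \<le> p x"
proof (rule field_le_epsilon)
  fix e :: real assume e: "0 < e"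
  define c where "c = (\<bar>C\<bar> + 1) / e"
  have c: "0 < c" using e by (simp add: c_def)
  have "c * \<phi> x \<le> c * p x + C" using le[of "c *\<^sub>R x"] c by (simp add: p linear_cmul[OF \<phi>])
  then have "\<phi> x \<le> p x + C / c" using c by (simp add: field_simps)
  also have "C / c \<le> e" using e c by (simp add: c_def field_simps abs_if)
  finally show "\<phi> x \<le> p x + e" by simp
qed

text \<open>The hypothesis says that the infimal convolution of \<open>E\<close> with
  \<open>K\<close> times the norm is at least \<open>m\<close> at \<open>p\<close>. This convolution
  has full domain, so it has a subgradient at \<open>p\<close>; being bounded above on a ball, the
  subgradient is continuous, and it minorizes \<open>E\<close> as well.\<close>

theorem convex_affine_minorant:
  fixes E :: "('v::real_normed_vector \<times> real) set"
  assumes E: "convex E" "E \<noteq> {}" and K: "0 \<le> K"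
    and le: "\<And>z r. (z, r) \<in> E \<Longrightarrow> m \<le> r + K * norm (z - p)"
  shows "\<exists>\<phi> :: 'v dual. \<forall>z r. (z, r) \<in> E \<longrightarrow> \<phi> (z - p) + m \<le> r"
proof -
  define E' where "E' = {(z - p + y, r + s) | z y r s. (z, r) \<in> E \<and> K * norm y \<le> s}"
  obtain z0 r0 where z0: "(z0, r0) \<in> E" using E(2) by auto
  have E'I: "(y, r0 + s) \<in> E'" if "K * norm (y - (z0 - p)) \<le> s" for y s
    unfolding E'_def using z0 that by (intro CollectI exI[of _ z0] exI[of _ "y - (z0 - p)"]) auto
  have conv: "convex E'"
  proof (rule convexI)
    fix a b and u v :: real assume "a \<in> E'" "b \<in> E'" and uv: "0 \<le> u" "0 \<le> v" "u + v = 1"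
    then obtain z y r s z' y' r' s' where a: "a = (z - p + y, r + s)" "(z, r) \<in> E" "K * norm y \<le> s"
      and b: "b = (z' - p + y', r' + s')" "(z', r') \<in> E" "K * norm y' \<le> s'"
      unfolding E'_def by blast
    have 1: "(u *\<^sub>R z + v *\<^sub>R z', u * r + v * r') \<in> E"
      using convexD[OF E(1) a(2) b(2) uv] by simp
    have "K * norm (u *\<^sub>R y + v *\<^sub>R y') \<le> K * (u * norm y + v * norm y')"
      using uv K by (intro mult_left_mono norm_triangle_le) auto
    also have "\<dots> = u * (K * norm y) + v * (K * norm y')" by (simp add: algebra_simps)
    also have "\<dots> \<le> u * s + v * s'" using a(3) b(3) uv by (intro add_mono mult_left_mono) auto
    finally have 2: "K * norm (u *\<^sub>R y + v *\<^sub>R y') \<le> u * s + v * s'" .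
    have "u *\<^sub>R p + v *\<^sub>R p = p" using uv by (metis scaleR_add_left scaleR_one)
    then have "u *\<^sub>R a + v *\<^sub>R b
      = ((u *\<^sub>R z + v *\<^sub>R z') - p + (u *\<^sub>R y + v *\<^sub>R y'), (u * r + v * r') + (u * s + v * s'))"
      unfolding a(1) b(1) by (simp add: algebra_simps) 
    then show "u *\<^sub>R a + v *\<^sub>R b \<in> E'" unfolding E'_def using 1 2 by blast
  qed
  have "\<exists>\<phi>. linear \<phi> \<and> (\<forall>(z, r)\<in>E'. \<phi> z + m \<le> r)"
  proof (rule convex_subgradient_at_0[OF conv])
    fix z show "\<exists>t>0. \<exists>r. (t *\<^sub>R z, r) \<in> E'"
      using E'I[of z, OF order_refl] by (intro exI[of _ 1]) auto
  next
    fix r assume "(0, r) \<in> E'"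
    then obtain z y q s where "z - p + y = 0" "r = q + s" "(z, q) \<in> E" "K * norm y \<le> s"
      unfolding E'_def by auto
    moreover from this have "norm y = norm (z - p)"
      by (metis add_eq_0_iff norm_minus_cancel)
    ultimately show "m \<le> r" using le[of z q] by simp
  qed
  then obtain \<phi> where \<phi>: "linear \<phi>" and min: "\<And>z r. (z, r) \<in> E' \<Longrightarrow> \<phi> z + m \<le> r" by blast
  have "bounded_linear \<phi>"
  proof (rule linear_bounded_above_imp_bounded_linear[OF \<phi> zero_less_one])
    fix z :: 'v assume "norm z \<le> 1"
    then have "K * norm (z - (z0 - p)) \<le> K * (1 + norm (z0 - p))"
      using K norm_triangle_ineq4[of z "z0 - p"] by (intro mult_left_mono) auto
    from min[OF E'I[OF this]] show "\<phi> z \<le> r0 + K * (1 + norm (z0 - p)) - m" by simp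
  qed
  moreover have "\<phi> (z - p) + m \<le> r" if "(z, r) \<in> E" for z r
    using that by (intro min) (force simp: E'_def)
  ultimately show ?thesis
    by (intro exI[of _ "Blinfun \<phi>"]) (auto simp: bounded_linear_Blinfun_apply)
qed

text \<open>A separating hyperplane might be vertical. To avoid this, one affine minorant
  (\<open>dom\<close>) is built first, at a point of the domain. Then a steep cone with vertex above
  \<open>p\<close> lies below \<open>E\<close>: near \<open>p\<close> because of the gap, far from
  \<open>p\<close> because of that minorant.\<close>

theorem fenchel_moreau:
  fixes E :: "('v::real_normed_vector \<times> real) set"
  assumes E: "convex E" "closed E" "E \<noteq> {}"
    and up: "\<And>z r r'. (z, r) \<in> E \<Longrightarrow> r \<le> r' \<Longrightarrow> (z, r') \<in> E"
    and proper: "\<And>z. \<exists>b. \<forall>r. (z, r) \<in> E \<longrightarrow> b \<le> r"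
    and minorants: "\<And>(\<phi> :: 'v dual) s. (\<And>z r. (z, r) \<in> E \<Longrightarrow> \<phi> z - s \<le> r) \<Longrightarrow> \<phi> p - s \<le> \<rho>"
  shows "(p, \<rho>) \<in> E"
proof -
  have gap: "\<exists>d>0. \<forall>(z, r)\<in>E. norm (z - p) < d \<longrightarrow> \<rho> + d \<le> r" if "(p, \<rho>) \<notin> E" for p \<rho>
  proof -
    have "open (- E)" using E(2) by auto
    then obtain e where e: "e > 0" "ball (p, \<rho>) e \<subseteq> - E"
      using \<open>(p, \<rho>) \<notin> E\<close> by (meson ComplI openE)
    have "\<rho> + e / 2 \<le> r" if z: "(z, r) \<in> E" "norm (z - p) < e / 2" for z r
    proof (rule ccontr)
      assume *: "\<not> \<rho> + e / 2 \<le> r"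
      \<comment> \<open>A point of \<open>E\<close> that is too low is lifted to height at least
        \<open>\<rho>\<close>; it stays in \<open>E\<close> and lands in the excluded ball.\<close>
      have "(z, max r \<rho>) \<in> E" using up[OF z(1)] by simp
      moreover have "dist (p, \<rho>) (z, max r \<rho>) < e"
      proof -
        have "dist (p, \<rho>) (z, max r \<rho>) \<le> dist p z + dist \<rho> (max r \<rho>)"
          unfolding dist_Pair_Pair by (rule sqrt_sum_squares_le_sum) auto
        moreover have "dist p z < e / 2" using z(2) by (simp add: dist_norm norm_minus_commute)
        moreover have "dist \<rho> (max r \<rho>) < e / 2" using * e(1) by (auto simp: dist_norm)
        ultimately show ?thesis by simp
      qed
      ultimately show False using e(2) by auto
    qed
    then show ?thesis using e(1) by (intro exI[of _ "e / 2"]) auto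
  qed
  have dom: "\<exists>(\<phi> :: 'v dual) s. \<forall>(z, r)\<in>E. \<phi> z - s \<le> r"
  proof -
    obtain p r' where p: "(p, r') \<in> E" using E(3) by auto
    obtain b where "\<And>r. (p, r) \<in> E \<Longrightarrow> b \<le> r" using proper by blast
    then have "(p, b - 1) \<notin> E" by force
    then obtain d where d: "0 < d" "\<And>z r. (z, r) \<in> E \<Longrightarrow> norm (z - p) < d \<Longrightarrow> b - 1 + d \<le> r"
      using gap by blast
    \<comment> \<open>On the segment from \<open>(p, r')\<close> to a far point of \<open>E\<close>,
      the point at distance \<open>d / 2\<close> from \<open>p\<close> has height at least
      \<open>m\<close>. This limits the descent to slope \<open>K\<close>.\<close>
    define m K where "m = b - 1 + d" and "K = 2 * (r' - m) / d"
    have m: "m \<le> r'" using d(2)[OF p] d(1) by (simp add: m_def)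
    have "m \<le> r + K * norm (z - p)" if z: "(z, r) \<in> E" for z r
    proof (cases "norm (z - p) < d")
      case True
      have "0 \<le> K" using m d(1) by (simp add: K_def)
      then have "0 \<le> K * norm (z - p)" by simp
      then show ?thesis using d(2)[OF z True] unfolding m_def by linarith
    next
      case False
      define t where "t = d / (2 * norm (z - p))"
      have t: "0 < t" "t \<le> 1" "t * norm (z - p) = d / 2" using False d(1) by (auto simp: t_def divide_simps)
      have "(1 - t) *\<^sub>R (p, r') + t *\<^sub>R (z, r) \<in> E" using t by (intro convexD[OF E(1) p z]) auto
      moreover have "(1 - t) *\<^sub>R p + t *\<^sub>R z = p + t *\<^sub>R (z - p)" by (simp add: algebra_simps)
      ultimately have "(p + t *\<^sub>R (z - p), (1 - t) * r' + t * r) \<in> E" by simp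
      then have "m \<le> (1 - t) * r' + t * r"
        unfolding m_def by (rule d(2)) (use t d(1) in simp)
      then have "t * (r' - r) \<le> r' - m" by (simp add: algebra_simps)
      then have "r' - r \<le> (r' - m) / t" using t by (simp add: field_simps)
      moreover have "K * norm (z - p) = (r' - m) / t" using False d(1) by (simp add: K_def t_def)
      ultimately show ?thesis using m by simp
    qed
    then obtain \<phi> :: "'v dual" where "\<And>z r. (z, r) \<in> E \<Longrightarrow> \<phi> (z - p) + m \<le> r"
      using convex_affine_minorant[OF E(1,3), of K m p] m d(1) unfolding K_def by force
    then show ?thesis by (intro exI[of _ \<phi>] exI[of _ "\<phi> p - m"]) (auto simp: blinfun.diff_right algebra_simps)
  qed
  show ?thesis
  proof (rule ccontr)
    assume "(p, \<rho>) \<notin> E"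
    then obtain d where d: "0 < d" "\<And>z r. (z, r) \<in> E \<Longrightarrow> norm (z - p) < d \<Longrightarrow> \<rho> + d \<le> r"
      using gap by blast
    obtain \<phi>1 :: "'v dual" and s where \<phi>1: "\<And>z r. (z, r) \<in> E \<Longrightarrow> \<phi>1 z - s \<le> r" using dom by blast
    \<comment> \<open>The first summand pays for the slope of \<open>\<phi>1\<close>, the second
      covers the deficit \<open>\<rho> + d - C\<close> from distance \<open>d\<close> on.\<close>
    define C K where "C = \<phi>1 p - s" and "K = norm \<phi>1 + \<bar>\<rho> + d - C\<bar> / d"
    have K: "0 \<le> K" using d(1) by (simp add: K_def)
    have "\<rho> + d \<le> r + K * norm (z - p)" if z: "(z, r) \<in> E" for z r
    proof (cases "norm (z - p) < d")
      case True
      then show ?thesis using d(2)[OF z] K by (meson add_increasing2 mult_nonneg_nonneg norm_ge_zero)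
    next
      case False
      have "\<bar>\<phi>1 (z - p)\<bar> \<le> norm \<phi>1 * norm (z - p)" using norm_blinfun[of \<phi>1 "z - p"] by simp
      then have "C - norm \<phi>1 * norm (z - p) \<le> r"
        using \<phi>1[OF z] by (simp add: C_def blinfun.diff_right)
      moreover have "\<bar>\<rho> + d - C\<bar> / d * d \<le> \<bar>\<rho> + d - C\<bar> / d * norm (z - p)"
        using False d(1) by (intro mult_left_mono) auto
      ultimately show ?thesis using d(1) by (simp add: K_def algebra_simps)
    qed
    then obtain \<phi> :: "'v dual" where \<phi>: "\<And>z r. (z, r) \<in> E \<Longrightarrow> \<phi> (z - p) + (\<rho> + d) \<le> r"
      using convex_affine_minorant[OF E(1,3) K, of "\<rho> + d" p] by blast
    have "\<phi> p - (\<phi> p - (\<rho> + d)) \<le> \<rho>"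
      by (rule minorants) (use \<phi> in \<open>simp add: blinfun.diff_right algebra_simps\<close>)
    then show False using d(1) by simp
  qed
qed

section \<open>Weak-star continuous functionals and Goldstine's theorem\<close>

lemma canon_apply [simp]: "blinfun_apply (canon x) f = blinfun_apply f x"
  unfolding canon_def by (subst bounded_linear_Blinfun_apply) (auto intro: blinfun.bounded_linear_left)

lemma canon_add: "canon (x + y) = canon x + canon y"
  and canon_diff: "canon (x - y) = canon x - canon y"
  and canon_scaleR: "canon (c *\<^sub>R x) = c *\<^sub>R canon x"
  by (intro blinfun_eqI; simp add: blinfun.bilinear_simps)+

lemma adjoint_op_apply [simp]: "blinfun_apply (blinfun_apply (adjoint_op A) y) x = y (A x)"
proof -
  have "bounded_linear (\<lambda>y. y o\<^sub>L A)"
    by (rule bounded_bilinear.bounded_linear_left[OF bounded_bilinear_blinfun_compose])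
  then show ?thesis unfolding adjoint_op_def by (subst bounded_linear_Blinfun_apply) auto
qed

text \<open>Induction on \<open>F\<close>. Unless evaluation at \<open>x\<close> already vanishes on
  the joint kernel of the others, some \<open>g0\<close> in that kernel is dual to \<open>x\<close>;
  subtracting \<open>\<phi> g0\<close> times this evaluation leaves a functional covered by the
  induction hypothesis.\<close>

lemma evaluation_of_vanishing:
  fixes \<phi> :: "'a::real_normed_vector dual \<Rightarrow> real"
  assumes "finite F" "linear \<phi>" "\<And>g. (\<forall>x\<in>F. blinfun_apply g x = 0) \<Longrightarrow> \<phi> g = 0"
  shows "\<exists>a. \<forall>g. \<phi> g = blinfun_apply g a"
  using assms
proof (induction F arbitrary: \<phi> rule: finite_induct)
  case empty
  then show ?case by (intro exI[of _ 0]) (auto simp: blinfun.zero_right)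
next
  case (insert x F)
  note \<phi> = \<open>linear \<phi>\<close>
  show ?case
  proof (cases "\<forall>g :: 'a dual. (\<forall>y\<in>F. blinfun_apply g y = 0) \<longrightarrow> blinfun_apply g x = 0")
    case True
    have "\<phi> g = 0" if "\<forall>y\<in>F. blinfun_apply g y = 0" for g :: "'a dual"
      by (rule insert.prems(2)) (use True that in blast)
    then show ?thesis by (rule insert.IH[OF \<phi>])
  next
    case False
    then obtain g1 :: "'a dual" where g1: "\<And>y. y \<in> F \<Longrightarrow> blinfun_apply g1 y = 0" "blinfun_apply g1 x \<noteq> 0" by blast
    define g0 where "g0 = (1 / g1 x) *\<^sub>R g1"
    have g0: "\<And>y. y \<in> F \<Longrightarrow> blinfun_apply g0 y = 0" "blinfun_apply g0 x = 1"
      using g1 by (auto simp: g0_def blinfun.scaleR_left)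
    have "\<exists>a. \<forall>g. \<phi> g - \<phi> g0 * blinfun_apply g x = blinfun_apply g a"
    proof (rule insert.IH)
      show "linear (\<lambda>g. \<phi> g - \<phi> g0 * blinfun_apply g x)"
        by (rule linearI) (simp_all add: linear_add[OF \<phi>] linear_cmul[OF \<phi>] blinfun.bilinear_simps algebra_simps)
    next
      fix g :: "'a dual" assume g: "\<forall>y\<in>F. blinfun_apply g y = 0"
      have "\<phi> (g - g x *\<^sub>R g0) = 0"
        using g g0 by (intro insert.prems(2)) (auto simp: blinfun.bilinear_simps)
      then show "\<phi> g - \<phi> g0 * blinfun_apply g x = 0"
        by (simp add: linear_diff[OF \<phi>] linear_cmul[OF \<phi>])
    qed
    then obtain a where a: "\<And>g. \<phi> g - \<phi> g0 * blinfun_apply g x = blinfun_apply g a" by blast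
    have "\<phi> g = blinfun_apply g (a + \<phi> g0 *\<^sub>R x)" for g
      using a[of g] by (simp add: blinfun.add_right blinfun.scaleR_right)
    then show ?thesis by blast
  qed
qed

text \<open>This turns a functional obtained by weak-star separation into a point of the predual.
  Domination by finitely many evaluations forces it to vanish wherever they all do.\<close>

lemma evaluation_of_weak_star_bound:
  fixes \<phi> :: "'a::real_normed_vector dual \<Rightarrow> real"
  assumes F: "finite F" and \<phi>: "linear \<phi>" and le: "\<And>g. \<phi> g \<le> (\<Sum>x\<in>F. \<bar>blinfun_apply g x\<bar>)"
  shows "\<exists>a. \<forall>g. \<phi> g = blinfun_apply g a"
proof (rule evaluation_of_vanishing[OF F \<phi>])
  fix g :: "'a dual" assume "\<forall>x\<in>F. blinfun_apply g x = 0"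
  then have "\<phi> g \<le> 0" "\<phi> (- g) \<le> 0" using le[of g] le[of "- g"] by (auto simp: blinfun.minus_left)
  then show "\<phi> g = 0" by (simp add: linear_neg[OF \<phi>])
qed

text \<open>\<open>E\<close> generates the convex function of \<open>z\<close> that is the infimum
  of \<open>p (z + d)\<close> over \<open>d\<close> in \<open>D\<close>; at \<open>0\<close> it is
  at least \<open>\<epsilon>\<close>. Its subgradient there is dominated by \<open>p\<close> up to a
  constant, hence by \<open>p\<close> itself.\<close>

theorem convex_seminorm_separation:
  fixes D :: "'v::real_vector set" and p :: "'v \<Rightarrow> real"
  assumes D: "convex D" "D \<noteq> {}" and p_add: "\<And>x y. p (x + y) \<le> p x + p y"
    and p_scale: "\<And>c x. 0 \<le> c \<Longrightarrow> p (c *\<^sub>R x) = c * p x" and ge: "\<And>d. d \<in> D \<Longrightarrow> \<epsilon> \<le> p d"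
  shows "\<exists>\<phi>. linear \<phi> \<and> (\<forall>x. \<phi> x \<le> p x) \<and> (\<forall>d\<in>D. \<epsilon> \<le> \<phi> d)"
proof -
  define E where "E = {(e - d, s) | e d s. d \<in> D \<and> p e \<le> s}"
  obtain d0 where d0: "d0 \<in> D" using D(2) by blast
  have EI: "(z, p (z + d)) \<in> E" if "d \<in> D" for z d
    unfolding E_def using that by (intro CollectI exI[of _ "z + d"] exI[of _ d]) simp
  have "\<exists>\<phi>. linear \<phi> \<and> (\<forall>(z, r)\<in>E. \<phi> z + \<epsilon> \<le> r)"
  proof (rule convex_subgradient_at_0)
    show "convex E"
    proof (rule convexI)
      fix a b and u v :: real assume "a \<in> E" "b \<in> E" and uv: "0 \<le> u" "0 \<le> v" "u + v = 1"
      then obtain e d s e' d' s' where a: "a = (e - d, s)" "d \<in> D" "p e \<le> s"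
        and b: "b = (e' - d', s')" "d' \<in> D" "p e' \<le> s'"
        unfolding E_def by blast
      have "p (u *\<^sub>R e + v *\<^sub>R e') \<le> u * p e + v * p e'"
        using p_add[of "u *\<^sub>R e" "v *\<^sub>R e'"] uv by (simp add: p_scale)
      also have "\<dots> \<le> u * s + v * s'" using a b uv by (intro add_mono mult_left_mono) auto
      finally have 1: "p (u *\<^sub>R e + v *\<^sub>R e') \<le> u * s + v * s'" .
      have 2: "u *\<^sub>R d + v *\<^sub>R d' \<in> D" by (rule convexD[OF D(1) a(2) b(2) uv])
      have "u *\<^sub>R a + v *\<^sub>R b = ((u *\<^sub>R e + v *\<^sub>R e') - (u *\<^sub>R d + v *\<^sub>R d'), u * s + v * s')"
        unfolding a(1) b(1) by (simp add: algebra_simps)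
      then show "u *\<^sub>R a + v *\<^sub>R b \<in> E" unfolding E_def using 1 2 by blast
    qed
  next
    fix z show "\<exists>t>0. \<exists>r. (t *\<^sub>R z, r) \<in> E"
      using EI[OF d0, of z] by (intro exI[of _ 1]) auto
  next
    fix r assume "(0, r) \<in> E"
    then show "\<epsilon> \<le> r" using ge by (force simp: E_def)
  qed
  then obtain \<phi> where \<phi>: "linear \<phi>" and min: "\<And>z r. (z, r) \<in> E \<Longrightarrow> \<phi> z + \<epsilon> \<le> r" by blast
  have min': "\<phi> e - \<phi> d + \<epsilon> \<le> p e" if "d \<in> D" for e d
    using min[OF EI[OF that], of "e - d"] by (simp add: linear_diff[OF \<phi>])
  have "\<phi> e \<le> p e" for e
  proof (rule linear_le_sublinear_of_affine_le[OF \<phi>])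
    show "\<phi> e \<le> p e + (\<phi> d0 - \<epsilon>)" for e using min'[OF d0, of e] by simp
  qed (simp add: p_scale)
  moreover have "\<epsilon> \<le> \<phi> d" if "d \<in> D" for d
    using min'[OF that, of 0] p_scale[of 0 0] by (simp add: linear_0[OF \<phi>])
  ultimately show ?thesis using \<phi> by blast
qed

text \<open>Otherwise the embedded ball, translated by \<open>- xss\<close>, keeps away from
  \<open>0\<close> in the seminorm given by \<open>F\<close>. The separating functional is
  evaluation at some \<open>g\<close>, and the separation makes \<open>norm xss * norm g\<close> at
  most \<open>- xss g - \<epsilon>\<close>, against the definition of the operator norm.\<close>

theorem goldstine:
  fixes xss :: "'a::real_normed_vector dual dual"
  assumes F: "finite F" and \<epsilon>: "0 < \<epsilon>"
  shows "\<exists>x. norm x \<le> norm xss \<and> (\<forall>f\<in>F. \<bar>blinfun_apply f x - xss f\<bar> < \<epsilon>)"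
proof (rule ccontr)
  assume contr: "\<not> ?thesis"
  define p where "p e = (\<Sum>f\<in>F. \<bar>blinfun_apply e f\<bar>)" for e :: "'a dual dual"
  define D where "D = (\<lambda>x. - xss + canon x) ` cball 0 (norm xss)"
  have "\<exists>\<phi>. linear \<phi> \<and> (\<forall>x. \<phi> x \<le> p x) \<and> (\<forall>d\<in>D. \<epsilon> \<le> \<phi> d)"
  proof (rule convex_seminorm_separation)
    have "linear (canon :: 'a \<Rightarrow> _)" by (rule linearI) (simp_all add: canon_add canon_scaleR)
    then have "convex ((+) (- xss) ` canon ` cball 0 (norm xss))"
      by (intro convex_translation convex_linear_image convex_cball)
    then show "convex D" by (simp add: D_def image_image)
    show "D \<noteq> {}" by (simp add: D_def)
    show "p (c *\<^sub>R e) = c * p e" if "0 \<le> c" for c e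
      using that by (simp add: p_def blinfun.scaleR_left abs_mult sum_distrib_left)
    show "p (e + e') \<le> p e + p e'" for e e'
      unfolding p_def sum.distrib[symmetric] by (intro sum_mono) (simp add: blinfun.add_left)
    fix d assume "d \<in> D"
    then obtain x where x: "d = - xss + canon x" "norm x \<le> norm xss" by (auto simp: D_def)
    then obtain f where f: "f \<in> F" "\<epsilon> \<le> \<bar>blinfun_apply f x - xss f\<bar>" using contr by (auto simp: not_less)
    note f(2)
    also have "\<bar>blinfun_apply f x - xss f\<bar> = \<bar>d f\<bar>" by (simp add: x(1) blinfun.diff_left)
    also have "\<dots> \<le> p d" unfolding p_def using F f(1) by (intro member_le_sum) auto
    finally show "\<epsilon> \<le> p d" .
  qed
  then obtain \<phi> where \<phi>: "linear \<phi>" "\<And>x. \<phi> x \<le> p x" "\<And>d. d \<in> D \<Longrightarrow> \<epsilon> \<le> \<phi> d" by blast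
  then obtain g where g: "\<And>e. \<phi> e = blinfun_apply e g"
    using evaluation_of_weak_star_bound[OF F \<phi>(1)] unfolding p_def by blast
  have gx: "- blinfun_apply g x + \<epsilon> \<le> - xss g" if "norm x \<le> norm xss" for x
    using \<phi>(3)[of "- xss + canon x"] that by (simp add: g D_def blinfun.diff_left)
  have "xss g < 0" using gx[of 0] \<epsilon> by (simp add: blinfun.zero_right)
  then have R: "0 < norm xss" by auto
  have *: "- blinfun_apply g x * norm xss \<le> (- xss g - \<epsilon>) * norm x" for x
  proof (cases "x = 0")
    case False
    then show ?thesis
      using gx[of "(norm xss / norm x) *\<^sub>R x"] by (simp add: blinfun.scaleR_right field_simps)
  qed (simp add: blinfun.zero_right)
  have "norm g \<le> (- xss g - \<epsilon>) / norm xss"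
  proof (rule norm_blinfun_bound)
    show "0 \<le> (- xss g - \<epsilon>) / norm xss" using gx[of 0] by (simp add: blinfun.zero_right)
    show "norm (blinfun_apply g x) \<le> (- xss g - \<epsilon>) / norm xss * norm x" for x
      using *[of x] *[of "- x"] R by (simp add: blinfun.minus_right field_simps abs_le_iff)
  qed
  then have "norm xss * norm g \<le> - xss g - \<epsilon>" using R by (simp add: field_simps)
  moreover have "- xss g \<le> norm xss * norm g" using norm_blinfun[of xss g] by simp
  ultimately show False using \<epsilon> by simp
qed

lemma blinfun_prod_split:
  fixes \<phi> :: "('a::real_normed_vector \<times> 'b::real_normed_vector) dual"
  shows "\<exists>f g. \<forall>x y. \<phi> (x, y) = blinfun_apply f x + blinfun_apply g y"
proof -
  have 1: "bounded_linear (\<lambda>x. blinfun_apply \<phi> (x, 0))"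
    by (intro bounded_linear_compose[OF blinfun.bounded_linear_right] bounded_linear_Pair) auto
  have 2: "bounded_linear (\<lambda>y. blinfun_apply \<phi> (0, y))"
    by (intro bounded_linear_compose[OF blinfun.bounded_linear_right] bounded_linear_Pair) auto
  have "\<phi> (x, y) = Blinfun (\<lambda>x. \<phi> (x, 0)) x + Blinfun (\<lambda>y. \<phi> (0, y)) y" for x y
    unfolding bounded_linear_Blinfun_apply[OF 1] bounded_linear_Blinfun_apply[OF 2]
      blinfun.add_right[symmetric] by simp
  then show ?thesis by blast
qed

section \<open>Strong representative functions and type (D)\<close>

text \<open>The conjugate of the function with epigraph \<open>E\<close> is at most \<open>s\<close>
  at \<open>(f, g)\<close>, expressed without extended reals. For empty \<open>E\<close> it holds
  for every \<open>s\<close>, which is how nonemptiness is derived below.\<close>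

definition conj_le :: "(('a::real_normed_vector \<times> 'a dual) \<times> real) set \<Rightarrow> 'a dual \<Rightarrow> 'a dual dual \<Rightarrow> real \<Rightarrow> bool" where
  "conj_le E f g s \<longleftrightarrow> (\<forall>x xs r. ((x, xs), r) \<in> E \<longrightarrow> f x + g xs - r \<le> s)"

lemma conj_leD: "conj_le E f g s \<Longrightarrow> ((x, xs), r) \<in> E \<Longrightarrow> f x + g xs - r \<le> s"
  by (auto simp: conj_le_def)

text \<open>The conjugate of \<open>c\<close> times the squared norm is the squared dual norm
  divided by \<open>4 * c\<close>; this is one half of that fact, and
  \<open>conjugate_bound_quadratic\<close> is the other.\<close>

lemma norm_square_le_of_conjugate_bound:
  fixes w :: "'a::real_normed_vector dual"
  assumes c: "0 < c" and le: "\<And>z. w z - c * (norm z)\<^sup>2 \<le> k"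
  shows "(norm w)\<^sup>2 \<le> 4 * c * k"
proof -
  have k: "0 \<le> k" using le[of 0] by (simp add: blinfun.zero_right)
  have *: "(w z)\<^sup>2 \<le> 4 * c * k * (norm z)\<^sup>2" for z
  proof (cases "z = 0")
    case False
    then have n: "0 < (norm z)\<^sup>2" by simp
    \<comment> \<open>This \<open>t\<close> maximizes the concave quadratic obtained by inserting
      \<open>t *\<^sub>R z\<close> into the hypothesis.\<close>
    define t where "t = w z / (2 * c * (norm z)\<^sup>2)"
    have "t * w z - c * t\<^sup>2 * (norm z)\<^sup>2 \<le> k"
      using le[of "t *\<^sub>R z"] by (simp add: blinfun.scaleR_right power_mult_distrib algebra_simps)
    moreover have "t * w z - c * t\<^sup>2 * (norm z)\<^sup>2 = (w z)\<^sup>2 / (4 * c * (norm z)\<^sup>2)"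
      using False c by (simp add: t_def power2_eq_square field_simps)
    ultimately show ?thesis using n c by (simp add: field_simps)
  qed (simp add: blinfun.zero_right)
  have "norm w \<le> sqrt (4 * c * k)"
  proof (rule norm_blinfun_bound)
    fix z :: 'a
    have "norm (w z) = sqrt ((w z)\<^sup>2)" by simp
    also have "\<dots> \<le> sqrt (4 * c * k * (norm z)\<^sup>2)" using * by (rule real_sqrt_le_mono)
    finally show "norm (w z) \<le> sqrt (4 * c * k) * norm z" by (simp add: real_sqrt_mult)
  qed (use c k in simp)
  then have "(norm w)\<^sup>2 \<le> (sqrt (4 * c * k))\<^sup>2" by (rule power_mono) simp
  then show ?thesis using c k by simp
qed

lemma conjugate_bound_quadratic:
  fixes w :: "'a::real_normed_vector dual"
  assumes l: "0 < l" and q: "l * (norm z)\<^sup>2 \<le> q"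
  shows "w z - q \<le> (norm w)\<^sup>2 / (4 * l)"
proof -
  have "w z \<le> norm w * norm z" using norm_blinfun[of w z] by simp
  moreover have "0 \<le> (norm w - 2 * l * norm z)\<^sup>2 / (4 * l)" using l by simp
  moreover have "(norm w - 2 * l * norm z)\<^sup>2 / (4 * l)
    = (norm w)\<^sup>2 / (4 * l) - norm w * norm z + l * (norm z)\<^sup>2"
    using l by (simp add: power2_eq_square field_simps)
  ultimately show ?thesis using q by linarith
qed

lemma convex_on_square_seminorm:
  fixes N :: "'a::real_vector \<Rightarrow> real"
  assumes tri: "\<And>x y. N (x + y) \<le> N x + N y" and scale: "\<And>c x. N (c *\<^sub>R x) = \<bar>c\<bar> * N x"
    and nonneg: "\<And>x. 0 \<le> N x" and k: "0 \<le> k"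
  shows "convex_on UNIV (\<lambda>z. k * (N z)\<^sup>2)"
  unfolding convex_on_def
proof (intro conjI ballI allI impI)
  fix x y and u v :: real assume uv: "0 \<le> u" "0 \<le> v" "u + v = 1"
  have "(N (u *\<^sub>R x + v *\<^sub>R y))\<^sup>2 \<le> (u * N x + v * N y)\<^sup>2"
    using tri[of "u *\<^sub>R x" "v *\<^sub>R y"] uv nonneg by (intro power_mono) (auto simp: scale)
  \<comment> \<open>The factor \<open>u + v\<close> is \<open>1\<close>; left symbolic, it makes the
    identity polynomial.\<close>
  also have "\<dots> = (u + v) * (u * (N x)\<^sup>2 + v * (N y)\<^sup>2) - u * v * (N x - N y)\<^sup>2"
    by (simp add: power2_eq_square algebra_simps)
  also have "\<dots> \<le> u * (N x)\<^sup>2 + v * (N y)\<^sup>2" using uv by simp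
  finally show "k * (N (u *\<^sub>R x + v *\<^sub>R y))\<^sup>2 \<le> u * (k * (N x)\<^sup>2) + v * (k * (N y)\<^sup>2)"
    using k mult_left_mono[of _ _ k] by (fastforce simp: algebra_simps)
qed simp

text \<open>\<open>E\<close> plays the role of the epigraph of a strong representative function.\<close>

locale strong_epigraph =
  fixes E :: "(('a::banach \<times> 'a dual) \<times> real) set"
  assumes convex_E: "convex E" and closed_E: "closed E"
    and up_E: "(p, r) \<in> E \<Longrightarrow> r \<le> r' \<Longrightarrow> (p, r') \<in> E"
    and ge_coupling: "((x, xs), r) \<in> E \<Longrightarrow> blinfun_apply xs x \<le> r"
    and conj_ge_coupling: "conj_le E f g s \<Longrightarrow> blinfun_apply g f \<le> s"
begin

definition contact :: "('a \<times> 'a dual) set" where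
  "contact = {(x, xs). ((x, xs), blinfun_apply xs x) \<in> E}"

lemma nonempty_E: "\<exists>x xs r. ((x, xs), r) \<in> E"
proof (rule ccontr)
  assume "\<not> ?thesis"
  then have "conj_le E 0 0 (-1)" by (auto simp: conj_le_def)
  from conj_ge_coupling[OF this] show False by simp
qed

text \<open>Fenchel duality for \<open>E\<close> against the sum of \<open>q\<close> and its conjugate; the upper bound \<open>\<rho>\<close> stands for
  the value of that sum. The conjugate pairing is tested at \<open>- f\<close> in the second slot, where the
  conjugates of \<open>q\<close> cancel.\<close>

lemma regularized_infimum_nonpos:
  fixes q :: "'a \<Rightarrow> real"
  assumes q: "convex_on UNIV q" and even: "\<And>z. q (- z) = q z" and l: "0 < l"
    and lower: "\<And>z. l * (norm z)\<^sup>2 \<le> q z" and upper: "\<And>z. q z \<le> L * (norm z)\<^sup>2" and \<eta>: "0 < \<eta>"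
  shows "\<exists>x xs r \<rho>. ((x, xs), r) \<in> E \<and> (\<forall>z. (xs - b) z - q z + q (x - a) \<le> \<rho>)
    \<and> r - xs a - b x + b a + \<rho> < \<eta>"
proof (rule ccontr)
  assume contr: "\<not> ?thesis"
  have L: "0 \<le> L * (norm z)\<^sup>2" for z :: 'a
    using lower[of z] upper[of z] l by (meson order_trans mult_nonneg_nonneg less_imp_le zero_le_power2)
  \<comment> \<open>The epigraph of the optimal value as a function of a displacement of the two
    slots: \<open>s\<close> bounds \<open>q e1\<close> plus the conjugate of \<open>q\<close> at
    \<open>e2\<close>, and displacement \<open>0\<close> is the original problem.\<close>
  define D where "D = {((x - a + e1, xs - b + e2), r - xs a - b x + b a + s) | x xs r e1 e2 s.
    ((x, xs), r) \<in> E \<and> (\<forall>z. blinfun_apply e2 z - q z + q e1 \<le> s)}"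
  have DI: "((z1, z2), r - xs a - b x + b a + s) \<in> D"
    if "((x, xs), r) \<in> E" "\<And>z. blinfun_apply (z2 - (xs - b)) z - q z + q (z1 - (x - a)) \<le> s" for z1 z2 x xs r s
    unfolding D_def using that
    by (intro CollectI exI[of _ x] exI[of _ xs] exI[of _ r] exI[of _ "z1 - (x - a)"] exI[of _ "z2 - (xs - b)"] exI[of _ s]) simp
  obtain x0 xs0 r0 where p0: "((x0, xs0), r0) \<in> E" using nonempty_E by blast
  have bound: "blinfun_apply e2 z - q z + q e1 \<le> (norm e2)\<^sup>2 / (4 * l) + L * (norm e1)\<^sup>2" for e1 e2 z
    using conjugate_bound_quadratic[OF l lower, of e2 z] upper[of e1] by simp
  have "\<exists>\<phi>. linear \<phi> \<and> (\<forall>(z, r)\<in>D. \<phi> z + \<eta> \<le> r)"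
  proof (rule convex_subgradient_at_0)
    show "convex D"
    proof (rule convexI)
      fix P P' and u v :: real assume "P \<in> D" "P' \<in> D" and uv: "0 \<le> u" "0 \<le> v" "u + v = 1"
      then obtain x xs r e1 e2 s x' xs' r' e1' e2' s'
        where P: "P = ((x - a + e1, xs - b + e2), r - xs a - b x + b a + s)" "((x, xs), r) \<in> E"
          "\<And>z. blinfun_apply e2 z - q z + q e1 \<le> s"
        and P': "P' = ((x' - a + e1', xs' - b + e2'), r' - xs' a - b x' + b a + s')" "((x', xs'), r') \<in> E"
          "\<And>z. blinfun_apply e2' z - q z + q e1' \<le> s'"
        unfolding D_def by blast
      have 1: "((u *\<^sub>R x + v *\<^sub>R x', u *\<^sub>R xs + v *\<^sub>R xs'), u * r + v * r') \<in> E"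
        using convexD[OF convex_E P(2) P'(2) uv] by simp
      have 2: "(u *\<^sub>R e2 + v *\<^sub>R e2') z - q z + q (u *\<^sub>R e1 + v *\<^sub>R e1') \<le> u * s + v * s'" for z
      proof -
        have "q (u *\<^sub>R e1 + v *\<^sub>R e1') \<le> u * q e1 + v * q e1'"
          using q uv by (auto simp: convex_on_def)
        moreover have "u * (e2 z - q z + q e1) + v * (e2' z - q z + q e1') \<le> u * s + v * s'"
          using P(3) P'(3) uv by (intro add_mono mult_left_mono) auto
        moreover have "u * q z + v * q z = q z" using uv by (metis distrib_right mult_1)
        ultimately show ?thesis by (simp add: blinfun.bilinear_simps algebra_simps)
      qed
      have uva: "u *\<^sub>R a + v *\<^sub>R a = a" "u *\<^sub>R b + v *\<^sub>R b = b" "u * b a + v * b a = b a"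
        using uv by (metis scaleR_add_left scaleR_one, metis scaleR_add_left scaleR_one, metis distrib_right mult_1)
      have "u *\<^sub>R P + v *\<^sub>R P' = (((u *\<^sub>R x + v *\<^sub>R x') - (u *\<^sub>R a + v *\<^sub>R a) + (u *\<^sub>R e1 + v *\<^sub>R e1'),
           (u *\<^sub>R xs + v *\<^sub>R xs') - (u *\<^sub>R b + v *\<^sub>R b) + (u *\<^sub>R e2 + v *\<^sub>R e2')),
          (u * r + v * r') - (u *\<^sub>R xs + v *\<^sub>R xs') a - b (u *\<^sub>R x + v *\<^sub>R x')
            + (u * b a + v * b a) + (u * s + v * s'))"
        unfolding P(1) P'(1) by (simp add: algebra_simps blinfun.bilinear_simps)
      then show "u *\<^sub>R P + v *\<^sub>R P' \<in> D" unfolding D_def uva using 1 2 by blast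
    qed
  next
    fix z :: "'a \<times> 'a dual"
    obtain z1 z2 where z: "z = (z1, z2)" by (cases z)
    show "\<exists>t>0. \<exists>r. (t *\<^sub>R z, r) \<in> D"
      using DI[OF p0 bound] unfolding z by (intro exI[of _ 1]) auto
  next
    fix t assume "(0, t) \<in> D"
    then obtain x xs r e1 e2 s where *: "x - a + e1 = 0" "xs - b + e2 = 0"
      "t = r - xs a - b x + b a + s" "((x, xs), r) \<in> E" "\<And>z. blinfun_apply e2 z - q z + q e1 \<le> s"
      unfolding D_def by (auto simp: zero_prod_def)
    have e: "e1 = - (x - a)" "e2 = - (xs - b)" using *(1,2) by (metis add_eq_0_iff)+
    have "(xs - b) z - q z + q (x - a) \<le> s" for z
      using *(5)[of "- z"] even by (simp add: e blinfun.bilinear_simps del: minus_diff_eq)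
    then show "\<eta> \<le> t" using contr *(3,4) by (meson not_le)
  qed
  then obtain \<phi> where \<phi>: "linear \<phi>" and min: "\<And>z r. (z, r) \<in> D \<Longrightarrow> \<phi> z + \<eta> \<le> r" by blast
  have "bounded_linear \<phi>"
  proof (rule linear_bounded_above_imp_bounded_linear[OF \<phi> zero_less_one])
    fix z :: "'a \<times> 'a dual" assume "norm z \<le> 1"
    obtain z1 z2 where z: "z = (z1, z2)" by (cases z)
    have n: "norm z1 \<le> 1" "norm z2 \<le> 1"
      using norm_fst_le[of z1 z2] norm_snd_le[of z2 z1] \<open>norm z \<le> 1\<close> z by auto
    have n2: "norm (z2 - (xs0 - b)) \<le> 1 + norm (xs0 - b)" "norm (z1 - (x0 - a)) \<le> 1 + norm (x0 - a)"
      using n norm_triangle_ineq4[of z2 "xs0 - b"] norm_triangle_ineq4[of z1 "x0 - a"] by auto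
    have "L * (norm (z1 - (x0 - a)))\<^sup>2 \<le> \<bar>L\<bar> * (1 + norm (x0 - a))\<^sup>2"
      using n2 by (intro mult_mono power_mono) auto
    moreover have "(norm (z2 - (xs0 - b)))\<^sup>2 / (4 * l) \<le> (1 + norm (xs0 - b))\<^sup>2 / (4 * l)"
      using n2 l by (intro divide_right_mono power_mono) auto
    ultimately have "blinfun_apply (z2 - (xs0 - b)) y - q y + q (z1 - (x0 - a))
        \<le> (1 + norm (xs0 - b))\<^sup>2 / (4 * l) + \<bar>L\<bar> * (1 + norm (x0 - a))\<^sup>2" for y
      using bound[of "z2 - (xs0 - b)" y "z1 - (x0 - a)"] by linarith
    from min[OF DI[OF p0 this]]
    show "\<phi> z \<le> r0 - xs0 a - b x0 + b a
      + ((1 + norm (xs0 - b))\<^sup>2 / (4 * l) + \<bar>L\<bar> * (1 + norm (x0 - a))\<^sup>2) - \<eta>"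
      unfolding z by simp
  qed
  then obtain f g where fg: "\<And>x y. \<phi> (x, y) = blinfun_apply f x + blinfun_apply g y"
    using blinfun_prod_split[of "Blinfun \<phi>"] by (auto simp: bounded_linear_Blinfun_apply)
  \<comment> \<open>\<open>\<sigma>\<close> is the conjugate of \<open>q\<close> at
    \<open>f\<close>. The point \<open>e1\<close> attains it up to \<open>\<eta> / 2\<close>, and
    the other half of \<open>\<eta>\<close> survives as the contradiction.\<close>
  define \<sigma> where "\<sigma> = (SUP z. f z - q z)"
  have bdd: "bdd_above (range (\<lambda>z. f z - q z))"
    using conjugate_bound_quadratic[OF l lower] by (intro bdd_aboveI2)
  have \<sigma>: "f z - q z \<le> \<sigma>" for z unfolding \<sigma>_def by (rule cSUP_upper[OF _ bdd]) simp
  have "\<sigma> - \<eta> / 2 < (SUP z. f z - q z)" using \<eta> by (simp add: \<sigma>_def)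
  then obtain e1 where e1: "\<sigma> - \<eta> / 2 < f e1 - q e1"
    by (subst (asm) less_cSUP_iff[OF _ bdd]) auto
  \<comment> \<open>The pairing of these two functionals is the stated bound without its
    \<open>- \<eta> / 2\<close>, which contradicts \<open>conj_ge_coupling\<close>.\<close>
  have "conj_le E (f + b) (g + canon a) (f a + g b + g f + b a - \<eta> / 2)"
    unfolding conj_le_def
  proof (intro allI impI)
    fix x xs r assume x: "((x, xs), r) \<in> E"
    have "((x - a + e1, xs - b + - f), r - xs a - b x + b a + (\<sigma> + q e1)) \<in> D"
    proof (rule DI[OF x])
      fix z
      show "(xs - b + - f - (xs - b)) z - q z + q (x - a + e1 - (x - a)) \<le> \<sigma> + q e1"
        using \<sigma>[of "- z"] even[of z] by (simp add: blinfun.bilinear_simps)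
    qed
    from min[OF this] e1
    show "(f + b) x + (g + canon a) xs - r \<le> f a + g b + g f + b a - \<eta> / 2"
      by (simp add: fg blinfun.bilinear_simps)
  qed
  from conj_ge_coupling[OF this] \<eta> show False by (simp add: blinfun.bilinear_simps)
qed

end

section \<open>Almost optimal points and the Brondsted-Rockafellar property\<close>

lemma le_of_affine_perturbation:
  fixes A B K :: real
  assumes "\<And>t. 0 < t \<Longrightarrow> t \<le> 1 \<Longrightarrow> A + t * K \<le> B"
  shows "A \<le> B"
proof (rule field_le_epsilon)
  fix e :: real assume e: "0 < e"
  define t where "t = min 1 (e / (\<bar>K\<bar> + 1))"
  have t: "0 < t" "t \<le> 1" using e by (auto simp: t_def)
  have "t * \<bar>K\<bar> \<le> e / (\<bar>K\<bar> + 1) * \<bar>K\<bar>" by (intro mult_right_mono) (auto simp: t_def)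
  also have "\<dots> \<le> e" using e by (simp add: field_simps)
  finally have "- (t * K) \<le> e" using t by (metis abs_ge_minus_self mult_left_mono order_trans less_imp_le mult_minus_right)
  then show "A \<le> B + e" using assms[OF t] by simp
qed

lemma half_square_norm_conjugate:
  fixes z :: "'a::real_normed_vector" and w :: "'a dual"
  assumes "\<And>y. w y - 1 / 2 * (norm y)\<^sup>2 + 1 / 2 * (norm z)\<^sup>2 \<le> \<rho>"
  shows "(norm z)\<^sup>2 + (norm w)\<^sup>2 \<le> 2 * \<rho>"
proof -
  have "(norm w)\<^sup>2 \<le> 4 * (1 / 2) * (\<rho> - 1 / 2 * (norm z)\<^sup>2)"
    by (rule norm_square_le_of_conjugate_bound) (use assms in \<open>auto simp: algebra_simps\<close>)
  then show ?thesis by simp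
qed

lemma convex_half_square_norm: "convex_on UNIV (\<lambda>z :: 'a::real_normed_vector. 1 / 2 * (norm z)\<^sup>2)"
  by (rule convex_on_square_seminorm) (auto intro: norm_triangle_ineq)

context strong_epigraph
begin

text \<open>If the defect \<open>r - b a\<close> of a point of \<open>E\<close> is less than \<open>\<epsilon>\<close>, convexity at the midpoint forces the
  almost optimal point of the regularized problem to be within \<open>2 * sqrt (\<epsilon> + \<eta>)\<close>.\<close>

lemma defect_decrease:
  assumes p0: "((a, b), r0) \<in> E" "r0 < b a + \<epsilon>" and \<eta>: "0 < \<eta>"
  shows "\<exists>x xs r. ((x, xs), r) \<in> E \<and> r < xs x + \<eta> \<and> (norm ((x, xs) - (a, b)))\<^sup>2 \<le> 4 * (\<epsilon> + \<eta>)"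
proof -
  obtain x xs r \<rho> where E: "((x, xs), r) \<in> E"
    and \<rho>: "\<And>z. (xs - b) z - 1 / 2 * (norm z)\<^sup>2 + 1 / 2 * (norm (x - a))\<^sup>2 \<le> \<rho>"
    and less: "r - xs a - b x + b a + \<rho> < \<eta>"
    using regularized_infimum_nonpos[OF convex_half_square_norm, of "1/2" "1/2" \<eta> b a] \<eta> by auto
  have sq: "(norm (x - a))\<^sup>2 + (norm (xs - b))\<^sup>2 \<le> 2 * \<rho>"
    by (rule half_square_norm_conjugate[OF \<rho>])
  \<comment> \<open>At \<open>- (x - a)\<close> the two values of the quadratic cancel; inserted
    into \<open>less\<close>, this bounds the defect of the new point by
    \<open>\<eta>\<close>.\<close>
  have "- ((xs - b) (x - a)) \<le> \<rho>"
    using \<rho>[of "- (x - a)"] by (simp add: blinfun.bilinear_simps norm_minus_commute)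
  then have def1: "r < xs x + \<eta>" using less by (simp add: blinfun.bilinear_simps)
  have "(1 / 2) *\<^sub>R ((a, b), r0) + (1 / 2) *\<^sub>R ((x, xs), r) \<in> E"
    by (rule convexD[OF convex_E p0(1) E]) auto
  then have "(((1 / 2) *\<^sub>R a + (1 / 2) *\<^sub>R x, (1 / 2) *\<^sub>R b + (1 / 2) *\<^sub>R xs), r0 / 2 + r / 2) \<in> E" by simp
  from ge_coupling[OF this] have "xs x + xs a + b x + b a \<le> 2 * (r0 + r)"
    by (simp add: blinfun.bilinear_simps algebra_simps)
  then have "\<rho> < \<epsilon> + \<eta> - (xs - b) (x - a) / 2"
    using p0(2) less by (simp add: blinfun.bilinear_simps field_simps)
  moreover have "- ((xs - b) (x - a)) \<le> (norm (x - a))\<^sup>2 / 2 + (norm (xs - b))\<^sup>2 / 2"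
  proof -
    have "- ((xs - b) (x - a)) \<le> norm (xs - b) * norm (x - a)"
      using norm_blinfun[of "xs - b" "x - a"] by simp
    also have "\<dots> \<le> (norm (x - a))\<^sup>2 / 2 + (norm (xs - b))\<^sup>2 / 2"
      using sum_squares_bound[of "norm (xs - b)" "norm (x - a)"] by (simp add: power2_eq_square)
    finally show ?thesis .
  qed
  \<comment> \<open>Here \<open>c\<close> stands for the coupling \<open>(xs - b) (x - a)\<close>
    and \<open>u\<close>, \<open>v\<close> for the squared distances. The coupling costs at most
    half of \<open>u + v\<close>, which is absorbed on the left; hence the factor
    \<open>4\<close>.\<close>
  moreover have "u + v \<le> 4 * (\<epsilon> + \<eta>)"
    if "\<rho> < \<epsilon> + \<eta> - c / 2" "- c \<le> u / 2 + v / 2" "u + v \<le> 2 * \<rho>" for u v c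
    using that by argo
  ultimately have "(norm (x - a))\<^sup>2 + (norm (xs - b))\<^sup>2 \<le> 4 * (\<epsilon> + \<eta>)" using sq by blast
  then show ?thesis using E def1 by (intro exI[of _ x] exI[of _ xs] exI[of _ r]) (simp add: norm_Pair)
qed

theorem bronsted_rockafellar:
  assumes \<delta>: "0 < \<delta>"
  shows "\<exists>\<epsilon>>0. \<forall>a b r. ((a, b), r) \<in> E \<longrightarrow> r < b a + \<epsilon> \<longrightarrow>
    (\<exists>x xs. (x, xs) \<in> contact \<and> norm (x - a) \<le> \<delta> \<and> norm (xs - b) \<le> \<delta>)"
proof (intro exI[of _ "(\<delta> / 6)\<^sup>2"] conjI allI impI)
  \<comment> \<open>The defect is divided by \<open>4\<close> in every round, so step
    \<open>n\<close> has length at most \<open>sqrt (5 * \<epsilon>) / 2 ^ n\<close>, rounded up to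
    \<open>3 * sqrt \<epsilon> / 2 ^ n\<close>. The total length is then
    \<open>6 * sqrt \<epsilon> = \<delta>\<close>.\<close>
  define \<epsilon> where "\<epsilon> = (\<delta> / 6)\<^sup>2"
  have \<epsilon>: "0 < \<epsilon>" using \<delta> by (simp add: \<epsilon>_def)
  then show "0 < (\<delta> / 6)\<^sup>2" by (simp add: \<epsilon>_def)
  fix a b r assume p0: "((a, b), r) \<in> E" "r < b a + (\<delta> / 6)\<^sup>2"
  define good where "good n p = (\<exists>r. (p, r) \<in> E \<and> r < blinfun_apply (snd p) (fst p) + \<epsilon> / 4 ^ n)" for n and p :: "'a \<times> 'a dual"
  have "\<exists>P. \<forall>n. (good n (P n) \<and> (n = 0 \<longrightarrow> P n = (a, b))) \<and> norm (P (Suc n) - P n) \<le> (\<delta> / 2) * (1 / 2) ^ n"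
  proof (rule dependent_nat_choice)
    show "\<exists>p. good 0 p \<and> (0 = 0 \<longrightarrow> p = (a, b))"
      using p0 by (intro exI[of _ "(a, b)"]) (auto simp: good_def \<epsilon>_def)
  next
    fix p n assume "good n p \<and> (n = 0 \<longrightarrow> p = (a, b))"
    then obtain x xs r where p: "p = (x, xs)" "((x, xs), r) \<in> E" "r < xs x + \<epsilon> / 4 ^ n"
      by (cases p) (auto simp: good_def)
    obtain y ys s where y: "((y, ys), s) \<in> E" "s < ys y + \<epsilon> / 4 ^ Suc n"
      "(norm ((y, ys) - p))\<^sup>2 \<le> 4 * (\<epsilon> / 4 ^ n + \<epsilon> / 4 ^ Suc n)"
      using defect_decrease[OF p(2,3), of "\<epsilon> / 4 ^ Suc n"] \<epsilon> p(1) by auto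
    have "(norm ((y, ys) - p))\<^sup>2 \<le> 9 * (\<epsilon> / 4 ^ n)" using y(3) \<epsilon>
      by (simp add: field_simps)
    also have "\<dots> = ((\<delta> / 2) * (1 / 2) ^ n)\<^sup>2"
      by (simp add: \<epsilon>_def power2_eq_square field_simps flip: power_mult_distrib)
    finally have "norm ((y, ys) - p) \<le> (\<delta> / 2) * (1 / 2) ^ n"
      by (rule power2_le_imp_le) (use \<delta> in simp)
    then show "\<exists>p'. (good (Suc n) p' \<and> (Suc n = 0 \<longrightarrow> p' = (a, b))) \<and> norm (p' - p) \<le> (\<delta> / 2) * (1 / 2) ^ n"
      using y by (intro exI[of _ "(y, ys)"]) (auto simp: good_def)
  qed
  then obtain P where P: "\<And>n. good n (P n)" "P 0 = (a, b)"
    "\<And>n. norm (P (Suc n) - P n) \<le> (\<delta> / 2) * (1 / 2) ^ n" by auto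
  define d where "d n = P (Suc n) - P n" for n
  have sums: "(\<lambda>n. (\<delta> / 2) * (1 / 2) ^ n) sums (\<delta> / 2 * 2)"
    by (intro sums_mult) (use geometric_sums[of "1/2::real"] in simp)
  have sd: "summable (\<lambda>n. norm (d n))"
    by (rule summable_comparison_test[OF _ sums_summable[OF sums]]) (use P(3) in \<open>auto simp: d_def\<close>)
  have Pn: "P n = P 0 + (\<Sum>k<n. d k)" for n
    unfolding d_def by (subst sum_lessThan_telescope) simp
  define p where "p = P 0 + suminf d"
  have "(\<lambda>n. P 0 + (\<Sum>k<n. d k)) \<longlonglongrightarrow> p"
    unfolding p_def by (intro tendsto_intros summable_LIMSEQ summable_norm_cancel[OF sd])
  then have lim: "P \<longlonglongrightarrow> p" by (simp flip: Pn)
  have "norm (p - P 0) \<le> (\<Sum>n. norm (d n))" unfolding p_def using summable_norm[OF sd] by simp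
  also have "\<dots> \<le> \<delta>"
    using suminf_le[OF _ sd sums_summable[OF sums]] P(3) sums_unique[OF sums] by (simp add: d_def)
  finally have norm_p: "norm (p - (a, b)) \<le> \<delta>" using P(2) by simp
  obtain x xs where p: "p = (x, xs)" by (cases p)
  have "(P n, blinfun_apply (snd (P n)) (fst (P n)) + \<epsilon> / 4 ^ n) \<in> E" for n
    using P(1)[of n] up_E[of "P n"] unfolding good_def by (meson less_imp_le)
  moreover have "(\<lambda>n. (P n, blinfun_apply (snd (P n)) (fst (P n)) + \<epsilon> / 4 ^ n)) \<longlonglongrightarrow> (p, blinfun_apply (snd p) (fst p) + 0)"
  proof (intro tendsto_intros lim)
    show "(\<lambda>n. \<epsilon> / 4 ^ n) \<longlonglongrightarrow> 0"
      using tendsto_mult_right_zero[OF LIMSEQ_realpow_zero[of "1/4::real"], of \<epsilon>]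
      by (simp add: power_one_over field_simps)
  qed
  ultimately have "(p, blinfun_apply (snd p) (fst p) + 0) \<in> E"
    by (rule closed_sequentially[OF closed_E])
  then have "(x, xs) \<in> contact" by (simp add: contact_def p)
  moreover have "norm (x - a, xs - b) \<le> \<delta>" using norm_p by (simp add: p)
  then have "norm (x - a) \<le> \<delta>" "norm (xs - b) \<le> \<delta>"
    using norm_fst_le norm_snd_le order_trans by blast+
  ultimately show "\<exists>x xs. (x, xs) \<in> contact \<and> norm (x - a) \<le> \<delta> \<and> norm (xs - b) \<le> \<delta>" by blast
qed

section \<open>The contact set: monotonicity, maximality and approximation of its Gossez
  closure\<close>

lemma contact_monotone: "monotone_op contact"
  unfolding monotone_op_def
proof clarify
  fix x xs y ys assume "(x, xs) \<in> contact" "(y, ys) \<in> contact"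
  then have "((x, xs), xs x) \<in> E" "((y, ys), ys y) \<in> E" by (auto simp: contact_def)
  \<comment> \<open>At the midpoint the coupling falls short of the mean of the two couplings by a
    quarter of the monotonicity pairing.\<close>
  then have "(1 / 2) *\<^sub>R ((x, xs), xs x) + (1 / 2) *\<^sub>R ((y, ys), ys y) \<in> E"
    by (intro convexD[OF convex_E]) auto
  then have "(((1 / 2) *\<^sub>R x + (1 / 2) *\<^sub>R y, (1 / 2) *\<^sub>R xs + (1 / 2) *\<^sub>R ys), xs x / 2 + ys y / 2) \<in> E" by simp
  from ge_coupling[OF this] show "0 \<le> (xs - ys) (x - y)"
    by (simp add: blinfun.bilinear_simps field_simps)
qed

text \<open>The coupling touches the function of \<open>E\<close> from below at
  \<open>(y, ys)\<close>, so its derivative there is a subgradient. On the segment towards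
  \<open>(x, xs)\<close> the comparison is quadratic in \<open>t\<close>; dividing by
  \<open>t\<close> and letting \<open>t\<close> tend to \<open>0\<close> leaves the linear
  part.\<close>

lemma contact_tangent:
  assumes y: "(y, ys) \<in> contact" and x: "((x, xs), r) \<in> E"
  shows "ys x + xs y - r \<le> ys y"
proof -
  have "ys x + xs y - 2 * ys y + t * (xs - ys) (x - y) \<le> r - ys y" if t: "0 < t" "t \<le> 1" for t
  proof -
    have "(1 - t) *\<^sub>R ((y, ys), ys y) + t *\<^sub>R ((x, xs), r) \<in> E"
      using y x t by (intro convexD[OF convex_E]) (auto simp: contact_def)
    then have "(((1 - t) *\<^sub>R y + t *\<^sub>R x, (1 - t) *\<^sub>R ys + t *\<^sub>R xs), (1 - t) * ys y + t * r) \<in> E" by simp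
    from ge_coupling[OF this]
    have "t * (ys x + xs y - 2 * ys y + t * (xs - ys) (x - y)) \<le> t * (r - ys y)"
      by (simp add: blinfun.bilinear_simps algebra_simps)
    then show ?thesis using t by simp
  qed
  from le_of_affine_perturbation[OF this] show ?thesis by simp
qed

lemma closed_contact: "closed contact"
proof -
  have "contact = (\<lambda>p. (p, blinfun_apply (snd p) (fst p))) -` E" by (auto simp: contact_def)
  moreover have "continuous_on UNIV (\<lambda>p :: 'a \<times> 'a dual. (p, blinfun_apply (snd p) (fst p)))"
    by (intro continuous_intros)
  ultimately show ?thesis using closed_vimage[OF closed_E] by metis
qed

text \<open>An almost optimal point has small defect, so some contact point \<open>(y, ys)\<close>
  lies within \<open>e\<close> of it. The closure inequality at that contact point bounds
  \<open>(xss - canon a) (xs - xs0)\<close> by the coupling \<open>w z\<close>, which is less than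
  \<open>\<eta> - \<rho>\<close>, up to errors governed by \<open>e\<close>.\<close>

lemma contact_near_closure_point:
  fixes q :: "'a \<Rightarrow> real"
  assumes cl: "(xss, xs0) \<in> gossez_closure contact"
    and q: "convex_on UNIV q" and even: "\<And>z. q (- z) = q z" and l: "0 < l"
    and lower: "\<And>z. l * (norm z)\<^sup>2 \<le> q z" and upper: "\<And>z. q z \<le> L * (norm z)\<^sup>2" and L: "0 < L"
    and \<delta>: "0 < \<delta>"
  shows "\<exists>x xs \<rho> y ys. (y, ys) \<in> contact \<and> norm (y - x) \<le> \<delta> \<and> norm (ys - xs) \<le> \<delta>
    \<and> (\<forall>z. (xs - xs0) z - q z + q (x - a) \<le> \<rho>) \<and> (xss - canon a) (xs - xs0) + 3 / 4 * \<rho> \<le> \<delta>"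
proof -
  define c where "c = norm (xss - canon a)"
  \<comment> \<open>The coefficients of \<open>e\<close> in the errors: \<open>c\<close> comes from
    \<open>(xss - canon a) v\<close>, \<open>1\<close> from \<open>v d\<close>, \<open>8 * L\<close>
    from \<open>w d\<close> and \<open>2 / l\<close> from \<open>v z\<close>.\<close>
  define C where "C = c + 1 + 8 * L + 2 / l"
  have C: "0 < C" using L l by (auto simp: C_def c_def intro!: add_nonneg_pos)
  define e where "e = min 1 (min \<delta> (\<delta> / (2 * C)))"
  have e: "0 < e" "e \<le> 1" "e \<le> \<delta>" "e * C \<le> \<delta> / 2"
    using \<delta> C by (auto simp: e_def min_def field_simps)
  obtain \<epsilon> where \<epsilon>: "0 < \<epsilon>" and br: "\<And>a b r. ((a, b), r) \<in> E \<Longrightarrow> r < b a + \<epsilon> \<Longrightarrow>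
    \<exists>x xs. (x, xs) \<in> contact \<and> norm (x - a) \<le> e \<and> norm (xs - b) \<le> e"
    using bronsted_rockafellar[OF e(1)] by blast
  define \<eta> where "\<eta> = min \<epsilon> (\<delta> / 2)"
  have \<eta>: "0 < \<eta>" "\<eta> \<le> \<epsilon>" "\<eta> \<le> \<delta> / 2" using \<epsilon> \<delta> by (auto simp: \<eta>_def)
  obtain x xs r \<rho> where E: "((x, xs), r) \<in> E"
    and \<rho>: "\<And>z. (xs - xs0) z - q z + q (x - a) \<le> \<rho>"
    and less: "r - xs a - xs0 x + xs0 a + \<rho> < \<eta>"
    using regularized_infimum_nonpos[OF q even l lower upper \<eta>(1), of xs0 a] by blast
  define z w where "z = x - a" and "w = xs - xs0"
  have "- (w z) \<le> \<rho>" using \<rho>[of "- z"] even by (simp add: z_def w_def blinfun.bilinear_simps del: minus_diff_eq)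
  then have "r < xs x + \<epsilon>" using less \<eta>(2) by (simp add: z_def w_def blinfun.bilinear_simps)
  then obtain y ys where y: "(y, ys) \<in> contact" "norm (y - x) \<le> e" "norm (ys - xs) \<le> e"
    using br[OF E] by blast
  define d v where "d = y - x" and "v = ys - xs"
  have dv: "norm d \<le> e" "norm v \<le> e" using y by (auto simp: d_def v_def)
  have q0: "q 0 = 0" using lower[of 0] upper[of 0] by simp
  have qnn: "0 \<le> q z" for z using lower[of z] l by (meson order_trans mult_nonneg_nonneg less_imp_le zero_le_power2)
  have wsq: "(norm w)\<^sup>2 \<le> 4 * L * \<rho>"
  proof (rule norm_square_le_of_conjugate_bound[OF L])
    fix y show "w y - L * (norm y)\<^sup>2 \<le> \<rho>" using \<rho>[of y] upper[of y] qnn[of "x - a"] by (simp add: w_def)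
  qed
  have zsq: "l * (norm z)\<^sup>2 \<le> \<rho>" using \<rho>[of 0] lower[of z] q0 by (simp add: z_def blinfun.zero_right)
  have "0 \<le> (xss - canon y) (xs0 - ys)" using cl y(1) by (auto simp: gossez_closure_def)
  then have 1: "(xss - canon a) w \<le> w z + w d - (xss - canon a) v + v z + v d"
    by (simp add: z_def w_def d_def v_def blinfun.bilinear_simps algebra_simps)
  have 2: "w z + \<rho> < \<eta>" using less ge_coupling[OF E] by (simp add: z_def w_def blinfun.bilinear_simps)
  have "w d \<le> norm w * norm d" "v z \<le> norm v * norm z" "v d \<le> norm v * norm d"
    "- (xss - canon a) v \<le> c * norm v"
    using norm_blinfun[of w d] norm_blinfun[of v z] norm_blinfun[of v d] norm_blinfun[of "xss - canon a" v]
    by (auto simp: c_def)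
  moreover have "norm w * norm d \<le> norm w * e" "norm v * norm z \<le> e * norm z" "c * norm v \<le> c * e"
    using dv e(1) by (auto simp: c_def intro!: mult_mono)
  moreover have "norm v * norm d \<le> 1 * e" using dv e(2) by (intro mult_mono) auto
  ultimately have 3: "w d - (xss - canon a) v + v z + v d \<le> norm w * e + e * norm z + e + c * e"
    by (simp add: blinfun.minus_left)
  have "e\<^sup>2 \<le> e" using e by (simp add: power2_eq_square mult_left_le)
  \<comment> \<open>This error grows with \<open>norm w\<close>, which only \<open>\<rho>\<close>
    controls. This estimate and the next one give up \<open>\<rho> / 8\<close> each, which is why
    three quarters of \<open>\<rho>\<close> remain in the conclusion.\<close>
  have 4: "norm w * e \<le> \<rho> / 8 + 8 * L * e"
  proof -
    have "0 \<le> (norm w - 16 * L * e)\<^sup>2 / (32 * L)" using L by simp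
    also have "\<dots> = (norm w)\<^sup>2 / (32 * L) - norm w * e + 8 * L * e\<^sup>2"
      using L by (simp add: power2_eq_square field_simps)
    also have "(norm w)\<^sup>2 / (32 * L) \<le> \<rho> / 8" using wsq L by (simp add: field_simps)
    also have "8 * L * e\<^sup>2 \<le> 8 * L * e" using \<open>e\<^sup>2 \<le> e\<close> L by (intro mult_left_mono) auto
    finally show ?thesis by simp
  qed
  have 5: "e * norm z \<le> \<rho> / 8 + 2 / l * e"
  proof -
    have "0 \<le> l * (norm z - 4 * e / l)\<^sup>2 / 8" using l by simp
    also have "\<dots> = l * (norm z)\<^sup>2 / 8 - e * norm z + 2 / l * e\<^sup>2"
      using l by (simp add: power2_eq_square field_simps)
    also have "2 / l * e\<^sup>2 \<le> 2 / l * e" using \<open>e\<^sup>2 \<le> e\<close> l by (intro mult_left_mono) auto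
    finally show ?thesis using zsq by simp
  qed
  have "(xss - canon a) w + 3 / 4 * \<rho> \<le> \<eta> + e * C"
    using 1 2 3 4 5 unfolding C_def by (simp add: algebra_simps)
  also have "\<dots> \<le> \<delta>" using e(4) \<eta>(3) by simp
  finally have 6: "(xss - canon a) w + 3 / 4 * \<rho> \<le> \<delta>" .
  show ?thesis
    using y e(3) \<rho> 6 unfolding w_def
    by (intro exI[of _ x] exI[of _ xs] exI[of _ \<rho>] exI[of _ y] exI[of _ ys]) auto
qed

text \<open>When \<open>xss\<close> is \<open>canon a\<close> and \<open>a\<close> itself is the
  base point, the term with \<open>xss - canon a\<close> vanishes. Then \<open>\<rho>\<close> is
  small, and \<open>\<rho>\<close> controls both squared distances; closedness of the contact set
  does the rest.\<close>

theorem contact_maximal: "maximal_monotone contact"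
proof -
  have "(a, b) \<in> contact" if cl: "(canon a, b) \<in> gossez_closure contact" for a b
  proof -
    have "\<exists>p\<in>contact. dist p (a, b) < \<epsilon>" if \<epsilon>: "0 < \<epsilon>" for \<epsilon>
    proof -
      define \<delta> where "\<delta> = min (\<epsilon> / 8) ((\<epsilon> / 8)\<^sup>2 / 4)"
      have \<delta>: "0 < \<delta>" "\<delta> \<le> \<epsilon> / 8" "\<delta> \<le> (\<epsilon> / 8)\<^sup>2 / 4" using \<epsilon> unfolding \<delta>_def by auto
      obtain x xs \<rho> y ys where y: "(y, ys) \<in> contact" "norm (y - x) \<le> \<delta>" "norm (ys - xs) \<le> \<delta>"
        and \<rho>: "\<And>z. (xs - b) z - 1 / 2 * (norm z)\<^sup>2 + 1 / 2 * (norm (x - a))\<^sup>2 \<le> \<rho>"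
        and le: "(canon a - canon a) (xs - b) + 3 / 4 * \<rho> \<le> \<delta>"
        using contact_near_closure_point[OF cl convex_half_square_norm _ _ order_refl order_refl _ \<delta>(1), of a]
        unfolding norm_minus_cancel by fastforce
      have "(norm (x - a))\<^sup>2 + (norm (xs - b))\<^sup>2 \<le> 2 * \<rho>" by (rule half_square_norm_conjugate[OF \<rho>])
      also have "2 * \<rho> \<le> (\<epsilon> / 8)\<^sup>2" using le \<delta>(3) zero_le_power2[of "\<epsilon> / 8"] unfolding diff_self blinfun.zero_left by argo
      finally have "(norm (x - a))\<^sup>2 \<le> (\<epsilon> / 8)\<^sup>2" "(norm (xs - b))\<^sup>2 \<le> (\<epsilon> / 8)\<^sup>2"
        using zero_le_power2[of "norm (x - a)"] zero_le_power2[of "norm (xs - b)"] by linarith+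
      then have "norm (x - a) \<le> \<epsilon> / 8" "norm (xs - b) \<le> \<epsilon> / 8"
        using \<epsilon> by (auto intro: power2_le_imp_le)
      then have "dist y a \<le> \<epsilon> / 4" "dist ys b \<le> \<epsilon> / 4"
        using y \<delta> norm_triangle_ineq[of "y - x" "x - a"] norm_triangle_ineq[of "ys - xs" "xs - b"]
        by (auto simp: dist_norm)
      then have "dist (y, ys) (a, b) < \<epsilon>"
        using sqrt_sum_squares_le_sum[of "dist y a" "dist ys b"] \<epsilon> by (simp add: dist_Pair_Pair)
      then show ?thesis using y(1) by blast
    qed
    then have "(a, b) \<in> closure contact" by (simp add: closure_approachable)
    then show ?thesis using closed_contact by simp
  qed
  moreover have "(canon a, b) \<in> gossez_closure contact" if "monotone_op S'" "contact \<subseteq> S'" "(a, b) \<in> S'" for S' a b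
    using that unfolding monotone_op_def gossez_closure_def by (fastforce simp flip: canon_diff)
  ultimately show ?thesis unfolding maximal_monotone_def using contact_monotone by auto
qed

text \<open>The seminorm \<open>N\<close> weighs the finitely many functionals in \<open>F\<close> much more than the norm, and the
  base point \<open>a\<close> agrees almost with \<open>xss\<close> on \<open>F\<close>; letting \<open>k\<close> tend to \<open>0\<close> forces norm convergence in the dual.\<close>

theorem contact_bounded_approximation:
  assumes cl: "(xss, xs0) \<in> gossez_closure contact" and F: "finite F" and \<epsilon>: "0 < \<epsilon>"
  shows "\<exists>(y, ys)\<in>contact. norm y \<le> 8 * norm xss + 9 \<and> norm (ys - xs0) < \<epsilon>
    \<and> (\<forall>f\<in>F. \<bar>blinfun_apply f y - xss f\<bar> < \<epsilon>)"
proof -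
  define B where "B = norm xss + 1"
  define G where "G = 1 + (\<Sum>f\<in>F. norm f)"
  \<comment> \<open>\<open>\<theta>\<close> is the weight of the norm against the functionals,
    chosen so that \<open>8 * \<theta> * B\<close> is half of the admissible error on
    \<open>F\<close>. \<open>G\<close> is a Lipschitz constant of the seminorm \<open>p\<close>, and
    \<open>k\<close> makes the final bound \<open>13 * k * (\<theta> + G) * \<theta> * B\<close> on
    the dual norm equal to \<open>\<epsilon> / 4\<close>.\<close>
  define \<theta> where "\<theta> = \<epsilon> / (16 * B)"
  define k where "k = \<epsilon> / (52 * (\<theta> + G) * \<theta> * B)"
  define \<delta> where "\<delta> = min 1 (min (k * \<theta>\<^sup>2 * B\<^sup>2) (\<epsilon> / (4 * G)))"
  have B: "1 \<le> B" by (simp add: B_def)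
  have G: "1 \<le> G" by (simp add: G_def sum_nonneg)
  have \<theta>: "0 < \<theta>" using \<epsilon> B by (simp add: \<theta>_def)
  have k: "0 < k" using \<epsilon> B G \<theta> by (simp add: k_def)
  have \<delta>: "0 < \<delta>" "\<delta> \<le> 1" "\<delta> \<le> k * \<theta>\<^sup>2 * B\<^sup>2" "\<delta> \<le> \<epsilon> / (4 * G)"
    using k \<theta> B G \<epsilon> by (auto simp: \<delta>_def)
  define p where "p z = (\<Sum>f\<in>F. \<bar>blinfun_apply f z\<bar>)" for z
  define N where "N z = \<theta> * norm z + p z" for z
  have p_tri: "p (x + y) \<le> p x + p y" for x y
    unfolding p_def sum.distrib[symmetric] by (intro sum_mono) (simp add: blinfun.add_right)
  have p_scale: "p (c *\<^sub>R x) = \<bar>c\<bar> * p x" for c x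
    by (simp add: p_def blinfun.scaleR_right abs_mult sum_distrib_left)
  have p_nn: "0 \<le> p x" for x by (simp add: p_def sum_nonneg)
  have p_le: "p z \<le> G * norm z" for z
  proof -
    have "p z \<le> (\<Sum>f\<in>F. norm f * norm z)"
      unfolding p_def by (rule sum_mono) (metis norm_blinfun real_norm_def)
    also have "\<dots> \<le> G * norm z" by (simp add: G_def algebra_simps flip: sum_distrib_left)
    finally show ?thesis .
  qed
  have p_ge: "\<bar>blinfun_apply f z\<bar> \<le> p z" if "f \<in> F" for f z
    unfolding p_def using F that by (intro member_le_sum) auto
  have N_scale: "N (c *\<^sub>R x) = \<bar>c\<bar> * N x" for c x by (simp add: N_def p_scale algebra_simps)
  have N_nn: "0 \<le> N x" for x using \<theta> p_nn by (simp add: N_def)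
  have N_tri: "N (x + y) \<le> N x + N y" for x y
  proof -
    have "\<theta> * norm (x + y) \<le> \<theta> * (norm x + norm y)"
      using \<theta> by (intro mult_left_mono norm_triangle_ineq) auto
    then show ?thesis using p_tri[of x y] by (simp add: N_def algebra_simps)
  qed
  define q where "q z = k * (N z)\<^sup>2" for z
  have q: "convex_on UNIV q" unfolding q_def
    by (rule convex_on_square_seminorm) (use N_tri N_scale N_nn k in auto)
  have even: "q (- z) = q z" for z using N_scale[of "- 1" z] by (simp add: q_def)
  have lower: "k * \<theta>\<^sup>2 * (norm z)\<^sup>2 \<le> q z" for z
  proof -
    have "(\<theta> * norm z)\<^sup>2 \<le> (N z)\<^sup>2" using \<theta> p_nn by (intro power_mono) (auto simp: N_def)
    then show ?thesis using k by (simp add: q_def power_mult_distrib)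
  qed
  have upper: "q z \<le> k * (\<theta> + G)\<^sup>2 * (norm z)\<^sup>2" for z
  proof -
    have "(N z)\<^sup>2 \<le> ((\<theta> + G) * norm z)\<^sup>2"
      using N_nn p_le by (intro power_mono) (auto simp: N_def algebra_simps)
    then show ?thesis using k by (simp add: q_def power_mult_distrib)
  qed
  have kl: "0 < k * \<theta>\<^sup>2" and kL: "0 < k * (\<theta> + G)\<^sup>2" using k \<theta> G by simp_all
  have small: "\<exists>a. norm a \<le> norm xss \<and> p' a < \<theta> \<and> (\<forall>f\<in>F'. \<bar>blinfun_apply f a - xss f\<bar> < \<delta>)"
    if p': "p' = (\<lambda>a. \<Sum>f\<in>F. \<bar>blinfun_apply f a - xss f\<bar>)" and F': "finite F'" for p' F'
  proof -
    define \<gamma> where "\<gamma> = min \<delta> (\<theta> / (card F + 1))"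
    have "0 < \<gamma>" using \<delta> \<theta> by (simp add: \<gamma>_def)
    then obtain a where a: "norm a \<le> norm xss" "\<And>f. f \<in> F \<union> F' \<Longrightarrow> \<bar>blinfun_apply f a - xss f\<bar> < \<gamma>"
      using goldstine[OF finite_UnI[OF F F'] \<open>0 < \<gamma>\<close>, of xss] by blast
    have "p' a \<le> card F * \<gamma>"
      unfolding p' by (rule sum_bounded_above) (use a in \<open>auto intro: less_imp_le\<close>)
    also have "\<dots> < (card F + 1) * \<gamma>" using \<open>0 < \<gamma>\<close> by simp
    also have "\<dots> \<le> (card F + 1) * (\<theta> / (card F + 1))"
      by (intro mult_left_mono) (auto simp: \<gamma>_def)
    also have "\<dots> = \<theta>" by simp
    finally show ?thesis using a by (intro exI[of _ a]) (auto simp: \<gamma>_def)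
  qed
  define p' where "p' = (\<lambda>a. \<Sum>f\<in>F. \<bar>blinfun_apply f a - xss f\<bar>)"
  obtain a where a: "norm a \<le> norm xss" "p' a < \<theta>" using small[OF p'_def, of "{}"] by auto
  obtain x xs \<rho> y ys where y: "(y, ys) \<in> contact" "norm (y - x) \<le> \<delta>" "norm (ys - xs) \<le> \<delta>"
    and \<rho>: "\<And>z. (xs - xs0) z - q z + q (x - a) \<le> \<rho>"
    and le: "(xss - canon a) (xs - xs0) + 3 / 4 * \<rho> \<le> \<delta>"
    using contact_near_closure_point[OF cl q even kl lower upper kL \<delta>(1), of a] by blast
  define z w where "z = x - a" and "w = xs - xs0"
  have \<rho>z: "q z \<le> \<rho>" using \<rho>[of 0] upper[of 0] by (simp add: z_def blinfun.zero_right)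
  have qnn: "0 \<le> q z" for z using k by (simp add: q_def)
  \<comment> \<open>The number \<open>(xss - canon a) w\<close> has no definite sign, and
    \<open>a\<close> was fixed before \<open>w\<close>. The second point \<open>a'\<close> is also
    accurate at \<open>w\<close>. Both points are close to \<open>xss\<close> on \<open>F\<close>,
    so \<open>N (a - a')\<close> is small even if \<open>norm (a - a')\<close> is not.\<close>
  obtain a' where a': "norm a' \<le> norm xss" "p' a' < \<theta>" "\<bar>w a' - xss w\<bar> < \<delta>"
    using small[OF p'_def, of "{w}"] by auto
  have "N (a - a') \<le> 2 * \<theta> * B"
  proof -
    have "p (a - a') \<le> p' a + p' a'"
      unfolding p_def p'_def sum.distrib[symmetric] by (intro sum_mono) (auto simp: blinfun.diff_right)
    moreover have "\<theta> * norm (a - a') \<le> \<theta> * (2 * norm xss)"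
      using a(1) a'(1) norm_triangle_ineq4[of a a'] \<theta> by (intro mult_left_mono) auto
    ultimately show ?thesis using a(2) a'(2) by (simp add: N_def B_def algebra_simps)
  qed
  then have "N (2 *\<^sub>R (a - a')) \<le> 4 * \<theta> * B" using N_scale[of 2 "a - a'"] by (simp add: ac_simps)
  then have "q (2 *\<^sub>R (a - a')) \<le> k * (4 * \<theta> * B)\<^sup>2"
    unfolding q_def using k N_nn by (intro mult_left_mono power_mono) auto
  \<comment> \<open>With the factor \<open>2\<close> the comparison of \<open>w a\<close> and
    \<open>w a'\<close> costs only half of \<open>\<rho>\<close>, less than the three quarters at
    hand; with factor \<open>1\<close> it would cost all of \<open>\<rho>\<close>.\<close>
  then have "w (2 *\<^sub>R (a - a')) \<le> \<rho> + 16 * (k * \<theta>\<^sup>2 * B\<^sup>2)"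
    using \<rho>[of "2 *\<^sub>R (a - a')"] qnn[of "x - a"] by (simp add: w_def power_mult_distrib algebra_simps)
  moreover have "w a' - w a \<le> (xss - canon a) w + \<delta>" using a'(3) by (simp add: blinfun.bilinear_simps)
  ultimately have \<rho>le: "\<rho> \<le> 40 * (k * \<theta>\<^sup>2 * B\<^sup>2)"
    using le \<delta>(3) unfolding w_def[symmetric] by (simp add: blinfun.bilinear_simps)
  have Nz: "N z \<le> 7 * \<theta> * B"
  proof (rule power2_le_imp_le)
    have "0 \<le> k * \<theta>\<^sup>2 * B\<^sup>2" using k by simp
    then have "k * (N z)\<^sup>2 \<le> 49 * (k * \<theta>\<^sup>2 * B\<^sup>2)" using \<rho>z \<rho>le unfolding q_def by linarith
    then have "k * (N z)\<^sup>2 \<le> k * (49 * (\<theta>\<^sup>2 * B\<^sup>2))" by (simp add: ac_simps)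
    then show "(N z)\<^sup>2 \<le> (7 * \<theta> * B)\<^sup>2" using k by (simp add: power_mult_distrib)
  qed (use \<theta> B in simp)
  have "\<theta> * norm z \<le> \<theta> * (7 * B)" using Nz p_nn[of z] by (simp add: N_def)
  then have z7: "norm z \<le> 7 * B" using \<theta> by simp
  have pz: "p z \<le> 7 * \<theta> * B" using Nz \<theta> by (simp add: N_def) (smt (verit) mult_nonneg_nonneg norm_ge_zero)
  have "(norm w)\<^sup>2 \<le> 4 * (k * (\<theta> + G)\<^sup>2) * \<rho>"
  proof (rule norm_square_le_of_conjugate_bound[OF kL])
    fix y show "w y - k * (\<theta> + G)\<^sup>2 * (norm y)\<^sup>2 \<le> \<rho>"
      using \<rho>[of y] upper[of y] qnn[of "x - a"] by (simp add: w_def)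
  qed
  also have "\<dots> \<le> 4 * (k * (\<theta> + G)\<^sup>2) * (40 * (k * \<theta>\<^sup>2 * B\<^sup>2))"
    using \<rho>le k by (intro mult_left_mono) auto
  also have "\<dots> \<le> (13 * k * (\<theta> + G) * \<theta> * B)\<^sup>2"
  proof -
    have "4 * (k * (\<theta> + G)\<^sup>2) * (40 * (k * \<theta>\<^sup>2 * B\<^sup>2)) = 160 * (k * (\<theta> + G) * \<theta> * B)\<^sup>2"
      unfolding power_mult_distrib by (simp add: power2_eq_square)
    also have "\<dots> \<le> (13 * (k * (\<theta> + G) * \<theta> * B))\<^sup>2" unfolding power_mult_distrib[of 13] by simp
    finally show ?thesis by (simp only: mult.assoc)
  qed
  finally have "norm w \<le> 13 * k * (\<theta> + G) * \<theta> * B"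
    by (rule power2_le_imp_le) (use k \<theta> G B in simp)
  also have "\<dots> = \<epsilon> / 4"
  proof -
    have "0 < (\<theta> + G) * \<theta> * B" using \<theta> G B by simp
    then have "13 * (\<epsilon> / (52 * ((\<theta> + G) * \<theta> * B))) * ((\<theta> + G) * \<theta> * B) = \<epsilon> / 4"
      by (subst (asm) less_le) (simp add: field_simps)
    then show ?thesis by (simp only: k_def mult.assoc)
  qed
  finally have w: "norm w \<le> \<epsilon> / 4" .
  have "\<delta> \<le> \<epsilon> / 4" using \<delta>(4) G \<epsilon> by (smt (verit) frac_le)
  then have "norm (ys - xs0) < \<epsilon>"
    using norm_triangle_ineq[of "ys - xs" w] y(3) w \<epsilon> by (simp add: w_def)
  moreover have "norm y \<le> 8 * norm xss + 9"
    using norm_triangle_ineq[of "y - x" x] norm_triangle_ineq[of z a] y(2) \<delta>(2) z7 a(1)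
    by (simp add: z_def B_def)
  moreover have "\<bar>blinfun_apply f y - xss f\<bar> < \<epsilon>" if f: "f \<in> F" for f
  proof -
    have "\<bar>f (y - x)\<bar> \<le> norm f * norm (y - x)" using norm_blinfun[of f "y - x"] by simp
    also have "\<dots> \<le> G * \<delta>"
      using y(2) member_le_sum[of f F norm] F f G by (intro mult_mono) (auto simp: G_def)
    also have "\<dots> \<le> \<epsilon> / 4" using \<delta>(4) G by (simp add: field_simps)
    finally have 1: "\<bar>f (y - x)\<bar> \<le> \<epsilon> / 4" .
    have 2: "\<bar>blinfun_apply f z\<bar> \<le> 7 * \<theta> * B" using p_ge[OF f, of z] pz by simp
    have "\<bar>blinfun_apply f a - xss f\<bar> \<le> p' a" unfolding p'_def using F f by (intro member_le_sum) auto
    then have 3: "\<bar>blinfun_apply f a - xss f\<bar> < \<theta> * B" using a(2) \<theta> B by (smt (verit) mult_left_le_one_le mult_le_cancel_left1)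
    have "8 * \<theta> * B = \<epsilon> / 2" using B by (simp add: \<theta>_def)
    then show ?thesis using 1 2 3 \<epsilon> by (simp add: z_def blinfun.diff_right abs_if split: if_splits)
  qed
  ultimately show ?thesis using y(1) by blast
qed

text \<open>One direction restricts the conjugate bound to contact points. For the other, the
  tangent inequality is taken at contact points that approximate \<open>xss\<close> on
  \<open>xs\<close> and \<open>xs0\<close>; the uniform bound \<open>R\<close> on
  \<open>norm y\<close> makes \<open>(ys - xs0) y\<close> negligible in the limit.\<close>

theorem gossez_closure_contact_iff:
  "(xss, xs0) \<in> gossez_closure contact \<longleftrightarrow> conj_le E xs0 xss (xss xs0)"
proof
  assume "conj_le E xs0 xss (xss xs0)"
  from conj_leD[OF this] show "(xss, xs0) \<in> gossez_closure contact"
    by (force simp: gossez_closure_def contact_def blinfun.bilinear_simps)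
next
  assume cl: "(xss, xs0) \<in> gossez_closure contact"
  define R where "R = 8 * norm xss + 9"
  show "conj_le E xs0 xss (xss xs0)"
    unfolding conj_le_def
  proof (intro allI impI)
    fix x xs r assume x: "((x, xs), r) \<in> E"
    have *: "xs0 x + xss xs - r \<le> xss xs0 + e * (2 + norm x + R)" if e: "0 < e" for e
    proof -
      obtain y ys where y: "(y, ys) \<in> contact" "norm y \<le> R" "norm (ys - xs0) < e"
        "\<bar>xs y - xss xs\<bar> < e" "\<bar>xs0 y - xss xs0\<bar> < e"
        using contact_bounded_approximation[OF cl, of "{xs, xs0}" e] e by (auto simp: R_def)
      have b: "\<bar>(ys - xs0) u\<bar> \<le> e * norm u" for u
        using norm_blinfun[of "ys - xs0" u] y(3) by (smt (verit) mult_right_mono norm_ge_zero real_norm_def)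
      have "e * norm y \<le> e * R" using y(2) e by simp
      then show ?thesis
        using contact_tangent[OF y(1) x] y(4,5) b[of x] b[of y] by (simp add: blinfun.diff_left algebra_simps)
    qed
    have "xs0 x + xss xs - r + t * (- (2 + norm x + R)) \<le> xss xs0" if "0 < t" "t \<le> 1" for t
      using *[OF that(1)] by (simp add: algebra_simps)
    from le_of_affine_perturbation[OF this] show "xs0 x + xss xs - r \<le> xss xs0" .
  qed
qed

end

section \<open>Weak-star neighbourhoods and bounded nets\<close>

lemma topspace_wstar [simp]: "topspace wstar = UNIV"
  unfolding wstar_def topology_generated_by_topspace by (auto intro: exI[of _ UNIV])

lemma wstar_nhd_basis:
  assumes "openin wstar U" "f \<in> U"
  shows "\<exists>F e. finite F \<and> 0 < e \<and> (\<forall>g. (\<forall>x\<in>F. \<bar>blinfun_apply g x - blinfun_apply f x\<bar> < e) \<longrightarrow> g \<in> U)"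
proof -
  have "generate_topology_on {{f. blinfun_apply f x \<in> U} | x U. open U} U"
    using assms(1) by (simp add: wstar_def openin_topology_generated_by_iff)
  then show ?thesis using assms(2)
  proof induction
    case (Int a b)
    from Int.IH(1) Int.prems obtain F e where "finite F" "0 < e"
      "\<forall>g. (\<forall>x\<in>F. \<bar>blinfun_apply g x - blinfun_apply f x\<bar> < e) \<longrightarrow> g \<in> a" by blast
    moreover from Int.IH(2) Int.prems obtain F' e' where "finite F'" "0 < e'"
      "\<forall>g. (\<forall>x\<in>F'. \<bar>blinfun_apply g x - blinfun_apply f x\<bar> < e') \<longrightarrow> g \<in> b" by blast
    ultimately show ?case by (intro exI[of _ "F \<union> F'"] exI[of _ "min e e'"]) auto
  next
    case (UN K)
    then obtain k where k: "k \<in> K" "f \<in> k" by blast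
    show ?case using UN.IH[OF k] k(1) by blast
  next
    case (Basis s)
    then obtain x V where s: "s = {f. blinfun_apply f x \<in> V}" "open V" by blast
    then obtain e where "0 < e" "ball (blinfun_apply f x) e \<subseteq> V" using Basis by (auto elim: openE)
    then show ?case unfolding s(1)
      by (intro exI[of _ "{x}"] exI[of _ e]) (auto simp: dist_real_def subset_iff abs_minus_commute)
  qed simp
qed

context strong_epigraph
begin

theorem contact_gossez_D: "gossez_D contact"
  unfolding gossez_D_def
proof (intro conjI contact_maximal, clarify)
  fix xss xs assume cl: "(xss, xs) \<in> gossez_closure contact"
  define T where "T = prod_topology (wstar :: 'a dual dual topology) (euclidean :: 'a dual topology)"
  define g where "g = (\<lambda>(x :: 'a, xs :: 'a dual). (canon x, xs))"
  define B where "B = contact \<inter> cball 0 (8 * norm xss + 9) \<times> cball xs 1"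
  \<comment> \<open>The neighbourhoods of the limit are pulled back along the embedding and traced
    on the bounded set \<open>B\<close>. Convergence holds by construction; properness is the
    content of the approximation theorem.\<close>
  define F where "F = inf (filtercomap g (nhdsin T (xss, xs))) (principal B)"
  have T: "topspace T = UNIV" by (simp add: T_def)
  have "F \<noteq> bot"
  proof
    assume "F = bot"
    then have "eventually (\<lambda>_. False) F" by simp
    then obtain Q where Q: "eventually Q (nhdsin T (xss, xs))" "\<And>p. Q (g p) \<Longrightarrow> p \<notin> B"
      unfolding F_def eventually_inf_principal eventually_filtercomap by blast
    then obtain W where W: "openin T W" "(xss, xs) \<in> W" "\<And>p. p \<in> W \<Longrightarrow> Q p"
      by (auto simp: eventually_nhdsin T)
    then obtain U V where UV: "openin wstar U" "open V" "xss \<in> U" "xs \<in> V" "U \<times> V \<subseteq> W"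
      unfolding T_def openin_prod_topology_alt by (metis open_openin)
    obtain H e where H: "finite H" "0 < e" "\<And>g. (\<forall>x\<in>H. \<bar>blinfun_apply g x - xss x\<bar> < e) \<Longrightarrow> g \<in> U"
      using wstar_nhd_basis[OF UV(1,3)] by blast
    obtain d where d: "0 < d" "ball xs d \<subseteq> V" using UV(2,4) by (auto elim: openE)
    define \<epsilon> where "\<epsilon> = min 1 (min e d)"
    have "0 < \<epsilon>" using H d by (simp add: \<epsilon>_def)
    then obtain y ys where y: "(y, ys) \<in> contact" "norm y \<le> 8 * norm xss + 9" "norm (ys - xs) < \<epsilon>"
      "\<And>f. f \<in> H \<Longrightarrow> \<bar>blinfun_apply f y - xss f\<bar> < \<epsilon>"
      using contact_bounded_approximation[OF cl H(1)] by blast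
    have "canon y \<in> U" using y(4) by (intro H(3)) (auto simp: \<epsilon>_def)
    moreover have "ys \<in> V" using y(3) d by (auto simp: \<epsilon>_def dist_norm norm_minus_commute subset_iff)
    ultimately have "Q (g (y, ys))" using UV(5) W(3) by (auto simp: g_def)
    moreover have "(y, ys) \<in> B" using y by (simp add: B_def \<epsilon>_def dist_norm norm_minus_commute)
    ultimately show False using Q(2) by blast
  qed
  moreover have "bounded B" unfolding B_def
    by (rule bounded_subset[OF bounded_Times[OF bounded_cball bounded_cball]]) auto
  moreover have "B \<subseteq> contact" by (simp add: B_def)
  moreover have "eventually (\<lambda>p. p \<in> B) F" by (simp add: F_def eventually_inf_principal)
  moreover have "limitin T g (xss, xs) F"
    unfolding limitin_def
  proof (intro conjI allI impI)
    show "(xss, xs) \<in> topspace T" by (simp add: T)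
    fix U assume "openin T U \<and> (xss, xs) \<in> U"
    then have "eventually (\<lambda>p. p \<in> U) (nhdsin T (xss, xs))" by (auto simp: eventually_nhdsin)
    then show "\<forall>\<^sub>F p in F. g p \<in> U"
      unfolding F_def eventually_inf_principal eventually_filtercomap by blast
  qed
  ultimately show "\<exists>F B. F \<noteq> bot \<and> bounded B \<and> B \<subseteq> contact \<and> eventually (\<lambda>p. p \<in> B) F \<and>
      limitin (prod_topology wstar euclidean) (\<lambda>(x, xs). (canon x, xs)) (xss, xs) F"
    unfolding T_def g_def by blast
qed

end

section \<open>Baire category and the open mapping theorem for convex sets\<close>

lemma closed_cover_has_interior:
  fixes L :: "'a::complete_space set" and C :: "nat \<Rightarrow> 'a set"
  assumes L: "closed L" "L \<noteq> {}" and C: "\<And>n. closed (C n)" and cover: "L \<subseteq> (\<Union>n. C n)"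
  shows "\<exists>n x e. x \<in> L \<and> 0 < e \<and> L \<inter> ball x e \<subseteq> C n"
proof (rule ccontr)
  assume contr: "\<not> ?thesis"
  \<comment> \<open>Baire's theorem is used in the subspace topology of \<open>L\<close>, because
    the affine hull in condition (a) may be a proper closed subspace.\<close>
  have "top_of_set L interior_of \<Union> (range (\<lambda>n. L \<inter> C n)) = {}"
  proof (rule Baire_category_alt)
    show "completely_metrizable_space (top_of_set L) \<or> locally_compact_space (top_of_set L) \<and> regular_space (top_of_set L)"
      using completely_metrizable_space_closedin[OF completely_metrizable_space_euclidean] L(1)
      by (metis closed_closedin)
    fix T assume "T \<in> range (\<lambda>n. L \<inter> C n)"
    then obtain n where T: "T = L \<inter> C n" by blast
    have "top_of_set L interior_of T = {}"
    proof (rule ccontr)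
      assume "top_of_set L interior_of T \<noteq> {}"
      then obtain U x where U: "openin (top_of_set L) U" "x \<in> U" "U \<subseteq> T" by (auto simp: interior_of_def)
      then obtain e where "0 < e" "ball x e \<inter> L \<subseteq> U" "x \<in> L" by (auto simp: openin_contains_ball subset_iff)
      then show False using contr U T by blast
    qed
    then show "closedin (top_of_set L) T \<and> top_of_set L interior_of T = {}"
      using C[of n] T closedin_closed by blast
  qed simp
  moreover have "\<Union> (range (\<lambda>n. L \<inter> C n)) = topspace (top_of_set L)" using cover by auto
  ultimately show False using L(2) by (metis interior_of_topspace topspace_euclidean_subtopology)
qed

text \<open>Robinson--Ursescu: the open mapping theorem for the convex process \<open>q \<mapsto> B q\<close> restricted to \<open>G\<close>.\<close>

theorem convex_open_mapping:
  fixes B :: "'q::banach \<Rightarrow>\<^sub>L 'z::banach"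
  assumes G: "convex G" "closed G" and L: "subspace L" "closed L" and BG: "\<And>q. q \<in> G \<Longrightarrow> B q \<in> L"
    and absorb: "\<And>z. z \<in> L \<Longrightarrow> \<exists>t>0. \<exists>q\<in>G. B q = t *\<^sub>R z"
  shows "\<exists>d>0. \<exists>R. \<forall>z\<in>L. norm z < d \<longrightarrow> (\<exists>q\<in>G. norm q \<le> R \<and> B q = z)"
proof -
  obtain q0 where q0: "q0 \<in> G" "B q0 = 0" using absorb[of 0] subspace_0[OF L(1)] by auto
  define H where "H n = B ` (G \<inter> cball 0 n)" for n :: real
  have H_mono: "H m \<subseteq> H n" if "m \<le> n" for m n using that by (auto simp: H_def)
  have H_conv: "convex (closure (H n))" for n
    unfolding H_def by (intro convex_closure convex_linear_image convex_Int G convex_cball)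
      (simp add: blinfun.bounded_linear_right bounded_linear.linear)
  \<comment> \<open>\<open>G\<close> is not a cone, so the images of bounded parts are dilated: any
    \<open>z\<close> in \<open>L\<close>, shrunk enough, is the image of a convex combination of
    \<open>q0\<close> and a point over a positive multiple of \<open>z\<close>.\<close>
  define C where "C n = (\<lambda>z. (1 / real (Suc n)) *\<^sub>R z) -` closure (H n)" for n :: nat
  have "\<exists>n x e. x \<in> L \<and> 0 < e \<and> L \<inter> ball x e \<subseteq> C n"
  proof (rule closed_cover_has_interior[OF L(2)])
    show "L \<noteq> {}" using subspace_0[OF L(1)] by blast
    show "closed (C n)" for n unfolding C_def by (intro closed_vimage closed_closure continuous_intros)
    show "L \<subseteq> (\<Union>n. C n)"
    proof
      fix z assume "z \<in> L"
      then obtain t q where t: "0 < t" "q \<in> G" "B q = t *\<^sub>R z" using absorb by blast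
      obtain n :: nat where n: "max (1 / t) (norm q0 + norm q) \<le> n" using real_arch_simple by blast
      define s where "s = 1 / (real (Suc n) * t)"
      have "1 / t \<le> real (Suc n)" using n by simp
      then have s: "0 \<le> s" "s \<le> 1" using t(1) by (auto simp: s_def field_simps)
      define p where "p = (1 - s) *\<^sub>R q0 + s *\<^sub>R q"
      have "p \<in> G" unfolding p_def using s by (intro convexD[OF G(1) q0(1) t(2)]) auto
      moreover have "norm p \<le> n"
      proof -
        have "norm p \<le> (1 - s) * norm q0 + s * norm q"
          unfolding p_def using norm_triangle_ineq[of "(1 - s) *\<^sub>R q0" "s *\<^sub>R q"] s by simp
        also have "\<dots> \<le> 1 * norm q0 + 1 * norm q" using s by (intro add_mono mult_right_mono) auto
        finally show ?thesis using n by simp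
      qed
      moreover have "B p = (1 / real (Suc n)) *\<^sub>R z"
        unfolding p_def using q0(2) t by (simp add: blinfun.bilinear_simps s_def)
      ultimately have "(1 / real (Suc n)) *\<^sub>R z \<in> H n" unfolding H_def by (intro image_eqI[of _ _ p]) auto
      then show "z \<in> (\<Union>n. C n)" unfolding C_def using closure_subset by blast
    qed
  qed
  then obtain n x e where x: "x \<in> L" "0 < e" and ball: "\<And>y. y \<in> L \<Longrightarrow> norm (y - x) < e \<Longrightarrow> (1 / real (Suc n)) *\<^sub>R y \<in> closure (H n)"
    unfolding C_def by (force simp: dist_norm norm_minus_commute)
  \<comment> \<open>The relative interior found so far surrounds a multiple of \<open>x\<close>, not
    \<open>0\<close>. A point of \<open>G\<close> over a negative multiple of \<open>x\<close> is
    mixed in with weight \<open>1 - l\<close>, and \<open>l\<close> is such that the two multiples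
    cancel.\<close>
  obtain t q where t: "0 < t" "q \<in> G" "B q = t *\<^sub>R (- x)" using absorb[of "- x"] subspace_neg[OF L(1) x(1)] by blast
  define m where "m = real n + norm q + norm q0"
  define \<sigma> l where "\<sigma> = 1 / real (Suc n)" and "l = t / (\<sigma> + t)"
  have \<sigma>: "0 < \<sigma>" by (simp add: \<sigma>_def)
  have l: "0 < l" "l < 1" using t(1) \<sigma> by (auto simp: l_def)
  define d where "d = l * \<sigma> * e"
  have d: "0 < d" using l \<sigma> x(2) by (simp add: d_def)
  have near: "v \<in> closure (H m)" if v: "v \<in> L" "norm v < d" for v
  proof -
    define y where "y = x + (1 / (l * \<sigma>)) *\<^sub>R v"
    have "y \<in> L" unfolding y_def using x(1) v(1) by (intro subspace_add subspace_scale L)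
    moreover have "norm (y - x) < e" using v(2) l \<sigma> by (simp add: y_def d_def field_simps)
    ultimately have "\<sigma> *\<^sub>R y \<in> closure (H n)" unfolding \<sigma>_def by (rule ball)
    then have 1: "\<sigma> *\<^sub>R y \<in> closure (H m)" using closure_mono[OF H_mono, of n m] by (auto simp: m_def)
    have "B q \<in> H m" unfolding H_def using t(2) by (intro imageI) (simp add: m_def)
    then have 2: "t *\<^sub>R (- x) \<in> closure (H m)" using t(3) closure_subset by fastforce
    have "l *\<^sub>R (\<sigma> *\<^sub>R y) + (1 - l) *\<^sub>R (t *\<^sub>R (- x)) \<in> closure (H m)"
      using l by (intro convexD[OF H_conv 1 2]) auto
    moreover have "l * \<sigma> = (1 - l) * t" using \<sigma> t(1) by (simp add: l_def field_simps)
    then have "l *\<^sub>R (\<sigma> *\<^sub>R y) + (1 - l) *\<^sub>R (t *\<^sub>R (- x)) = v"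
      using l \<sigma> t(1) by (simp add: y_def scaleR_add_right)
    ultimately show ?thesis by simp
  qed
  define G' where "G' = G \<inter> cball 0 m"
  have G': "convex G'" "closed G'" "q0 \<in> G'" "\<And>q. q \<in> G' \<Longrightarrow> norm q \<le> m"
    using G q0 by (auto simp: G'_def m_def intro: convex_Int closed_Int)
  have "\<exists>q\<in>G'. norm (v - B q) < d / 2" if "v \<in> L" "norm v < d" for v
  proof -
    have "\<exists>y\<in>H m. dist y v < d / 2" 
      using near[OF that] half_gt_zero[OF d] unfolding closure_approachable by blast
    then show ?thesis by (auto simp: H_def G'_def dist_norm norm_minus_commute)
  qed
  then obtain Q where Q: "\<And>v. v \<in> L \<Longrightarrow> norm v < d \<Longrightarrow> Q v \<in> G'"
    "\<And>v. v \<in> L \<Longrightarrow> norm v < d \<Longrightarrow> norm (v - B (Q v)) < d / 2" by metis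
  have "\<exists>q\<in>G. norm q \<le> m \<and> B q = z" if z: "z \<in> L" "norm z < d / 2" for z
  proof -
    \<comment> \<open>\<open>r k\<close> is the residual after \<open>k\<close> corrections, doubled
      each time so that it stays in the range of \<open>Q\<close>. It starts at
      \<open>2 *\<^sub>R z\<close> because the first weight is \<open>1 / 2\<close>.\<close>
    define r where "r k = ((\<lambda>v. 2 *\<^sub>R (v - B (Q v))) ^^ k) (2 *\<^sub>R z)" for k
    have r0: "r 0 = 2 *\<^sub>R z" and rS: "r (Suc k) = 2 *\<^sub>R (r k - B (Q (r k)))" for k by (auto simp: r_def)
    have r: "r k \<in> L \<and> norm (r k) < d" for k
    proof (induction k)
      case 0
      then show ?case using z by (simp add: r0 subspace_scale[OF L(1)])
    next
      case (Suc k)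
      then have "B (Q (r k)) \<in> L" using Q(1) BG by (auto simp: G'_def)
      then show ?case using Suc Q(2)[of "r k"] by (simp add: rS subspace_scale subspace_diff L(1))
    qed
    define p where "p k = Q (r k)" for k
    have p: "p k \<in> G'" for k using Q(1) r by (simp add: p_def)
    define s where "s n = (\<Sum>k<n. (1 / 2) ^ Suc k *\<^sub>R p k)" for n
    \<comment> \<open>The weights of \<open>s n\<close> add up to \<open>1 - (1 / 2) ^ n\<close>
      only, and convexity needs total mass \<open>1\<close>. The missing mass is put on an arbitrary
      \<open>u\<close> in \<open>G'\<close>.\<close>
    have sG: "s n + (1 / 2) ^ n *\<^sub>R u \<in> G'" if "u \<in> G'" for n u
      using that
    proof (induction n arbitrary: u)
      case (Suc n)
      have "(1 / 2) *\<^sub>R p n + (1 / 2) *\<^sub>R u \<in> G'" by (rule convexD[OF G'(1) p Suc.prems]) auto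
      from Suc.IH[OF this] show ?case by (simp add: s_def scaleR_add_right add.assoc)
    qed (simp add: s_def)
    have Bs: "B (s n) = z - (1 / 2) ^ Suc n *\<^sub>R r n" for n
    proof (induction n)
      case (Suc n)
      have "B (p n) = r n - (1 / 2) *\<^sub>R r (Suc n)" by (simp add: rS p_def)
      then show ?case using Suc by (simp add: s_def blinfun.bilinear_simps scaleR_diff_right)
    qed (simp add: s_def r0 blinfun.zero_right)
    have half: "(\<lambda>n. (1 / 2 :: real) ^ n) \<longlonglongrightarrow> 0" by (rule LIMSEQ_realpow_zero) auto
    have "summable (\<lambda>k. (1 / 2) ^ Suc k *\<^sub>R p k)"
    proof (rule summable_comparison_test)
      show "summable (\<lambda>k. m * (1 / 2 :: real) ^ k)" by (intro summable_mult summable_geometric) simp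
      have "norm ((1 / 2) ^ Suc k *\<^sub>R p k) \<le> m * (1 / 2) ^ k" for k
      proof -
        have "norm ((1 / 2) ^ Suc k *\<^sub>R p k) = (1 / 2) ^ Suc k * norm (p k)" by simp
        also have "\<dots> \<le> (1 / 2) ^ k * m" using G'(4)[OF p[of k]] by (intro mult_mono) auto
        finally show ?thesis by (simp add: mult.commute)
      qed
      then show "\<exists>N. \<forall>k\<ge>N. norm ((1 / 2) ^ Suc k *\<^sub>R p k) \<le> m * (1 / 2) ^ k" by blast
    qed
    then obtain q where q: "s \<longlonglongrightarrow> q" unfolding s_def by (blast dest: summable_LIMSEQ)
    have "(\<lambda>n. s n + (1 / 2) ^ n *\<^sub>R q0) \<longlonglongrightarrow> q + 0 *\<^sub>R q0" by (intro tendsto_intros q half)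
    then have "q + 0 *\<^sub>R q0 \<in> G'" by (rule closed_sequentially[OF G'(2) sG[OF G'(3)]])
    moreover have "(\<lambda>n. (1 / 2) ^ Suc n *\<^sub>R r n) \<longlonglongrightarrow> 0"
    proof (rule Lim_null_comparison[OF always_eventually])
      show "(\<lambda>n. (1 / 2) ^ n * d) \<longlonglongrightarrow> 0" using tendsto_mult_right[OF half, of d] by simp
      show "\<forall>n. norm ((1 / 2) ^ Suc n *\<^sub>R r n) \<le> (1 / 2) ^ n * d"
      proof
        fix n
        have "norm ((1 / 2) ^ Suc n *\<^sub>R r n) = (1 / 2) ^ Suc n * norm (r n)" by simp
        also have "\<dots> \<le> (1 / 2) ^ n * d" using r[of n] by (intro mult_mono) auto
        finally show "norm ((1 / 2) ^ Suc n *\<^sub>R r n) \<le> (1 / 2) ^ n * d" .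
      qed
    qed
    then have "(\<lambda>n. B (s n)) \<longlonglongrightarrow> z - 0" unfolding Bs by (intro tendsto_diff tendsto_const)
    moreover have "(\<lambda>n. B (s n)) \<longlonglongrightarrow> B q" by (intro blinfun.tendsto tendsto_const q)
    ultimately have "B q = z" using LIMSEQ_unique by fastforce
    then show ?thesis using \<open>q + 0 *\<^sub>R q0 \<in> G'\<close> by (auto simp: G'_def)
  qed
  then show ?thesis using d by (intro exI[of _ "d / 2"]) auto
qed

section \<open>The conjugate of the parallel sum\<close>

text \<open>The epigraph of \<open>inf_conv1\<close>, up to closure: the infimum need not be attained.\<close>

definition parallel_epi :: "('x::real_normed_vector \<Rightarrow>\<^sub>L 'y::real_normed_vector) \<Rightarrow> (('x \<times> 'x dual) \<times> real) set
    \<Rightarrow> (('y \<times> 'y dual) \<times> real) set \<Rightarrow> (('x \<times> 'x dual) \<times> real) set" where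
  "parallel_epi A E1 E2 = {((u + w, adjoint_op A vs), r1 + r2) | u w vs r1 r2.
     ((u, adjoint_op A vs), r1) \<in> E1 \<and> ((A w, vs), r2) \<in> E2}"

lemma parallel_epiI:
  "((u, adjoint_op A vs), r1) \<in> E1 \<Longrightarrow> ((A w, vs), r2) \<in> E2
    \<Longrightarrow> ((u + w, adjoint_op A vs), r1 + r2) \<in> parallel_epi A E1 E2"
  unfolding parallel_epi_def by blast

text \<open>A linear functional bounded above vanishes. This is how a variable that ranges over a
  whole space yields an equation for the multipliers.\<close>

lemma blinfun_eq_of_affine_le:
  fixes f g :: "'v::real_normed_vector dual"
  assumes "\<And>x. f x - g x \<le> C"
  shows "f = g"
proof (rule blinfun_eqI)
  have "linear (\<lambda>x. (f - g) x)" by (simp add: blinfun.bounded_linear_right bounded_linear.linear)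
  then have le: "(f - g) x \<le> 0" for x
    by (rule linear_le_sublinear_of_affine_le[where C=C]) (use assms in \<open>auto simp: blinfun.diff_left\<close>)
  show "f x = g x" for x
    using le[of x] le[of "- x"] by (simp add: blinfun.diff_left blinfun.minus_right)
qed

text \<open>Take for \<open>s\<close> the supremum of \<open>F\<close>, finite because
  \<open>Q\<close> is nonempty, and \<open>r - s\<close> for \<open>t\<close>. It distributes one
  joint conjugate bound over two functions.\<close>

lemma split_bounded_sum:
  fixes F :: "'a \<Rightarrow> real" and G :: "'b \<Rightarrow> real"
  assumes le: "\<And>a b. a \<in> P \<Longrightarrow> b \<in> Q \<Longrightarrow> F a + G b \<le> r" and ne: "P \<noteq> {}" "Q \<noteq> {}"
  shows "\<exists>s t. (\<forall>a\<in>P. F a \<le> s) \<and> (\<forall>b\<in>Q. G b \<le> t) \<and> s + t \<le> r"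
proof -
  obtain b0 where b0: "b0 \<in> Q" using ne by blast
  have bdd: "bdd_above (F ` P)" using le[OF _ b0] by (intro bdd_aboveI2[of _ _ "r - G b0"]) (simp add: algebra_simps)
  define s where "s = (SUP a\<in>P. F a)"
  have s: "F a \<le> s" if "a \<in> P" for a unfolding s_def by (rule cSUP_upper[OF that bdd])
  have "G b \<le> r - s" if "b \<in> Q" for b
  proof -
    have "s \<le> r - G b" unfolding s_def using le[OF _ that] ne(1) by (intro cSUP_least) (simp_all add: algebra_simps)
    then show ?thesis by simp
  qed
  then show ?thesis using s by (intro exI[of _ s] exI[of _ "r - s"]) auto
qed

text \<open>Lagrange duality. The variables are points of \<open>E1\<close> and \<open>E2\<close>
  and free \<open>w\<close>, \<open>p\<close>; the constraints \<open>y = A w\<close>,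
  \<open>v = p\<close> and \<open>us = adjoint_op A p\<close> describe \<open>parallel_epi\<close>.
  Their multipliers are, in this order, the required \<open>vs\<close>, \<open>vss\<close> and
  \<open>uss\<close>.\<close>

theorem parallel_conjugate_interior:
  fixes A :: "'x::banach \<Rightarrow>\<^sub>L 'y::banach"
    and E1 :: "(('x \<times> 'x dual) \<times> real) set" and E2 :: "(('y \<times> 'y dual) \<times> real) set"
  assumes E1: "convex E1" "closed E1" and E2: "convex E2" "closed E2"
    and D: "D = {(y - A w, v - p, us - adjoint_op A p) | u us r1 y v r2 w p. ((u, us), r1) \<in> E1 \<and> ((y, v), r2) \<in> E2}"
    and aff: "closed (affine hull D)" and D0: "0 \<in> D" and core: "0 \<in> icr D"
    and le: "conj_le (parallel_epi A E1 E2) xs xss r"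
  shows "\<exists>uss vs vss s t. adjoint_op A vs = xs \<and> adjoint_op (adjoint_op A) uss + vss = adjoint_op (adjoint_op A) xss
    \<and> conj_le E1 xs uss s \<and> conj_le E2 vs vss t \<and> s + t \<le> r"
proof -
  define As where "As = adjoint_op A"
  define B0 where "B0 = (\<lambda>q :: (('x \<times> 'x dual) \<times> real) \<times> (('y \<times> 'y dual) \<times> real) \<times> ('x \<times> 'y dual).
    (fst (fst (fst (snd q))) - A (fst (snd (snd q))),
     snd (fst (fst (snd q))) - snd (snd (snd q)), snd (fst (fst q)) - As (snd (snd (snd q)))))"
  define k0 where "k0 = (\<lambda>q :: (('x \<times> 'x dual) \<times> real) \<times> (('y \<times> 'y dual) \<times> real) \<times> ('x \<times> 'y dual).
    snd (fst q) + snd (fst (snd q)) - xs (fst (fst (fst q))) - xs (fst (snd (snd q))) - xss (As (snd (snd (snd q)))))"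
  note bl = bounded_linear_Pair bounded_linear_sub bounded_linear_add bounded_linear_fst bounded_linear_snd
    bounded_linear_compose[OF bounded_linear_fst] bounded_linear_compose[OF bounded_linear_snd]
    bounded_linear_compose[OF blinfun.bounded_linear_right]
  have "bounded_linear B0" unfolding B0_def by (intro bl)
  then obtain B where B: "\<And>q. blinfun_apply B q = B0 q" using bounded_linear_Blinfun_apply by metis
  have "bounded_linear k0" unfolding k0_def by (intro bl)
  then obtain k where k: "\<And>q. blinfun_apply k q = k0 q" using bounded_linear_Blinfun_apply by metis
  define G :: "((('x \<times> 'x dual) \<times> real) \<times> (('y \<times> 'y dual) \<times> real) \<times> ('x \<times> 'y dual)) set" where "G = E1 \<times> E2 \<times> UNIV"
  have G: "convex G" "closed G" unfolding G_def using E1 E2 by (auto intro!: convex_Times closed_Times)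
  have BG: "B ` G = D"
  proof
    show "B ` G \<subseteq> D" unfolding D G_def As_def[symmetric] by (auto simp: B B0_def) metis
    show "D \<subseteq> B ` G"
    proof
      fix z assume "z \<in> D"
      then obtain u us r1 y v r2 w p where "z = (y - A w, v - p, us - As p)" "((u, us), r1) \<in> E1" "((y, v), r2) \<in> E2"
        unfolding D As_def by blast
      then show "z \<in> B ` G"
        unfolding G_def by (intro image_eqI[of _ _ "(((u, us), r1), ((y, v), r2), (w, p))"]) (auto simp: B B0_def)
    qed
  qed
  define L where "L = affine hull D"
  have core': "\<exists>d>0. \<forall>l\<in>{0..d}. l *\<^sub>R z \<in> D" if "z \<in> affine hull (set_minus D D)" for z
    using core that by (auto simp: icr_def)
  have "D \<subseteq> set_minus D D" 
  proof
    fix z assume "z \<in> D"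
    then show "z \<in> set_minus D D"
      unfolding set_minus_def using D0 by (intro CollectI exI[of _ z] exI[of _ 0]) simp
  qed
  then have L_sub: "L \<subseteq> affine hull (set_minus D D)" unfolding L_def by (rule hull_mono)
  have L: "subspace L" "closed L" "D \<subseteq> L"
    using aff affine_hull_span_0[OF hull_inc[OF D0]] hull_subset[of D affine] unfolding L_def by simp_all
  have "\<exists>d>0. \<exists>R. \<forall>z\<in>L. norm z < d \<longrightarrow> (\<exists>q\<in>G. norm q \<le> R \<and> B q = z)"
  proof (rule convex_open_mapping[OF G L(1,2)])
    show "B q \<in> L" if "q \<in> G" for q using that BG L(3) by blast
    show "\<exists>t>0. \<exists>q\<in>G. B q = t *\<^sub>R z" if "z \<in> L" for z
    proof -
      obtain d where d: "0 < d" "\<forall>l\<in>{0..d}. l *\<^sub>R z \<in> D" using core' L_sub \<open>z \<in> L\<close> by blast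
      then have "d *\<^sub>R z \<in> B ` G" unfolding BG by simp
      then show ?thesis using d(1) by (metis imageE)
    qed
  qed
  then obtain d R where d: "0 < d" and R: "\<And>z. z \<in> L \<Longrightarrow> norm z < d \<Longrightarrow> \<exists>q\<in>G. norm q \<le> R \<and> B q = z" by blast
  have zero: "- r \<le> k q" if q: "q \<in> G" "B q = 0" for q
  proof -
    obtain u us r1 y v r2 w p where qq: "q = (((u, us), r1), ((y, v), r2), (w, p))" by (metis surj_pair)
    have "y = A w" "v = p" "us = As p" using q(2) by (simp_all add: B B0_def qq zero_prod_def)
    then have "((u + w, As p), r1 + r2) \<in> parallel_epi A E1 E2"
      using q(1) unfolding As_def G_def qq by (intro parallel_epiI) auto
    from conj_leD[OF le this] show ?thesis by (simp add: k k0_def qq blinfun.bilinear_simps)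
  qed
  define KR where "KR = norm k * R"
  define E where "E = (\<lambda>q. (B q, k q)) ` G"
  have "convex E" unfolding E_def
    by (intro convex_linear_image G) (simp add: bounded_linear.linear bl blinfun.bounded_linear_right)
  moreover have "E \<noteq> {}" using D0 BG by (auto simp: E_def)
  \<comment> \<open>The open mapping theorem bounds the objective from above, by \<open>KR\<close>,
    at some point over the opposite vector \<open>- (c / n) *\<^sub>R z\<close>. Convexity across
    \<open>0\<close>, where the objective is at least \<open>- r\<close>, turns this into a lower
    bound of linear growth at \<open>z\<close>.\<close>
  moreover have "- r \<le> \<rho> + 2 * \<bar>KR + r\<bar> / d * norm (z - 0)" if z: "(z, \<rho>) \<in> E" for z \<rho>
  proof -
    obtain q where q: "q \<in> G" "B q = z" "k q = \<rho>" using z by (auto simp: E_def)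
    show ?thesis
    proof (cases "z = 0")
      case True
      then show ?thesis using zero[OF q(1)] q by simp
    next
      case False
      define n where "n = norm z"
      have n: "0 < n" using False by (simp add: n_def)
      define c where "c = d / 2"
      have c: "0 < c" using d by (simp add: c_def)
      have "z \<in> L" using q BG L(3) by blast
      then have "- (c / n) *\<^sub>R z \<in> L" by (rule subspace_scale[OF L(1)])
      moreover have "norm (- (c / n) *\<^sub>R z) < d" using n d by (simp add: n_def c_def)
      ultimately obtain q' where q': "q' \<in> G" "norm q' \<le> R" "B q' = - (c / n) *\<^sub>R z"
        using R by blast
      have "norm (k q') \<le> norm k * norm q'" by (rule norm_blinfun)
      also have "\<dots> \<le> KR" using q'(2) by (simp add: KR_def mult_left_mono)
      finally have kq': "k q' \<le> KR" by simp
      have "(c / (n + c)) *\<^sub>R q + (n / (n + c)) *\<^sub>R q' \<in> G"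
        using n c by (intro convexD[OF G(1) q(1) q'(1)]) (auto simp flip: add_divide_distrib)
      moreover have "B ((c / (n + c)) *\<^sub>R q + (n / (n + c)) *\<^sub>R q') = 0"
        using n c q(2) q'(3) by (simp add: blinfun.bilinear_simps)
      ultimately have "- r \<le> k ((c / (n + c)) *\<^sub>R q + (n / (n + c)) *\<^sub>R q')" by (rule zero)
      also have "\<dots> = (c * \<rho> + n * k q') / (n + c)" using q(3) by (simp add: blinfun.bilinear_simps add_divide_distrib)
      finally have "- r * (n + c) \<le> c * \<rho> + n * k q'" using n c by (simp add: field_simps)
      also have "\<dots> \<le> c * \<rho> + n * KR" using kq' n by simp
      finally have "c * (- r) \<le> c * \<rho> + n * (KR + r)" by (simp add: algebra_simps)
      also have "\<dots> \<le> c * \<rho> + n * \<bar>KR + r\<bar>" using n by simp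
      also have "\<dots> = c * (\<rho> + \<bar>KR + r\<bar> / c * n)" using c by (simp add: field_simps)
      finally have "- r \<le> \<rho> + \<bar>KR + r\<bar> / c * n" using c by (simp only: mult_le_cancel_left_pos)
      then show ?thesis by (simp add: c_def n_def ac_simps)
    qed
  qed
  ultimately obtain \<phi> :: "('y \<times> 'y dual \<times> 'x dual) dual" where \<phi>: "\<And>z \<rho>. (z, \<rho>) \<in> E \<Longrightarrow> \<phi> (z - 0) + - r \<le> \<rho>"
    using convex_affine_minorant[of E "2 * \<bar>KR + r\<bar> / d" "- r" 0] d by auto
  obtain \<alpha> \<beta>\<gamma> where 1: "\<And>y z. \<phi> (y, z) = blinfun_apply \<alpha> y + blinfun_apply \<beta>\<gamma> z" using blinfun_prod_split by blast
  obtain \<beta> \<gamma> where 2: "\<And>y z. \<beta>\<gamma> (y, z) = blinfun_apply \<beta> y + blinfun_apply \<gamma> z" using blinfun_prod_split by blast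
  have main: "\<alpha> (y - A w) + \<beta> (v - p) + \<gamma> (us - As p) - r \<le> r1 + r2 - xs u - xs w - xss (As p)"
    if "((u, us), r1) \<in> E1" "((y, v), r2) \<in> E2" for u us r1 y v r2 w p
    using \<phi>[of "(y - A w, v - p, us - As p)" "r1 + r2 - xs u - xs w - xss (As p)"] that
    unfolding E_def G_def by (force simp: 1 2 k k0_def B B0_def image_iff)
  obtain q where "q \<in> G" using D0 BG by auto
  then obtain u0 us0 r10 y0 v0 r20 where p1: "((u0, us0), r10) \<in> E1" and p2: "((y0, v0), r20) \<in> E2"
    unfolding G_def by (metis SigmaE surj_pair)
  \<comment> \<open>\<open>w\<close> ranges over the whole space, so its linear coefficient must
    vanish; \<open>p\<close> gives the second equation in the same way.\<close>
  have "adjoint_op A \<alpha> = xs"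
  proof (rule blinfun_eq_of_affine_le[symmetric])
    fix w show "xs w - (adjoint_op A \<alpha>) w \<le> r + r10 + r20 - xs u0 - \<alpha> y0 - \<beta> v0 - \<gamma> us0"
      using main[OF p1 p2, of w 0] by (simp add: blinfun.bilinear_simps)
  qed
  moreover have "adjoint_op As \<gamma> + \<beta> = adjoint_op As xss"
  proof (rule blinfun_eq_of_affine_le[symmetric])
    fix p show "adjoint_op As xss p - (adjoint_op As \<gamma> + \<beta>) p \<le> r + r10 + r20 - xs u0 - \<alpha> y0 - \<beta> v0 - \<gamma> us0"
      using main[OF p1 p2, of 0 p] by (simp add: blinfun.bilinear_simps)
  qed
  moreover have "\<exists>s t. (\<forall>a\<in>E1. (case a of ((u, us), r1) \<Rightarrow> xs u + \<gamma> us - r1) \<le> s)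
    \<and> (\<forall>b\<in>E2. (case b of ((y, v), r2) \<Rightarrow> \<alpha> y + \<beta> v - r2) \<le> t) \<and> s + t \<le> r"
  proof (rule split_bounded_sum)
    show "E1 \<noteq> {}" "E2 \<noteq> {}" using p1 p2 by auto
    fix a b assume "a \<in> E1" "b \<in> E2"
    then show "(case a of ((u, us), r1) \<Rightarrow> xs u + \<gamma> us - r1) + (case b of ((y, v), r2) \<Rightarrow> \<alpha> y + \<beta> v - r2) \<le> r"
      using main[of _ _ _ _ _ _ 0 0] by (force simp: blinfun.zero_right algebra_simps split: prod.splits)
  qed
  then obtain s t where "\<forall>a\<in>E1. (case a of ((u, us), r1) \<Rightarrow> xs u + \<gamma> us - r1) \<le> s"
    "\<forall>b\<in>E2. (case b of ((y, v), r2) \<Rightarrow> \<alpha> y + \<beta> v - r2) \<le> t" "s + t \<le> r" by blast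
  then have "conj_le E1 xs \<gamma> s" "conj_le E2 \<alpha> \<beta> t" "s + t \<le> r" by (auto simp: conj_le_def)
  ultimately show ?thesis unfolding As_def by blast
qed

section \<open>Splitting of the conjugate up to weak-star closure\<close>

lemma openin_prod_topology_rectangle:
  assumes "openin (prod_topology X Y) W" "(a, b) \<in> W"
  obtains U V where "openin X U" "openin Y V" "a \<in> U" "b \<in> V" "U \<times> V \<subseteq> W"
  using assms(1)[unfolded openin_prod_topology_alt, rule_format, OF assms(2)] by blast

lemma conj_le_combination:
  assumes "conj_le E f g s" "conj_le E f' g' s'" and uv: "0 \<le> u" "0 \<le> v" "u + v = 1"
  shows "conj_le E (u *\<^sub>R f + v *\<^sub>R f') (u *\<^sub>R g + v *\<^sub>R g') (u * s + v * s')"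
  unfolding conj_le_def
proof (intro allI impI)
  fix x xs r assume x: "((x, xs), r) \<in> E"
  have "u * (f x + g xs - r) + v * (f' x + g' xs - r) \<le> u * s + v * s'"
    using conj_leD[OF assms(1) x] conj_leD[OF assms(2) x] uv by (intro add_mono mult_left_mono) auto
  moreover have "u * r + v * r = r" using uv by (metis distrib_right mult_1)
  ultimately show "(u *\<^sub>R f + v *\<^sub>R f') x + (u *\<^sub>R g + v *\<^sub>R g') xs - r \<le> u * s + v * s'"
    by (simp add: blinfun.bilinear_simps algebra_simps)
qed

context strong_epigraph
begin

lemma mem_of_affine_minorants:
  assumes "\<And>f g s. conj_le E f g s \<Longrightarrow> f a + g b - s \<le> \<rho>"
  shows "((a, b), \<rho>) \<in> E"
proof (rule fenchel_moreau[OF convex_E closed_E])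
  show "E \<noteq> {}" using nonempty_E by auto
  show "\<exists>m. \<forall>r. (z, r) \<in> E \<longrightarrow> m \<le> r" for z using ge_coupling by (cases z) auto
  fix \<phi> :: "('a \<times> 'a dual) dual" and s assume *: "\<And>z r. (z, r) \<in> E \<Longrightarrow> \<phi> z - s \<le> r"
  obtain f g where fg: "\<And>x y. \<phi> (x, y) = blinfun_apply f x + blinfun_apply g y" using blinfun_prod_split by blast
  have "conj_le E f g s" unfolding conj_le_def
  proof (intro allI impI)
    fix x xs r assume "((x, xs), r) \<in> E"
    from *[OF this] show "f x + g xs - r \<le> s" by (simp add: fg)
  qed
  from assms[OF this] show "\<phi> (a, b) - s \<le> \<rho>" by (simp add: fg)
qed (rule up_E)

text \<open>Without any affine minorant the premise of \<open>mem_of_affine_minorants\<close> is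
  vacuous, and the point \<open>(0, 0)\<close> at height \<open>- 1\<close> would lie in
  \<open>E\<close> below the coupling.\<close>

lemma ex_conj_le: "\<exists>f g s. conj_le E f g s"
proof (rule ccontr)
  assume "\<not> ?thesis"
  then have "((0, 0), - 1) \<in> E" by (intro mem_of_affine_minorants) blast
  from ge_coupling[OF this] show False by simp
qed

end

text \<open>Otherwise a weak-star continuous functional separates \<open>P\<close> from
  \<open>D\<close>. It consists of predual points \<open>a\<close>, \<open>b\<close>,
  \<open>f\<close> and a multiplier \<open>\<tau>\<close> of the height; biconjugation turns the
  separation into points of \<open>parallel_epi\<close> at which \<open>le\<close> fails.\<close>

theorem parallel_conjugate_closure:
  fixes A :: "'x::banach \<Rightarrow>\<^sub>L 'y::banach"
    and E1 :: "(('x \<times> 'x dual) \<times> real) set" and E2 :: "(('y \<times> 'y dual) \<times> real) set"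
  assumes "strong_epigraph E1" "strong_epigraph E2"
    and dom: "((u0, adjoint_op A v0), \<rho>1) \<in> E1" "((A w0, v0), \<rho>2) \<in> E2"
    and le: "conj_le (parallel_epi A E1 E2) xs xss r"
  defines "D \<equiv> {(us, adjoint_op A vs, adjoint_op (adjoint_op A) uss + vss, t) | us uss vs vss t.
    \<exists>s1 s2. conj_le E1 us uss s1 \<and> conj_le E2 vs vss s2 \<and> s1 + s2 \<le> t}"
  shows "(xs, xs, adjoint_op (adjoint_op A) xss, r)
    \<in> prod_topology wstar (prod_topology wstar (prod_topology wstar euclideanreal)) closure_of D"
proof (rule ccontr)
  interpret E1: strong_epigraph E1 by fact
  interpret E2: strong_epigraph E2 by fact
  define As where "As = adjoint_op A"
  define Ass where "Ass = adjoint_op As"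
  define T :: "('x dual \<times> 'x dual \<times> 'y dual dual \<times> real) topology"
    where "T = prod_topology wstar (prod_topology wstar (prod_topology wstar euclideanreal))"
  define P where "P = (xs, xs, Ass xss, r)"
  assume "\<not> ?thesis"
  then have "P \<notin> T closure_of D" by (simp add: T_def P_def Ass_def As_def)
  moreover have "P \<in> topspace T" by (simp add: T_def P_def)
  ultimately obtain U where U: "openin T U" "P \<in> U" "U \<inter> D = {}"
    unfolding in_closure_of by blast
  obtain U1 U' where 1: "openin wstar U1" "openin (prod_topology wstar (prod_topology wstar euclideanreal)) U'"
    "xs \<in> U1" "(xs, Ass xss, r) \<in> U'" "U1 \<times> U' \<subseteq> U"
    by (rule openin_prod_topology_rectangle[OF U(1)[unfolded T_def] U(2)[unfolded P_def]])
  obtain U2 U'' where 2: "openin wstar U2" "openin (prod_topology wstar euclideanreal) U''"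
    "xs \<in> U2" "(Ass xss, r) \<in> U''" "U2 \<times> U'' \<subseteq> U'"
    by (rule openin_prod_topology_rectangle[OF 1(2,4)])
  obtain U3 V where 3: "openin wstar U3" "open V" "Ass xss \<in> U3" "r \<in> V" "U3 \<times> V \<subseteq> U''"
    by (rule openin_prod_topology_rectangle[OF 2(2,4), unfolded open_openin[symmetric]])
  obtain F1 e1 where F1: "finite F1" "0 < e1" "\<And>g. (\<forall>x\<in>F1. \<bar>blinfun_apply g x - xs x\<bar> < e1) \<Longrightarrow> g \<in> U1"
    using wstar_nhd_basis[OF 1(1,3)] by blast
  obtain F2 e2 where F2: "finite F2" "0 < e2" "\<And>g. (\<forall>x\<in>F2. \<bar>blinfun_apply g x - xs x\<bar> < e2) \<Longrightarrow> g \<in> U2"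
    using wstar_nhd_basis[OF 2(1,3)] by blast
  obtain F3 e3 where F3: "finite F3" "0 < e3" "\<And>g. (\<forall>x\<in>F3. \<bar>blinfun_apply g x - (Ass xss) x\<bar> < e3) \<Longrightarrow> g \<in> U3"
    using wstar_nhd_basis[OF 3(1,3)] by blast
  obtain e4 where e4: "0 < e4" "ball r e4 \<subseteq> V" using 3(2,4) by (auto elim: openE)
  define \<epsilon> where "\<epsilon> = min (min e1 e2) (min e3 e4)"
  have \<epsilon>: "0 < \<epsilon>" using F1 F2 F3 e4 by (simp add: \<epsilon>_def)
  define p1 where "p1 F g = (\<Sum>x\<in>F. \<bar>blinfun_apply g x\<bar>)" for F and g :: "'x dual"
  define p3 where "p3 g = (\<Sum>x\<in>F3. \<bar>blinfun_apply g x\<bar>)" for g :: "'y dual dual"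
  define p where "p = (\<lambda>(g1, g2, g3, t :: real). p1 F1 g1 + p1 F2 g2 + p3 g3 + \<bar>t\<bar>)"
  have p1_nn: "0 \<le> p1 F g" for F g by (simp add: p1_def sum_nonneg)
  have p3_nn: "0 \<le> p3 g" for g by (simp add: p3_def sum_nonneg)
  have p1_add: "p1 F (g + h) \<le> p1 F g + p1 F h" for F g h
    unfolding p1_def sum.distrib[symmetric] by (intro sum_mono) (simp add: blinfun.add_left)
  have p3_add: "p3 (g + h) \<le> p3 g + p3 h" for g h
    unfolding p3_def sum.distrib[symmetric] by (intro sum_mono) (simp add: blinfun.add_left)
  have p1_scale: "p1 F (c *\<^sub>R g) = c * p1 F g" if "0 \<le> c" for F g c
    using that by (simp add: p1_def blinfun.scaleR_left abs_mult sum_distrib_left)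
  have p3_scale: "p3 (c *\<^sub>R g) = c * p3 g" if "0 \<le> c" for g c
    using that by (simp add: p3_def blinfun.scaleR_left abs_mult sum_distrib_left)
  have DI: "(us, As vs, Ass uss + vss, t) \<in> D" if "conj_le E1 us uss s1" "conj_le E2 vs vss s2" "s1 + s2 \<le> t" for us uss vs vss s1 s2 t
    unfolding D_def As_def Ass_def using that by blast
  have "\<exists>\<phi>. linear \<phi> \<and> (\<forall>x. \<phi> x \<le> p x) \<and> (\<forall>d\<in>(+) (- P) ` D. \<epsilon> \<le> \<phi> d)"
  proof (rule convex_seminorm_separation)
    have "convex D"
    proof (rule convexI)
      fix a b and u v :: real assume "a \<in> D" "b \<in> D" and uv: "0 \<le> u" "0 \<le> v" "u + v = 1"
      then obtain us uss vs vss t s1 s2 us' uss' vs' vss' t' s1' s2' where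
        a: "a = (us, As vs, Ass uss + vss, t)" "conj_le E1 us uss s1" "conj_le E2 vs vss s2" "s1 + s2 \<le> t"
        and b: "b = (us', As vs', Ass uss' + vss', t')" "conj_le E1 us' uss' s1'" "conj_le E2 vs' vss' s2'" "s1' + s2' \<le> t'"
        unfolding D_def As_def Ass_def by blast
      have "u * (s1 + s2) + v * (s1' + s2') \<le> u * t + v * t'"
        using a(4) b(4) uv by (intro add_mono mult_left_mono) auto
      then have "(u *\<^sub>R us + v *\<^sub>R us', As (u *\<^sub>R vs + v *\<^sub>R vs'),
          Ass (u *\<^sub>R uss + v *\<^sub>R uss') + (u *\<^sub>R vss + v *\<^sub>R vss'), u * t + v * t') \<in> D"
        by (intro DI[OF conj_le_combination[OF a(2) b(2) uv] conj_le_combination[OF a(3) b(3) uv]])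
          (simp add: algebra_simps)
      then show "u *\<^sub>R a + v *\<^sub>R b \<in> D"
        unfolding a(1) b(1) by (simp add: blinfun.bilinear_simps algebra_simps)
    qed
    then show "convex ((+) (- P) ` D)" by (rule convex_translation)
    show "(+) (- P) ` D \<noteq> {}" using E1.ex_conj_le E2.ex_conj_le DI by blast
    show "p (x + y) \<le> p x + p y" for x y
    proof -
      obtain x1 x2 x3 x4 y1 y2 y3 y4 where "x = (x1, x2, x3, x4)" "y = (y1, y2, y3, y4)" by (metis surj_pair)
      then show ?thesis
        using p1_add[of F1 x1 y1] p1_add[of F2 x2 y2] p3_add[of x3 y3] by (simp add: p_def)
    qed
    show "p (c *\<^sub>R x) = c * p x" if "0 \<le> c" for c x
    proof -
      obtain x1 x2 x3 x4 where "x = (x1, x2, x3, x4)" by (rule prod_cases4)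
      then show ?thesis using that by (simp add: p_def p1_scale p3_scale abs_mult distrib_left)
    qed
    fix d assume "d \<in> (+) (- P) ` D"
    then obtain d' where d': "d = - P + d'" "d' \<in> D" by blast
    obtain g1 g2 g3 t where "d' = (g1, g2, g3, t)" by (rule prod_cases4)
    with d' have d: "d = - P + (g1, g2, g3, t)" "(g1, g2, g3, t) \<in> D" by simp_all
    have pd: "p d = p1 F1 (g1 - xs) + p1 F2 (g2 - xs) + p3 (g3 - Ass xss) + \<bar>t - r\<bar>"
      by (simp add: d p_def P_def)
    show "\<epsilon> \<le> p d"
    proof (rule ccontr)
      assume "\<not> \<epsilon> \<le> p d"
      then have lt: "p1 F1 (g1 - xs) < \<epsilon>" "p1 F2 (g2 - xs) < \<epsilon>" "p3 (g3 - Ass xss) < \<epsilon>" "\<bar>t - r\<bar> < \<epsilon>"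
        using p1_nn[of F1 "g1 - xs"] p1_nn[of F2 "g2 - xs"] p3_nn[of "g3 - Ass xss"] unfolding pd by linarith+
      have "\<bar>blinfun_apply g1 x - xs x\<bar> < e1" if "x \<in> F1" for x
        using member_le_sum[OF that, of "\<lambda>x. \<bar>blinfun_apply (g1 - xs) x\<bar>"] F1(1) lt(1)
        by (simp add: p1_def \<epsilon>_def blinfun.diff_left)
      then have g1: "g1 \<in> U1" using F1(3) by blast
      have "\<bar>blinfun_apply g2 x - xs x\<bar> < e2" if "x \<in> F2" for x
        using member_le_sum[OF that, of "\<lambda>x. \<bar>blinfun_apply (g2 - xs) x\<bar>"] F2(1) lt(2)
        by (simp add: p1_def \<epsilon>_def blinfun.diff_left)
      then have g2: "g2 \<in> U2" using F2(3) by blast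
      have "\<bar>blinfun_apply g3 x - (Ass xss) x\<bar> < e3" if "x \<in> F3" for x
        using member_le_sum[OF that, of "\<lambda>x. \<bar>blinfun_apply (g3 - Ass xss) x\<bar>"] F3(1) lt(3)
        by (simp add: p3_def \<epsilon>_def blinfun.diff_left)
      then have g3: "g3 \<in> U3" using F3(3) by blast
      have "t \<in> V" using lt(4) e4(2) by (auto simp: \<epsilon>_def dist_real_def subset_iff abs_minus_commute)
      then have "(g1, g2, g3, t) \<in> U" using g1 g2 g3 1(5) 2(5) 3(5) by blast
      then show False using d(2) U(3) by blast
    qed
  qed
  then obtain \<phi> where \<phi>: "linear \<phi>" and \<phi>p: "\<And>x. \<phi> x \<le> p x" and sep0: "\<forall>d\<in>(+) (- P) ` D. \<epsilon> \<le> \<phi> d"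
    by blast
  have sep: "\<phi> P + \<epsilon> \<le> \<phi> d" if "d \<in> D" for d
  proof -
    have "\<epsilon> \<le> \<phi> (- P + d)" using sep0 that by blast
    then show ?thesis unfolding linear_add[OF \<phi>] linear_neg[OF \<phi>] by simp
  qed
  have lin: "linear (\<lambda>g. \<phi> (g, 0, 0, 0))" "linear (\<lambda>g. \<phi> (0, g, 0, 0))" "linear (\<lambda>g. \<phi> (0, 0, g, 0))"
    by (rule linear_compose[OF _ \<phi>, unfolded o_def], rule linearI; simp)+
  have "\<exists>a. \<forall>g. \<phi> (g, 0, 0, 0) = blinfun_apply g a"
    by (rule evaluation_of_weak_star_bound[OF F1(1) lin(1)])
      (use \<phi>p[of "(_, 0, 0, 0)"] in \<open>simp add: p_def p1_def p3_def\<close>)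
  then obtain a where a: "\<And>g. \<phi> (g, 0, 0, 0) = blinfun_apply g a" by blast
  have "\<exists>a. \<forall>g. \<phi> (0, g, 0, 0) = blinfun_apply g a"
    by (rule evaluation_of_weak_star_bound[OF F2(1) lin(2)])
      (use \<phi>p[of "(0, _, 0, 0)"] in \<open>simp add: p_def p1_def p3_def\<close>)
  then obtain b where b: "\<And>g. \<phi> (0, g, 0, 0) = blinfun_apply g b" by blast
  have "\<exists>a. \<forall>g. \<phi> (0, 0, g, 0) = blinfun_apply g a"
    by (rule evaluation_of_weak_star_bound[OF F3(1) lin(3)])
      (use \<phi>p[of "(0, 0, _, 0)"] in \<open>simp add: p_def p1_def p3_def\<close>)
  then obtain f where f: "\<And>g. \<phi> (0, 0, g, 0) = blinfun_apply g f" by blast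
  define \<tau> where "\<tau> = \<phi> (0, 0, 0, 1)"
  have \<phi>_eq: "\<phi> (g1, g2, g3, t) = g1 a + g2 b + g3 f + t * \<tau>" for g1 g2 g3 t
  proof -
    have "(g1, g2, g3, t) = (g1, 0, 0, 0) + (0, g2, 0, 0) + (0, 0, g3, 0) + t *\<^sub>R (0, 0, 0, 1)" by simp
    then have "\<phi> (g1, g2, g3, t) = \<phi> (g1, 0, 0, 0) + \<phi> (0, g2, 0, 0) + \<phi> (0, 0, g3, 0) + t * \<phi> (0, 0, 0, 1)"
      by (simp only: linear_add[OF \<phi>] linear_cmul[OF \<phi>] real_scaleR_def)
    then show ?thesis by (simp add: a b f \<tau>_def)
  qed
  define c where "c = xs a + xs b + xss (As f)"
  have sep': "c + \<tau> * r + \<epsilon> \<le> us a + vs (A b) + uss (As f) + vss f + \<tau> * t"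
    if "conj_le E1 us uss s1" "conj_le E2 vs vss s2" "s1 + s2 \<le> t" for us uss vs vss s1 s2 t
    using sep[OF DI[OF that]]
    by (simp add: P_def \<phi>_eq c_def Ass_def As_def blinfun.add_left algebra_simps)
  obtain us1 uss1 s1 where c1: "conj_le E1 us1 uss1 s1" using E1.ex_conj_le by blast
  obtain vs1 vss1 s2 where c2: "conj_le E2 vs1 vss1 s2" using E2.ex_conj_le by blast
  \<comment> \<open>Heights in \<open>D\<close> can be raised at will, so a negative multiplier
    would violate \<open>sep'\<close>.\<close>
  have \<tau>: "0 \<le> \<tau>"
  proof (rule ccontr)
    assume "\<not> 0 \<le> \<tau>"
    define C where "C = us1 a + vs1 (A b) + uss1 (As f) + vss1 f + \<tau> * (s1 + s2) - (c + \<tau> * r + \<epsilon>)"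
    define n where "n = (\<bar>C\<bar> + 1) / - \<tau>"
    have n: "0 < n" "n * \<tau> = - (\<bar>C\<bar> + 1)" using \<open>\<not> 0 \<le> \<tau>\<close> by (auto simp: n_def field_simps)
    have "0 \<le> C + n * \<tau>"
      using sep'[OF c1 c2, of "s1 + s2 + n"] n(1) by (simp add: C_def algebra_simps)
    then show False using n(2) by simp
  qed
  define M where "M = r - xs (u0 + w0) - xss (As v0) + \<rho>1 + \<rho>2"
  have bound: "k * \<epsilon> \<le> M" if k: "0 \<le> k" for k
  proof -
    define \<sigma> where "\<sigma> = 1 + k * \<tau>"
    have \<sigma>: "0 < \<sigma>" using k \<tau> by (simp add: \<sigma>_def add_pos_nonneg)
    define R where "R = \<rho>1 + \<rho>2 - k * (c + \<tau> * r + \<epsilon>)"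
    define u' w' v' where "u' = (1 / \<sigma>) *\<^sub>R (u0 - k *\<^sub>R a)" and "w' = (1 / \<sigma>) *\<^sub>R (w0 - k *\<^sub>R b)"
      and "v' = (1 / \<sigma>) *\<^sub>R (v0 - k *\<^sub>R f)"
    have sum: "(us u' + uss (As v') - s) + (vs (A w') + vss v' - t) \<le> R / \<sigma>"
      if s: "conj_le E1 us uss s" and t: "conj_le E2 vs vss t" for us uss s vs vss t
    proof -
      have "us u0 + uss (As v0) - \<rho>1 \<le> s" using conj_leD[OF s dom(1)] by (simp add: As_def)
      moreover have "vs (A w0) + vss v0 - \<rho>2 \<le> t" using conj_leD[OF t dom(2)] by simp
      moreover have "k * (c + \<tau> * r + \<epsilon>) \<le> k * (us a + vs (A b) + uss (As f) + vss f + \<tau> * (s + t))"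
        using sep'[OF s t order_refl] k by (rule mult_left_mono)
      ultimately have "us (u0 - k *\<^sub>R a) + uss (As (v0 - k *\<^sub>R f)) + vs (A (w0 - k *\<^sub>R b)) + vss (v0 - k *\<^sub>R f) - \<sigma> * (s + t) \<le> R"
        unfolding R_def \<sigma>_def by (simp add: blinfun.bilinear_simps algebra_simps)
      then have "(us (u0 - k *\<^sub>R a) + uss (As (v0 - k *\<^sub>R f)) + vs (A (w0 - k *\<^sub>R b)) + vss (v0 - k *\<^sub>R f) - \<sigma> * (s + t)) / \<sigma> \<le> R / \<sigma>"
        using \<sigma> by (intro divide_right_mono) auto
      then show ?thesis using \<sigma>
        unfolding u'_def w'_def v'_def blinfun.scaleR_right by (simp add: diff_divide_distrib add_divide_distrib)
    qed
    have "\<exists>s t. (\<forall>a\<in>{(us, uss, s). conj_le E1 us uss s}. (case a of (us, uss, s0) \<Rightarrow> us u' + uss (As v') - s0) \<le> s)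
       \<and> (\<forall>b\<in>{(vs, vss, t). conj_le E2 vs vss t}. (case b of (vs, vss, t0) \<Rightarrow> vs (A w') + vss v' - t0) \<le> t) \<and> s + t \<le> R / \<sigma>"
      by (rule split_bounded_sum) (use sum c1 c2 in \<open>auto split: prod.splits\<close>)
    then obtain s t where s: "\<And>us uss s0. conj_le E1 us uss s0 \<Longrightarrow> us u' + uss (As v') - s0 \<le> s"
      and t: "\<And>vs vss t0. conj_le E2 vs vss t0 \<Longrightarrow> vs (A w') + vss v' - t0 \<le> t" and st: "s + t \<le> R / \<sigma>" by auto
    have "((u', As v'), s) \<in> E1" by (rule E1.mem_of_affine_minorants) (rule s)
    moreover have "((A w', v'), t) \<in> E2" by (rule E2.mem_of_affine_minorants) (rule t)
    ultimately have "((u' + w', As v'), s + t) \<in> parallel_epi A E1 E2" unfolding As_def by (rule parallel_epiI)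
    from conj_leD[OF le this] st have "xs (u' + w') + xss (As v') \<le> r + R / \<sigma>" by simp
    then have "\<sigma> * (xs (u' + w') + xss (As v')) \<le> \<sigma> * (r + R / \<sigma>)" using \<sigma> by (intro mult_left_mono) auto
    moreover have "\<sigma> * (xs (u' + w') + xss (As v')) = xs (u0 + w0) + xss (As v0) - k * c"
      using \<sigma> unfolding u'_def w'_def v'_def c_def
      by (simp add: blinfun.bilinear_simps algebra_simps flip: scaleR_add_right)
    moreover have "\<sigma> * (r + R / \<sigma>) = r + k * \<tau> * r + R" using \<sigma> by (simp add: distrib_left) (simp add: \<sigma>_def algebra_simps)
    ultimately show ?thesis by (simp add: R_def M_def algebra_simps)
  qed
  have "(\<bar>M\<bar> + 1) / \<epsilon> * \<epsilon> \<le> M" by (rule bound) (use \<epsilon> in simp)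
  then show False using \<epsilon> by simp
qed

section \<open>The parallel sum\<close>

lemma mem_epi: "(p, r) \<in> epi h \<longleftrightarrow> h p \<le> ereal r"
  by (simp add: epi_def)

lemma epi_upward: "(p, r) \<in> epi h \<Longrightarrow> r \<le> r' \<Longrightarrow> (p, r') \<in> epi h"
  unfolding mem_epi by (erule order_trans) simp

lemma fconj_le_iff: "fconj h (f, g) \<le> ereal s \<longleftrightarrow> conj_le (epi h) f g s"
proof -
  have *: "ereal a - h p \<le> ereal s \<longleftrightarrow> (\<forall>r. h p \<le> ereal r \<longrightarrow> a - r \<le> s)" for a p
  proof (cases "h p")
    case MInf
    have "\<not> (\<forall>r. a - r \<le> s)" by (auto intro!: exI[of _ "a - s - 1"])
    then show ?thesis using MInf by simp
  qed (auto intro: order_trans)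
  have "fconj h (f, g) \<le> ereal s \<longleftrightarrow> (\<forall>p. ereal (f (fst p) + g (snd p)) - h p \<le> ereal s)"
    by (simp add: fconj_def SUP_le_iff)
  then show ?thesis unfolding * by (simp add: conj_le_def epi_def)
qed

lemma ereal_le_iff_real_upper: "ereal c \<le> z \<longleftrightarrow> (\<forall>r. z \<le> ereal r \<longrightarrow> c \<le> r)"
proof (cases z)
  case MInf
  then show ?thesis by (auto intro!: exI[of _ "c - 1"])
qed (auto intro: order_trans)

lemma strong_representative_imp_strong_epigraph:
  assumes "strong_representative S h"
  shows "strong_epigraph (epi h)"
proof
  have h: "convex (epi h)" "closed (epi h)" "\<And>x xs. ereal (blinfun_apply xs x) \<le> h (x, xs)"
    "\<And>f g. ereal (blinfun_apply g f) \<le> fconj h (f, g)"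
    using assms by (auto simp: strong_representative_def representative_def)
  show "convex (epi h)" "closed (epi h)" by fact+
  show "(p, r') \<in> epi h" if "(p, r) \<in> epi h" "r \<le> r'" for p r r' using that by (rule epi_upward)
  show "xs x \<le> r" if "((x, xs), r) \<in> epi h" for x xs r
    using that h(3)[of xs x] unfolding epi_def ereal_le_iff_real_upper by auto
  show "g f \<le> s" if "conj_le (epi h) f g s" for f g s
    using that h(4)[of g f] unfolding fconj_le_iff[symmetric] ereal_le_iff_real_upper by auto
qed

lemma strong_epigraph_imp_strong_representative:
  assumes "strong_epigraph (epi h)" and S: "S = strong_epigraph.contact (epi h)"
  shows "strong_representative S h"
proof -
  interpret strong_epigraph "epi h" by fact
  have ge: "ereal (blinfun_apply xs x) \<le> h (x, xs)" for x xs
    unfolding ereal_le_iff_real_upper using ge_coupling by (auto simp: epi_def)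
  moreover have "h (x, xs) = ereal (blinfun_apply xs x)" if "(x, xs) \<in> S" for x xs
    using that ge[of xs x] by (simp add: S contact_def mem_epi antisym)
  moreover have "ereal (blinfun_apply g f) \<le> fconj h (f, g)" for f g
    unfolding ereal_le_iff_real_upper fconj_le_iff using conj_ge_coupling by blast
  ultimately show ?thesis
    unfolding strong_representative_def representative_def using convex_E closed_E by auto
qed

text \<open>\<open>h\<close> equals the coupling on \<open>S\<close>, so \<open>S\<close> is
  contained in the contact set, which is monotone; maximality leaves only equality.\<close>

lemma maximal_eq_contact:
  assumes S: "maximal_monotone S" and h: "strong_representative S h"
  shows "S = strong_epigraph.contact (epi h)"
proof -
  interpret strong_epigraph "epi h" by (rule strong_representative_imp_strong_epigraph[OF h])
  have "S \<subseteq> contact"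
    using h unfolding strong_representative_def representative_def contact_def by (auto simp: mem_epi)
  then show ?thesis using S contact_monotone unfolding maximal_monotone_def by blast
qed

text \<open>Every neighbourhood counted by \<open>nhds p\<close> contains \<open>p\<close>, so this
  lower limit takes the value at \<open>p\<close> into account and describes the closure of the
  whole epigraph.\<close>

lemma epi_lsc_hull: "epi (lsc_hull h) = closure (epi h)"
proof (intro set_eqI iffI)
  fix z assume z: "z \<in> epi (lsc_hull h)"
  obtain p r where pr: "z = (p, r)" by (cases z)
  show "z \<in> closure (epi h)"
  proof (rule ccontr)
    assume "z \<notin> closure (epi h)"
    then obtain W where W: "open W" "(p, r) \<in> W" "W \<inter> epi h = {}"
      unfolding pr closure_iff_nhds_not_empty by blast
    obtain U V where UV: "open U" "open V" "(p, r) \<in> U \<times> V" "U \<times> V \<subseteq> W"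
      by (rule open_prod_elim[OF W(1,2)])
    then obtain e where e: "0 < e" "ball r e \<subseteq> V" by (auto elim: openE)
    have "ereal (r + e / 2) \<le> h q" if "q \<in> U" for q
    proof (rule ccontr)
      assume "\<not> ereal (r + e / 2) \<le> h q"
      then have "(q, r + e / 2) \<in> epi h" by (simp add: epi_def)
      moreover have "r + e / 2 \<in> V" using e by (auto simp: subset_iff dist_real_def)
      ultimately show False using UV(4) W(3) that by blast
    qed
    then have "\<forall>\<^sub>F q in nhds p. ereal (r + e / 2) \<le> h q"
      using UV(1,3) unfolding eventually_nhds by blast
    then have "ereal (r + e / 2) \<le> lsc_hull h p" unfolding lsc_hull_def by (rule Liminf_bounded)
    also have "\<dots> \<le> ereal r" using z by (simp add: pr epi_def)
    finally show False using e(1) by simp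
  qed
next
  fix z assume z: "z \<in> closure (epi h)"
  obtain p r where pr: "z = (p, r)" by (cases z)
  have "lsc_hull h p \<le> ereal r"
  proof (rule ccontr)
    assume "\<not> ?thesis"
    then obtain y where y: "ereal r < ereal y" "ereal y < Liminf (nhds p) h"
      using ereal_dense2 unfolding lsc_hull_def by (metis not_le)
    then obtain U where U: "open U" "p \<in> U" "\<And>q. q \<in> U \<Longrightarrow> ereal y < h q"
      using less_LiminfD[OF y(2)] unfolding eventually_nhds by blast
    have "open (U \<times> {..<y})" "(p, r) \<in> U \<times> {..<y}" using U y(1) by (auto intro: open_Times)
    then have "(U \<times> {..<y}) \<inter> epi h \<noteq> {}" using z unfolding pr closure_iff_nhds_not_empty by blast
    then obtain q t where "q \<in> U" "t < y" "h q \<le> ereal t" by (auto simp: epi_def)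
    then show False using U(3)[of q] by (metis ereal_less(2) ereal_less_eq(3) leD less_imp_le order_trans)
  qed
  then show "z \<in> epi (lsc_hull h)" by (simp add: pr epi_def)
qed

section \<open>The epigraph of the infimal convolution\<close>

lemma convex_parallel_epi:
  assumes "convex E1" "convex E2"
  shows "convex (parallel_epi A E1 E2)"
proof (rule convexI)
  fix a b and c d :: real
  assume "a \<in> parallel_epi A E1 E2" "b \<in> parallel_epi A E1 E2" and cd: "0 \<le> c" "0 \<le> d" "c + d = 1"
  then obtain u w vs r1 r2 u' w' vs' r1' r2' where
    a: "a = ((u + w, adjoint_op A vs), r1 + r2)" "((u, adjoint_op A vs), r1) \<in> E1" "((A w, vs), r2) \<in> E2"
    and b: "b = ((u' + w', adjoint_op A vs'), r1' + r2')" "((u', adjoint_op A vs'), r1') \<in> E1" "((A w', vs'), r2') \<in> E2"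
    unfolding parallel_epi_def by blast
  have "((c *\<^sub>R u + d *\<^sub>R u', adjoint_op A (c *\<^sub>R vs + d *\<^sub>R vs')), c * r1 + d * r1') \<in> E1"
    using convexD[OF assms(1) a(2) b(2) cd] by (simp add: blinfun.bilinear_simps)
  moreover have "((A (c *\<^sub>R w + d *\<^sub>R w'), c *\<^sub>R vs + d *\<^sub>R vs'), c * r2 + d * r2') \<in> E2"
    using convexD[OF assms(2) a(3) b(3) cd] by (simp add: blinfun.bilinear_simps)
  ultimately have "(((c *\<^sub>R u + d *\<^sub>R u') + (c *\<^sub>R w + d *\<^sub>R w'), adjoint_op A (c *\<^sub>R vs + d *\<^sub>R vs')),
      (c * r1 + d * r1') + (c * r2 + d * r2')) \<in> parallel_epi A E1 E2" by (rule parallel_epiI)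
  then show "c *\<^sub>R a + d *\<^sub>R b \<in> parallel_epi A E1 E2"
    unfolding a(1) b(1) by (simp add: blinfun.bilinear_simps algebra_simps)
qed

lemma closure_epi_inf_conv1:
  assumes lower: "\<And>p. hS p \<noteq> - \<infinity>" "\<And>p. hT p \<noteq> - \<infinity>"
  shows "closure (epi (inf_conv1 A hS hT)) = closure (parallel_epi A (epi hS) (epi hT))"
proof (intro antisym closure_minimal closed_closure)
  have "parallel_epi A (epi hS) (epi hT) \<subseteq> epi (inf_conv1 A hS hT)"
  proof
    fix z assume "z \<in> parallel_epi A (epi hS) (epi hT)"
    then obtain u w vs r1 r2 where z: "z = ((u + w, adjoint_op A vs), r1 + r2)"
      "hS (u, adjoint_op A vs) \<le> ereal r1" "hT (A w, vs) \<le> ereal r2"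
      unfolding parallel_epi_def epi_def by blast
    have "inf_conv1 A hS hT (u + w, adjoint_op A vs) \<le> hS (u, adjoint_op A vs) + hT (A w, vs)"
      unfolding inf_conv1_def by (auto intro!: INF_lower2[of "(u, w, vs)"])
    also have "\<dots> \<le> ereal r1 + ereal r2" using z by (intro add_mono)
    finally show "z \<in> epi (inf_conv1 A hS hT)" by (simp add: z(1) epi_def)
  qed
  then show "parallel_epi A (epi hS) (epi hT) \<subseteq> closure (epi (inf_conv1 A hS hT))"
    using closure_subset by blast
  show "epi (inf_conv1 A hS hT) \<subseteq> closure (parallel_epi A (epi hS) (epi hT))"
  proof
    fix z assume z: "z \<in> epi (inf_conv1 A hS hT)"
    obtain x xs r where zx: "z = ((x, xs), r)" by (metis surj_pair)
    have "\<exists>y\<in>parallel_epi A (epi hS) (epi hT). dist y z < e" if e: "0 < e" for e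
    proof -
      have "inf_conv1 A hS hT (x, xs) < ereal (r + e / 2)"
        using z e by (auto simp: zx epi_def intro: le_less_trans)
      then obtain u w vs where uw: "u + w = x" "adjoint_op A vs = xs"
        and less: "hS (u, xs) + hT (A w, vs) < ereal (r + e / 2)"
        unfolding inf_conv1_def by (auto simp: INF_less_iff)
      \<comment> \<open>Neither summand is negative infinity and the sum is below a real number, so
        both are real. All the slack then goes into the first height.\<close>
      obtain r1 r2 where r: "hS (u, xs) = ereal r1" "hT (A w, vs) = ereal r2"
        using less lower(1)[of "(u, xs)"] lower(2)[of "(A w, vs)"]
        by (cases "hS (u, xs)"; cases "hT (A w, vs)") auto
      have "((u + w, adjoint_op A vs), (r + e / 2 - r2) + r2) \<in> parallel_epi A (epi hS) (epi hT)"
        using less r uw by (intro parallel_epiI) (auto simp: epi_def)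
      then have "((x, xs), r + e / 2) \<in> parallel_epi A (epi hS) (epi hT)" by (simp add: uw)
      moreover have "dist ((x, xs), r + e / 2) z < e" using e by (simp add: zx dist_Pair_Pair dist_real_def)
      ultimately show ?thesis by blast
    qed
    then show "z \<in> closure (parallel_epi A (epi hS) (epi hT))" by (simp add: closure_approachable)
  qed
qed

lemma conj_le_closure: "conj_le (closure E) f g s \<longleftrightarrow> conj_le E f g s"
proof
  assume le: "conj_le E f g s"
  define H where "H = {z. f (fst (fst z)) + g (snd (fst z)) - snd z \<le> s}"
  have "closed H" unfolding H_def by (intro closed_Collect_le continuous_intros)
  moreover have "E \<subseteq> H" using le by (auto simp: H_def conj_le_def)
  ultimately have "closure E \<subseteq> H" by (simp add: closure_minimal)
  then show "conj_le (closure E) f g s" by (auto simp: H_def conj_le_def)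
qed (use closure_subset in \<open>fastforce simp: conj_le_def\<close>)

text \<open>\<open>exact\<close> is the common outcome of the two qualification conditions: the
  conjugate of the infimal convolution is the sum of the two conjugates, with an attained
  decomposition.\<close>

locale exact_parallel_sum = E1: strong_epigraph E1 + E2: strong_epigraph E2
  for E1 :: "(('x::banach \<times> 'x dual) \<times> real) set" and E2 :: "(('y::banach \<times> 'y dual) \<times> real) set" +
  fixes A :: "'x \<Rightarrow>\<^sub>L 'y"
  assumes exact: "conj_le (parallel_epi A E1 E2) xs xss r \<Longrightarrow>
    \<exists>uss vs vss s t. adjoint_op A vs = xs \<and> adjoint_op (adjoint_op A) uss + vss = adjoint_op (adjoint_op A) xss
      \<and> conj_le E1 xs uss s \<and> conj_le E2 vs vss t \<and> s + t \<le> r"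
begin

lemma strong_epigraph_closure: "strong_epigraph (closure (parallel_epi A E1 E2))"
proof
  show "convex (closure (parallel_epi A E1 E2))"
    by (intro convex_closure convex_parallel_epi E1.convex_E E2.convex_E)
  show "closed (closure (parallel_epi A E1 E2))" by simp
next
  fix p :: "'x \<times> 'x dual" and r r' :: real
  assume p: "(p, r) \<in> closure (parallel_epi A E1 E2)" and "r \<le> r'"
  have "(+) (0, r' - r) ` parallel_epi A E1 E2 \<subseteq> parallel_epi A E1 E2"
  proof (rule image_subsetI)
    fix z assume "z \<in> parallel_epi A E1 E2"
    then obtain u w vs r1 r2 where *: "z = ((u + w, adjoint_op A vs), r1 + r2)"
      "((u, adjoint_op A vs), r1) \<in> E1" "((A w, vs), r2) \<in> E2"
      unfolding parallel_epi_def by blast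
    have "((u + w, adjoint_op A vs), r1 + (r2 + (r' - r))) \<in> parallel_epi A E1 E2"
      using * \<open>r \<le> r'\<close> by (intro parallel_epiI) (auto intro: E2.up_E)
    then show "(0, r' - r) + z \<in> parallel_epi A E1 E2" by (simp add: *(1) ac_simps)
  qed
  then have "closure ((+) (0, r' - r) ` parallel_epi A E1 E2) \<subseteq> closure (parallel_epi A E1 E2)"
    by (rule closure_mono)
  then have "(0, r' - r) + (p, r) \<in> closure (parallel_epi A E1 E2)"
    using p unfolding closure_translation by blast
  then show "(p, r') \<in> closure (parallel_epi A E1 E2)" by simp
next
  fix x xs r assume x: "((x, xs), r) \<in> closure (parallel_epi A E1 E2)"
  define H where "H = {z :: ('x \<times> 'x dual) \<times> real. blinfun_apply (snd (fst z)) (fst (fst z)) \<le> snd z}"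
  have "closed H" unfolding H_def by (intro closed_Collect_le continuous_intros)
  moreover have "parallel_epi A E1 E2 \<subseteq> H"
  proof
    fix z assume "z \<in> parallel_epi A E1 E2"
    then obtain u w vs r1 r2 where *: "z = ((u + w, adjoint_op A vs), r1 + r2)"
      "((u, adjoint_op A vs), r1) \<in> E1" "((A w, vs), r2) \<in> E2"
      unfolding parallel_epi_def by blast
    then show "z \<in> H"
      using E1.ge_coupling[OF *(2)] E2.ge_coupling[OF *(3)] by (simp add: H_def blinfun.add_right)
  qed
  ultimately have "closure (parallel_epi A E1 E2) \<subseteq> H" by (simp add: closure_minimal)
  then show "xs x \<le> r" using x by (auto simp: H_def)
next
  fix f g s assume "conj_le (closure (parallel_epi A E1 E2)) f g s"
  then obtain uss vs vss s' t where *: "adjoint_op A vs = f"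
    "adjoint_op (adjoint_op A) uss + vss = adjoint_op (adjoint_op A) g"
    "conj_le E1 f uss s'" "conj_le E2 vs vss t" "s' + t \<le> s"
    unfolding conj_le_closure using exact by blast
  \<comment> \<open>Evaluated at \<open>vs\<close>, the equation in the bidual of the second space
    says that the coupling of \<open>g\<close> and \<open>f\<close> is the sum of the couplings of
    the two pieces.\<close>
  have "(adjoint_op (adjoint_op A) uss + vss) vs = (adjoint_op (adjoint_op A) g) vs" using *(2) by simp
  then have "g f = uss f + vss vs" by (simp add: *(1) blinfun.add_left)
  then show "g f \<le> s" using E1.conj_ge_coupling[OF *(3)] E2.conj_ge_coupling[OF *(4)] *(5) by simp
qed

text \<open>A contact point gives the conjugate bound \<open>xs x\<close> at \<open>canon x\<close>.
  After splitting, each part is at least its coupling while the couplings add up to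
  \<open>xs x\<close>; so both are equalities, which puts the pieces into the Gossez closures.
  Conversely, the two equalities add up on \<open>parallel_epi\<close>, and maximality
  applies.\<close>

lemma contact_closure:
  "strong_epigraph.contact (closure (parallel_epi A E1 E2)) = par_sum A E1.contact E2.contact"
proof -
  interpret P: strong_epigraph "closure (parallel_epi A E1 E2)" by (rule strong_epigraph_closure)
  have "(x, xs) \<in> P.contact \<longleftrightarrow> (x, xs) \<in> par_sum A E1.contact E2.contact" for x xs
  proof
    assume x: "(x, xs) \<in> P.contact"
    have "(canon x, xs) \<in> gossez_closure P.contact"
      using P.contact_monotone x unfolding monotone_op_def gossez_closure_def by (fastforce simp flip: canon_diff)
    then have "conj_le (parallel_epi A E1 E2) xs (canon x) (xs x)"
      unfolding P.gossez_closure_contact_iff conj_le_closure by simp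
    then obtain uss vs vss s t where *: "adjoint_op A vs = xs"
      "adjoint_op (adjoint_op A) uss + vss = adjoint_op (adjoint_op A) (canon x)"
      "conj_le E1 xs uss s" "conj_le E2 vs vss t" "s + t \<le> xs x"
      using exact by blast
    \<comment> \<open>The second equation places \<open>vss\<close> in the range of the biadjoint;
      its preimage \<open>canon x - uss\<close> is the second summand that \<open>par_sum\<close>
      asks for.\<close>
    have vss: "vss = adjoint_op (adjoint_op A) (canon x - uss)"
      using *(2) by (simp add: blinfun.diff_right algebra_simps)
    have "vss vs = xs x - uss xs" unfolding vss by (simp add: *(1) blinfun.diff_left)
    then have "s = uss xs" "t = vss vs"
      using E1.conj_ge_coupling[OF *(3)] E2.conj_ge_coupling[OF *(4)] *(5) by auto
    then have "(uss, xs) \<in> gossez_closure E1.contact" "(vss, vs) \<in> gossez_closure E2.contact"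
      using *(3,4) by (auto simp: E1.gossez_closure_contact_iff E2.gossez_closure_contact_iff)
    then show "(x, xs) \<in> par_sum A E1.contact E2.contact"
      unfolding par_sum_def vss using *(1)
      by (intro CollectI case_prodI exI[of _ uss] exI[of _ "canon x - uss"] exI[of _ vs]) auto
  next
    assume "(x, xs) \<in> par_sum A E1.contact E2.contact"
    then obtain uss vss ys where x: "canon x = uss + vss" and "(uss, xs) \<in> gossez_closure E1.contact"
      "(adjoint_op (adjoint_op A) vss, ys) \<in> gossez_closure E2.contact" and ys: "adjoint_op A ys = xs"
      unfolding par_sum_def by blast
    then have 1: "conj_le E1 xs uss (uss xs)" and 2: "conj_le E2 ys (adjoint_op (adjoint_op A) vss) (vss xs)"
      by (auto simp: E1.gossez_closure_contact_iff E2.gossez_closure_contact_iff)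
    have x': "blinfun_apply f x = uss f + vss f" for f
      using x by (metis canon_apply blinfun.add_left)
    have "conj_le (parallel_epi A E1 E2) xs (canon x) (xs x)"
      unfolding conj_le_def
    proof (intro allI impI)
      fix z zs r assume "((z, zs), r) \<in> parallel_epi A E1 E2"
      then obtain u w vs r1 r2 where z: "z = u + w" "zs = adjoint_op A vs" "r = r1 + r2"
        "((u, adjoint_op A vs), r1) \<in> E1" "((A w, vs), r2) \<in> E2"
        unfolding parallel_epi_def by blast
      have "xs w = ys (A w)" using ys by auto
      then show "xs z + canon x zs - r \<le> xs x"
        using conj_leD[OF 1 z(4)] conj_leD[OF 2 z(5)] by (simp add: z(1-3) x' blinfun.add_right)
    qed
    then have "(canon x, xs) \<in> gossez_closure P.contact"
      unfolding P.gossez_closure_contact_iff conj_le_closure by simp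
    then have "monotone_op (insert (x, xs) P.contact)"
      using P.contact_monotone unfolding monotone_op_def gossez_closure_def
      by (auto simp flip: canon_diff) (fastforce simp: blinfun.bilinear_simps)+
    then show "(x, xs) \<in> P.contact" using P.contact_maximal unfolding maximal_monotone_def by blast
  qed
  then show ?thesis by auto
qed

end

theorem theorem3p1:
  fixes S :: "('x::banach \<times> 'x dual) set" and T :: "('y::banach \<times> 'y dual) set"
    and hS :: "'x \<times> 'x dual \<Rightarrow> ereal" and hT :: "'y \<times> 'y dual \<Rightarrow> ereal"
    and A :: "'x \<Rightarrow>\<^sub>L 'y"
  assumes X_nonzero: "\<exists>x::'x. x \<noteq> 0" and Y_nonzero: "\<exists>y::'y. y \<noteq> 0"
    and S_D: "gossez_D S" and T_D: "gossez_D T"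
    and hS_strong: "strong_representative S hS" and hT_strong: "strong_representative T hT"
    and nonempty: "{(y, ys, xs). (y, ys) \<in> edom hT \<and> xs \<in> snd ` edom hS}
                   \<inter> {(blinfun_apply A w, ys, blinfun_apply (adjoint_op A) ys) | w ys. True} \<noteq> {}"
    and qual: "(0, 0, 0) \<in> ic (set_minus {(y, ys, xs). (y, ys) \<in> edom hT \<and> xs \<in> snd ` edom hS}
                   {(blinfun_apply A w, ys, blinfun_apply (adjoint_op A) ys) | w ys. True})
             \<or> closed_regarding (prod_topology wstar (prod_topology wstar (prod_topology wstar euclideanreal)))
                 {(us, blinfun_apply (adjoint_op A) vs,
                   blinfun_apply (adjoint_op (adjoint_op A)) uss + vss, r) | us uss vs vss r.
                    fconj hS (us, uss) + fconj hT (vs, vss) \<le> ereal r}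
                 {(xs, xs, blinfun_apply (adjoint_op (adjoint_op A)) xss, r) | xs xss r. True}"
  shows "strong_representative (par_sum A S T) (lsc_hull (inf_conv1 A hS hT))
         \<and> gossez_D (par_sum A S T)"
proof -
  interpret E1: strong_epigraph "epi hS" by (rule strong_representative_imp_strong_epigraph[OF hS_strong])
  interpret E2: strong_epigraph "epi hT" by (rule strong_representative_imp_strong_epigraph[OF hT_strong])
  have S: "S = E1.contact" by (rule maximal_eq_contact[OF _ hS_strong]) (use S_D in \<open>simp add: gossez_D_def\<close>)
  have T: "T = E2.contact" by (rule maximal_eq_contact[OF _ hT_strong]) (use T_D in \<open>simp add: gossez_D_def\<close>)
  have gt: "hS p \<noteq> - \<infinity>" "hT q \<noteq> - \<infinity>" for p q
    using hS_strong hT_strong unfolding strong_representative_def representative_def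
    by (metis ereal_infty_less_eq(2) MInfty_neq_ereal(1) surj_pair)+
  have edom_iff: "p \<in> edom h \<longleftrightarrow> (\<exists>r. (p, r) \<in> epi h)" if "\<And>p. h p \<noteq> - \<infinity>" for h :: "'z \<Rightarrow> ereal" and p
    using that[of p] by (cases "h p") (auto simp: edom_def epi_def)
  obtain w0 v0 u0 where dom: "(A w0, v0) \<in> edom hT" "(u0, adjoint_op A v0) \<in> edom hS" using nonempty by auto
  obtain \<rho>1 \<rho>2 where \<rho>: "((u0, adjoint_op A v0), \<rho>1) \<in> epi hS" "((A w0, v0), \<rho>2) \<in> epi hT"
    using dom gt by (auto simp: edom_iff)
  interpret exact_parallel_sum "epi hS" "epi hT" A
  proof
    fix xs xss r assume le: "conj_le (parallel_epi A (epi hS) (epi hT)) xs xss r"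
    from qual show "\<exists>uss vs vss s t. adjoint_op A vs = xs
      \<and> adjoint_op (adjoint_op A) uss + vss = adjoint_op (adjoint_op A) xss
      \<and> conj_le (epi hS) xs uss s \<and> conj_le (epi hT) vs vss t \<and> s + t \<le> r"
    proof
      define D where "D = set_minus {(y, ys, xs). (y, ys) \<in> edom hT \<and> xs \<in> snd ` edom hS}
                   {(blinfun_apply A w, ys, blinfun_apply (adjoint_op A) ys) | w ys. True}"
      assume "(0, 0, 0) \<in> ic (set_minus {(y, ys, xs). (y, ys) \<in> edom hT \<and> xs \<in> snd ` edom hS}
                   {(blinfun_apply A w, ys, blinfun_apply (adjoint_op A) ys) | w ys. True})"
      then have "0 \<in> ic D" by (simp add: D_def zero_prod_def)
      then have aff: "closed (affine hull D)" and core: "0 \<in> icr D" by (auto simp: ic_def split: if_splits)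
      \<comment> \<open>The projection of the domain of \<open>hS\<close> is unfolded into a witness
        \<open>u\<close>, and finiteness into heights, to fit the constraint map of
        \<open>parallel_conjugate_interior\<close>.\<close>
      have D: "D = {(y - A w, v - p, us - adjoint_op A p) | u us r1 y v r2 w p.
        ((u, us), r1) \<in> epi hS \<and> ((y, v), r2) \<in> epi hT}"
      proof (intro set_eqI iffI)
        fix z assume "z \<in> D"
        then obtain y v us w p u where z: "z = (y - A w, v - p, us - adjoint_op A p)" "(y, v) \<in> edom hT" "(u, us) \<in> edom hS"
          unfolding D_def set_minus_def by auto
        then obtain r1 r2 where "((u, us), r1) \<in> epi hS" "((y, v), r2) \<in> epi hT" using gt by (auto simp: edom_iff)
        then show "z \<in> {(y - A w, v - p, us - adjoint_op A p) | u us r1 y v r2 w p.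
          ((u, us), r1) \<in> epi hS \<and> ((y, v), r2) \<in> epi hT}" using z(1) by blast
      next
        fix z assume "z \<in> {(y - A w, v - p, us - adjoint_op A p) | u us r1 y v r2 w p.
          ((u, us), r1) \<in> epi hS \<and> ((y, v), r2) \<in> epi hT}"
        then obtain u us r1 y v r2 w p where z: "z = (y - A w, v - p, us - adjoint_op A p)"
          "((u, us), r1) \<in> epi hS" "((y, v), r2) \<in> epi hT" by blast
        then have "(u, us) \<in> edom hS" "(y, v) \<in> edom hT" using gt by (auto simp: edom_iff)
        then show "z \<in> D"
          unfolding D_def set_minus_def z(1)
          by (intro CollectI exI[of _ "(y, v, us)"] exI[of _ "(A w, p, adjoint_op A p)"]) force
      qed
      have "(A w0 - A w0, v0 - v0, adjoint_op A v0 - adjoint_op A v0) \<in> D" unfolding D using \<rho> by blast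
      then have "0 \<in> D" by (simp add: zero_prod_def)
      then show ?thesis
        by (rule parallel_conjugate_interior[OF E1.convex_E E1.closed_E E2.convex_E E2.closed_E D aff _ core le])
    next
      define D where "D = {(us, adjoint_op A vs, adjoint_op (adjoint_op A) uss + vss, t) | us uss vs vss t.
        \<exists>s1 s2. conj_le (epi hS) us uss s1 \<and> conj_le (epi hT) vs vss s2 \<and> s1 + s2 \<le> t}"
      have sum_iff: "fconj hS (us, uss) + fconj hT (vs, vss) \<le> ereal t
        \<longleftrightarrow> (\<exists>s1 s2. conj_le (epi hS) us uss s1 \<and> conj_le (epi hT) vs vss s2 \<and> s1 + s2 \<le> t)" for us uss vs vss t
      proof
        assume *: "fconj hS (us, uss) + fconj hT (vs, vss) \<le> ereal t"
        \<comment> \<open>Both conjugates dominate the coupling and so exceed negative infinity; a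
          sum with a real upper bound therefore has two real summands.\<close>
        have "fconj hS (us, uss) \<noteq> - \<infinity>" "fconj hT (vs, vss) \<noteq> - \<infinity>"
          using hS_strong hT_strong unfolding strong_representative_def
          by (metis ereal_infty_less_eq(2) MInfty_neq_ereal(1))+
        then obtain s1 s2 where "fconj hS (us, uss) = ereal s1" "fconj hT (vs, vss) = ereal s2"
          using * by (cases "fconj hS (us, uss)"; cases "fconj hT (vs, vss)") auto
        then show "\<exists>s1 s2. conj_le (epi hS) us uss s1 \<and> conj_le (epi hT) vs vss s2 \<and> s1 + s2 \<le> t"
          using * by (intro exI[of _ s1] exI[of _ s2]) (simp flip: fconj_le_iff)
      next
        assume "\<exists>s1 s2. conj_le (epi hS) us uss s1 \<and> conj_le (epi hT) vs vss s2 \<and> s1 + s2 \<le> t"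
        then obtain s1 s2 where "fconj hS (us, uss) \<le> ereal s1" "fconj hT (vs, vss) \<le> ereal s2" "s1 + s2 \<le> t"
          unfolding fconj_le_iff by blast
        then show "fconj hS (us, uss) + fconj hT (vs, vss) \<le> ereal t"
          using add_mono[of "fconj hS (us, uss)" "ereal s1" "fconj hT (vs, vss)" "ereal s2"]
          by (auto intro: order_trans)
      qed
      assume "closed_regarding (prod_topology wstar (prod_topology wstar (prod_topology wstar euclideanreal)))
                 {(us, blinfun_apply (adjoint_op A) vs,
                   blinfun_apply (adjoint_op (adjoint_op A)) uss + vss, r) | us uss vs vss r.
                    fconj hS (us, uss) + fconj hT (vs, vss) \<le> ereal r}
                 {(xs, xs, blinfun_apply (adjoint_op (adjoint_op A)) xss, r) | xs xss r. True}"
      then have "closed_regarding (prod_topology wstar (prod_topology wstar (prod_topology wstar euclideanreal))) D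
                 {(xs, xs, blinfun_apply (adjoint_op (adjoint_op A)) xss, r) | xs xss r. True}"
        unfolding sum_iff D_def .
      moreover have "(xs, xs, adjoint_op (adjoint_op A) xss, r)
          \<in> prod_topology wstar (prod_topology wstar (prod_topology wstar euclideanreal)) closure_of D"
        unfolding D_def
        by (rule parallel_conjugate_closure[OF E1.strong_epigraph_axioms E2.strong_epigraph_axioms \<rho> le])
      \<comment> \<open>The point lies in the closure and in the reference set, so condition (b)
        puts it into \<open>D\<close> itself. Its two equal entries then give \<open>us = xs\<close>
        and \<open>adjoint_op A vs = xs\<close> at once.\<close>
      ultimately have "(xs, xs, adjoint_op (adjoint_op A) xss, r) \<in> D"
        unfolding closed_regarding_def by blast
      then show ?thesis unfolding D_def by (elim CollectE exE conjE) (metis prod.inject)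
    qed
  qed
  have epi: "epi (lsc_hull (inf_conv1 A hS hT)) = closure (parallel_epi A (epi hS) (epi hT))"
    unfolding epi_lsc_hull by (rule closure_epi_inf_conv1[OF gt])
  have strong: "strong_epigraph (epi (lsc_hull (inf_conv1 A hS hT)))"
    unfolding epi by (rule strong_epigraph_closure)
  have eq: "par_sum A S T = strong_epigraph.contact (epi (lsc_hull (inf_conv1 A hS hT)))"
    unfolding epi contact_closure S T ..
  show ?thesis
    using strong_epigraph_imp_strong_representative[OF strong eq] strong_epigraph.contact_gossez_D[OF strong]
    unfolding eq by blast
qed

end
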